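(* Assume that $0<\mu<\min\{N,4\}$. For $\lambda\in\mathbb{R}$ and $\rho\in\mathbb{L}^2_\mu$ let $\hat u(\lambda,\rho)\in W$ denote a principal solution (determined up to its sign) of $$-\Delta u+V(x)u-S[\rho]u+\left(|x|^{-\mu}\ast|u|^2\right)u=\lambda u\quad\text{in }\mathbb{R}^N$$ if $\lambda>\lambda_1(\rho)$, and $\hat u(\lambda,\rho)=0$ if $\lambda\le\lambda_1(\rho)$. (i) Let $\bar\rho\in\mathbb{L}^2_\mu$, $\lambda\ge\lambda_1(\bar\rho)$, and suppose $\rho_n\to\bar\rho$ in $\mathbb{L}^2_\mu$ as $n\to\infty$. Then there exist a subsequence, still denoted by $(\rho_n)$, and a solution $\hat u(\lambda,\bar\rho)$ of the equation with kernel $\bar\rho$ such that $$\hat u(\lambda,\rho_n)\to\hat u(\lambda,\bar\rho)\quad\text{in }W\text{ as }n\to+\infty.$$ Moreover, if $\lambda>\lambda_1(\bar\rho)$, then $\hat u(\lambda,\bar\rho)$ is a principal solution; if $\lambda=\lambda_1(\bar\rho)$, then $\hat u(\lambda,\bar\rho)=0$. (ii) Let $\bar\rho\in\mathbb{L}^2_\mu$ and suppose $\lambda_n\to\lambda\in[\lambda_1(\bar\rho),+\infty)$ as $n\to\infty$. Then there exist a subsequence, still denoted by $(\lambda_n)$, and a solution $\hat u(\lambda,\bar\rho)$ of the equation with kernel $\bar\rho$ such that $$\hat u(\lambda_n,\bar\rho)\to\hat u(\lambda,\bar\rho)\quad\text{in }W\text{ as }n\to+\infty.$$ Moreover, if $\lambda>\lambda_1(\bar\rho)$,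 then $\hat u(\lambda,\bar\rho)$ is a principal solution; if $\lambda=\lambda_1(\bar\rho)$, then $\hat u(\lambda,\bar\rho)=0$. (iii) The following continuity properties hold (with $\hat u$ regarded as an element of $W$ modulo sign): - for any $\bar\rho\in\mathbb{L}^2_\mu$ and any $\lambda\ge\lambda_1(\bar\rho)$, the map $\mathbb{L}^2_\mu\ni\rho\mapsto\hat u(\lambda,\rho)\in W$ is continuous at $\bar\rho$; - for any $\bar\rho\in\mathbb{L}^2_\mu$, the map $\hat u(\cdot,\bar\rho):[\lambda_1(\bar\rho),+\infty)\to W$ is continuous.
   Context: $N\ge 1$ is an integer. The potential $V\in C(\mathbb{R}^N)$ is real-valued with $\lim_{|x|\to\infty}V(x)=+\infty$ and $V(x)\ge a_V>0$ for all $x$, for some constant $a_V$. $\mathbb{L}^2_\mu=\mathbb{L}^2_\mu(\mathbb{R}^N\times\mathbb{R}^N)$ is the space of (classes of) real measurable symmetric kernels $\rho(x,y)=\rho(y,x)$ with finite norm $$\|\rho\|_{\mathbb{L}^2_\mu}^2=\int_{\mathbb{R}^N}\int_{\mathbb{R}^N}\frac{|\rho(x,y)|^2}{|x-y|^\mu}\,dx\,dy.$$ Exchange potential: $S[\rho]u(x)=\int_{\mathbb{R}^N}\frac{\rho(x,y)u(y)}{|x-y|^\mu}\,dy$. Convolution: $(|x|^{-\mu}\ast|u|^2)(x)=\int_{\mathbb{R}^N}\frac{|u(y)|^2}{|x-y|^\mu}\,dy$. All functions are real-valued. $W$ is the space of $u\in W^{1,2}(\mathbb{R}^N)$ with $\int_{\mathbb{R}^N}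 V u^2\,dx<\infty$, with norm $\|u\|_W=\left(\int_{\mathbb{R}^N}(|\nabla u|^2+V|u|^2)\,dx\right)^{1/2}$. Solutions are weak (distributional) solutions in $W$. "Modulo sign" means identifying $u$ with $-u$, with distance $\min\{\|u-v\|_W,\|u+v\|_W\}$. $\mathcal{L}[\rho]:=-\Delta+V-S[\rho]$ is the associated self-adjoint operator, with quadratic form $(\mathcal{L}[\rho]\psi,\psi)=\int(|\nabla\psi|^2+V\psi^2)\,dx-\iint\frac{\rho(x,y)\psi(x)\psi(y)}{|x-y|^\mu}\,dx\,dy$, and principal (lowest) eigenvalue $$\lambda_1(\rho)=\inf_{\psi\in C_0^\infty(\mathbb{R}^N)\setminus\{0\}}\frac{(\mathcal{L}[\rho]\psi,\psi)}{(\psi,\psi)},$$ where $(\cdot,\cdot)$ is the $L^2$ inner product. A principal eigenfunction of $\mathcal{L}[\rho]$ is an eigenfunction (in the weak sense, in $W$) associated with $\lambda_1(\rho)$. A weak solution $\hat u\in W$, $\hat u\neq0$, of the equation with kernel $\rho$ and parameter $\lambda$ is called principal if $\hat u/\|\hat u\|_{L^2}$ is a principal eigenfunction of $\mathcal{L}[\hat\rho]$ associated with the eigenvalue $\lambda$ (so $\lambda=\lambda_1(\hat\rho)$), where $\hat\rho(x,y)=\rho(x,y)-\hat u(x)\hat u(y)$ a.e. in $\mathbb{R}^N\times\mathbb{R}^N$. *)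

theory Defs
  imports "HOL-Analysis.Analysis"
begin

text \<open>
  The space R^N is a type \<open>'a :: euclidean_space\<close> with N = \<open>DIM('a)\<close>.  Elements of the function and
  kernel spaces are represented by Borel functions (every class of Lebesgue measurable functions
  has a Borel representative), so "zero" means zero almost everywhere and "nonzero" its negation.
\<close>

subsection \<open>Test functions and the Sobolev space\<close>

primrec Ck_fun :: "nat \<Rightarrow> ('a::euclidean_space \<Rightarrow> real) \<Rightarrow> bool" where
  "Ck_fun 0 f \<longleftrightarrow> continuous_on UNIV f"
| "Ck_fun (Suc k) f \<longleftrightarrow>
     (\<forall>x. f differentiable (at x)) \<and> (\<forall>v. Ck_fun k (\<lambda>x. frechet_derivative f (at x) v))"

definition test_function :: "('a::euclidean_space \<Rightarrow> real) \<Rightarrow> bool" where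
  "test_function \<phi> \<longleftrightarrow> (\<forall>k. Ck_fun k \<phi>) \<and> compact (closure {x. \<phi> x \<noteq> 0})"

definition square_integrable :: "('a::euclidean_space \<Rightarrow> 'b::euclidean_space) \<Rightarrow> bool" where
  "square_integrable f \<longleftrightarrow> f \<in> borel_measurable borel \<and> integrable lborel (\<lambda>x. (norm (f x))\<^sup>2)"

definition L2_norm :: "('a::euclidean_space \<Rightarrow> real) \<Rightarrow> real" where
  "L2_norm u = sqrt (LINT x|lborel. (u x)\<^sup>2)"

definition is_weak_gradient :: "('a::euclidean_space \<Rightarrow> real) \<Rightarrow> ('a \<Rightarrow> 'a) \<Rightarrow> bool" where
  "is_weak_gradient u G \<longleftrightarrow>
     (\<forall>\<phi>. test_function \<phi> \<longrightarrow> (\<forall>b\<in>Basis.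
        (LINT x|lborel. u x * frechet_derivative \<phi> (at x) b) = - (LINT x|lborel. (G x \<bullet> b) * \<phi> x)))"

definition W12 :: "('a::euclidean_space \<Rightarrow> real) set" where
  "W12 = {u. square_integrable u \<and> (\<exists>G. square_integrable G \<and> is_weak_gradient u G)}"

text \<open>
  For \<open>u \<in> W12\<close> the choice below is unique up to null sets, and for test functions it agrees almost
  everywhere with the classical gradient.
\<close>

definition weak_grad :: "('a::euclidean_space \<Rightarrow> real) \<Rightarrow> 'a \<Rightarrow> 'a" where
  "weak_grad u = (SOME G. square_integrable G \<and> is_weak_gradient u G)"

definition W_space :: "('a::euclidean_space \<Rightarrow> real) \<Rightarrow> ('a \<Rightarrow> real) set" where
  "W_space V = {u \<in> W12. integrable lborel (\<lambda>x. V x * (u x)\<^sup>2)}"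

definition W_norm :: "('a::euclidean_space \<Rightarrow> real) \<Rightarrow> ('a \<Rightarrow> real) \<Rightarrow> real" where
  "W_norm V u = sqrt (LINT x|lborel. (norm (weak_grad u x))\<^sup>2 + V x * (u x)\<^sup>2)"

definition W_dist_mod_sign ::
    "('a::euclidean_space \<Rightarrow> real) \<Rightarrow> ('a \<Rightarrow> real) \<Rightarrow> ('a \<Rightarrow> real) \<Rightarrow> real" where
  "W_dist_mod_sign V u v = min (W_norm V (\<lambda>x. u x - v x)) (W_norm V (\<lambda>x. u x + v x))"

definition ae_zero :: "('a::euclidean_space \<Rightarrow> real) \<Rightarrow> bool" where
  "ae_zero u \<longleftrightarrow> (AE x in lborel. u x = 0)"

subsection \<open>Kernels\<close>

text \<open>
  On the diagonal, where \<open>norm (x - y) powr \<mu> = 0\<close>, the quotients are 0 by convention; the diagonal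
  is a null set of \<open>'a \<times> 'a\<close>.
\<close>

definition L2_mu :: "real \<Rightarrow> ('a::euclidean_space \<Rightarrow> 'a \<Rightarrow> real) set" where
  "L2_mu \<mu> = {\<rho>. (\<lambda>(x, y). \<rho> x y) \<in> borel_measurable borel
      \<and> (AE (x, y) in lborel. \<rho> x y = \<rho> y x)
      \<and> integrable lborel (\<lambda>(x, y). (\<rho> x y)\<^sup>2 / norm (x - y) powr \<mu>)}"

definition L2_mu_norm :: "real \<Rightarrow> ('a::euclidean_space \<Rightarrow> 'a \<Rightarrow> real) \<Rightarrow> real" where
  "L2_mu_norm \<mu> \<rho> = sqrt (LINT p|lborel. (case p of (x, y) \<Rightarrow> (\<rho> x y)\<^sup>2 / norm (x - y) powr \<mu>))"

definition exchange ::
    "real \<Rightarrow> ('a::euclidean_space \<Rightarrow> 'a \<Rightarrow> real) \<Rightarrow> ('a \<Rightarrow> real) \<Rightarrow> 'a \<Rightarrow> real" where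
  "exchange \<mu> \<rho> u x = (LINT y|lborel. \<rho> x y * u y / norm (x - y) powr \<mu>)"

definition hartree :: "real \<Rightarrow> ('a::euclidean_space \<Rightarrow> real) \<Rightarrow> 'a \<Rightarrow> real" where
  "hartree \<mu> u x = (LINT y|lborel. (u y)\<^sup>2 / norm (x - y) powr \<mu>)"

subsection \<open>The linear operator and its principal eigenvalue\<close>

definition quad_form ::
    "('a::euclidean_space \<Rightarrow> real) \<Rightarrow> real \<Rightarrow> ('a \<Rightarrow> 'a \<Rightarrow> real) \<Rightarrow> ('a \<Rightarrow> real) \<Rightarrow> real" where
  "quad_form V \<mu> \<rho> \<psi> =
     (LINT x|lborel. (norm (weak_grad \<psi> x))\<^sup>2 + V x * (\<psi> x)\<^sup>2)
     - (LINT p|lborel. (case p of (x, y) \<Rightarrow> \<rho> x y * \<psi> x * \<psi> y / norm (x - y) powr \<mu>))"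

definition lambda1 ::
    "('a::euclidean_space \<Rightarrow> real) \<Rightarrow> real \<Rightarrow> ('a \<Rightarrow> 'a \<Rightarrow> real) \<Rightarrow> real" where
  "lambda1 V \<mu> \<rho> =
     (INF \<psi>\<in>{\<psi>. test_function \<psi> \<and> \<psi> \<noteq> (\<lambda>_. 0)}. quad_form V \<mu> \<rho> \<psi> / (LINT x|lborel. (\<psi> x)\<^sup>2))"

definition weak_eigenfunction ::
    "('a::euclidean_space \<Rightarrow> real) \<Rightarrow> real \<Rightarrow> ('a \<Rightarrow> 'a \<Rightarrow> real) \<Rightarrow> real \<Rightarrow> ('a \<Rightarrow> real) \<Rightarrow> bool" where
  "weak_eigenfunction V \<mu> \<rho> lam \<psi> \<longleftrightarrow>
     \<psi> \<in> W_space V \<and> \<not> ae_zero \<psi> \<and>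
     (\<forall>\<phi>. test_function \<phi> \<longrightarrow>
        (LINT x|lborel. weak_grad \<psi> x \<bullet> weak_grad \<phi> x + V x * \<psi> x * \<phi> x - exchange \<mu> \<rho> \<psi> x * \<phi> x)
        = lam * (LINT x|lborel. \<psi> x * \<phi> x))"

definition principal_eigenfunction ::
    "('a::euclidean_space \<Rightarrow> real) \<Rightarrow> real \<Rightarrow> ('a \<Rightarrow> 'a \<Rightarrow> real) \<Rightarrow> ('a \<Rightarrow> real) \<Rightarrow> bool" where
  "principal_eigenfunction V \<mu> \<rho> \<psi> \<longleftrightarrow> weak_eigenfunction V \<mu> \<rho> (lambda1 V \<mu> \<rho>) \<psi>"

subsection \<open>The nonlinear equation\<close>

definition weak_solution ::
    "('a::euclidean_space \<Rightarrow> real) \<Rightarrow> real \<Rightarrow> real \<Rightarrow> ('a \<Rightarrow> 'a \<Rightarrow> real) \<Rightarrow> ('a \<Rightarrow> real) \<Rightarrow> bool" where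
  "weak_solution V \<mu> lam \<rho> u \<longleftrightarrow>
     u \<in> W_space V \<and>
     (\<forall>\<phi>. test_function \<phi> \<longrightarrow>
        (LINT x|lborel. weak_grad u x \<bullet> weak_grad \<phi> x + V x * u x * \<phi> x
             - exchange \<mu> \<rho> u x * \<phi> x + hartree \<mu> u x * u x * \<phi> x)
        = lam * (LINT x|lborel. u x * \<phi> x))"

definition principal_solution ::
    "('a::euclidean_space \<Rightarrow> real) \<Rightarrow> real \<Rightarrow> real \<Rightarrow> ('a \<Rightarrow> 'a \<Rightarrow> real) \<Rightarrow> ('a \<Rightarrow> real) \<Rightarrow> bool" where
  "principal_solution V \<mu> lam \<rho> u \<longleftrightarrow>
     weak_solution V \<mu> lam \<rho> u \<and> \<not> ae_zero u \<and>
     (let \<rho>' = (\<lambda>x y. \<rho> x y - u x * u y) in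
        lambda1 V \<mu> \<rho>' = lam \<and> principal_eigenfunction V \<mu> \<rho>' (\<lambda>x. u x / L2_norm u))"

text \<open>
  \<open>is_uhat V \<mu> lam \<rho> u\<close> says that u is an admissible value of the (sign-ambiguous) expression
  \<open>uhat(lam, \<rho>)\<close>.  It is a relation rather than a chosen function, so that the sign at each
  \<open>(lam, \<rho>)\<close> is arbitrary and existence of a principal solution is not presupposed.
\<close>

definition is_uhat ::
    "('a::euclidean_space \<Rightarrow> real) \<Rightarrow> real \<Rightarrow> real \<Rightarrow> ('a \<Rightarrow> 'a \<Rightarrow> real) \<Rightarrow> ('a \<Rightarrow> real) \<Rightarrow> bool" where
  "is_uhat V \<mu> lam \<rho> u \<longleftrightarrow>
     (if lam > lambda1 V \<mu> \<rho> then principal_solution V \<mu> lam \<rho> u else u \<in> W_space V \<and> ae_zero u)"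

end

theory Submission
  imports Defs "HOL-Library.Diagonal_Subsequence"
begin

text \<open>
  Call \<open>u\<close> extremal for \<open>(\<lambda>, \<rho>)\<close> if it solves the equation tested with all of \<open>W\<close> and the quadratic form of
  \<open>\<L>[\<rho> - u \<otimes> u]\<close> is at least \<open>\<lambda>\<close> times the squared \<open>L\<^sup>2\<close> norm.  This is equivalent to being a value of
  \<open>uhat\<close>, whether \<open>\<lambda>\<close> lies above \<open>\<lambda>\<^sub>1(\<rho>)\<close> or not.

  Uniqueness up to sign: inserting one extremal function into the form inequality of the other
  and adding the two results gives \<open>\<parallel>u \<otimes> u - v \<otimes> v\<parallel>\<^sup>2 \<le> 0\<close> in the kernel space.

  Compactness: the quartic Hartree energy together with \<open>V \<longlonglongrightarrow> \<infinity>\<close> bounds extremal functions in \<open>W\<close>, so a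
  subsequence converges in \<open>L\<^sup>2\<close>.  Testing the difference of two equations with the difference \<open>w\<close> of
  their solutions gives convergence in \<open>W\<close>, since \<open>\<parallel>w \<otimes> u\<parallel>\<close> tends to 0: for \<open>\<mu> < min N 4\<close> there is room
  for a slightly larger exponent near the diagonal.  Being extremal passes to the limit.

  The kernel bound \<open>\<parallel>u \<otimes> v\<parallel> \<le> C * \<parallel>u\<parallel> * \<parallel>v\<parallel>\<close> comes from Hardy's inequality, applied once in each variable
  if \<open>\<mu> > 2\<close>.
\<close>

section \<open>Square integrable functions\<close>

text \<open>Extremality mentions neither \<open>lambda1\<close> nor nontriviality, and both of its
  conditions are built from L2 pairings that survive limits. Sequences along which lam crosses the
  principal eigenvalue thus need no separate treatment; \<open>lambda1\<close> returns in the
  equivalence with \<open>is_uhat\<close>.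

  The definitions test with smooth compactly supported functions, whereas the estimates test with
  solutions and their differences. Density of test functions in \<open>W\<close>, by cutoff and
  mollification, is therefore the hinge: it carries weak equations, form inequalities and kernel
  bounds over to \<open>W\<close>.

  The threshold min N 4 is that of Hardy's inequality: an exponent m must be below N, each
  application lowers it by 2, and there are two variables to use. Hardy's inequality itself is
  weighted Cauchy-Schwarz along rays, integrated by Tonelli and scaling; the same one-dimensional
  inequality along segments gives the translation estimate behind compactness.

  All norms become plain L2 norms, of the gradient paired with sqrt V times u for \<open>W\<close>
  and of weighted functions of two variables for kernels, so one small L2 calculus serves
  both.\<close>

definition L2n :: "('a::euclidean_space \<Rightarrow> 'b::euclidean_space) \<Rightarrow> real" where
  "L2n f = sqrt (LINT x|lborel. (norm (f x))\<^sup>2)"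

definition L2ip :: "('a::euclidean_space \<Rightarrow> 'b::euclidean_space) \<Rightarrow> ('a \<Rightarrow> 'b) \<Rightarrow> real" where
  "L2ip f g = (LINT x|lborel. f x \<bullet> g x)"

lemma sqi_meas: "square_integrable f \<Longrightarrow> f \<in> borel_measurable borel"
  by (simp add: square_integrable_def)

lemma sqi_integrable: "square_integrable f \<Longrightarrow> integrable lborel (\<lambda>x. (norm (f x))\<^sup>2)"
  by (simp add: square_integrable_def)

lemma sqi_real_iff:
  "square_integrable (f :: 'a::euclidean_space \<Rightarrow> real) \<longleftrightarrow>
     f \<in> borel_measurable borel \<and> integrable lborel (\<lambda>x. (f x)\<^sup>2)"
  by (simp add: square_integrable_def)

lemma L2n_nonneg [simp]: "0 \<le> L2n f"
  by (simp add: L2n_def)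

lemma L2n_sq: "(L2n f)\<^sup>2 = (LINT x|lborel. (norm (f x))\<^sup>2)"
  by (simp add: L2n_def)

lemma L2n_real_sq: "(L2n (f :: 'a::euclidean_space \<Rightarrow> real))\<^sup>2 = (LINT x|lborel. (f x)\<^sup>2)"
  by (simp add: L2n_def)

lemma L2_norm_eq: "L2_norm u = L2n u"
  by (simp add: L2_norm_def L2n_def)

lemma L2n_cong: "(\<And>x. norm (f x) = norm (g x)) \<Longrightarrow> L2n f = L2n g"
  by (simp add: L2n_def)

lemma L2n_minus_commute: "L2n (\<lambda>x. f x - g x) = L2n (\<lambda>x. g x - f x)"
  by (rule L2n_cong) (rule norm_minus_commute)

lemma sqi_bound:
  assumes "square_integrable g" "f \<in> borel_measurable borel" "AE x in lborel. norm (f x) \<le> norm (g x)"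
  shows "square_integrable f" "L2n f \<le> L2n g"
proof -
  have *: "AE x in lborel. (norm (f x))\<^sup>2 \<le> (norm (g x))\<^sup>2"
    using assms(3) by eventually_elim (auto intro: power_mono)
  have m[measurable]: "f \<in> borel_measurable borel" by fact
  have i: "integrable lborel (\<lambda>x. (norm (f x))\<^sup>2)"
    by (rule Bochner_Integration.integrable_bound[OF sqi_integrable[OF assms(1)]])
       (use * in auto)
  then show "square_integrable f" using assms by (simp add: square_integrable_def)
  show "L2n f \<le> L2n g"
    unfolding L2n_def
    by (intro real_sqrt_le_mono integral_mono_AE i sqi_integrable assms *)
qed

lemma sqi_cong_AE:
  assumes "square_integrable g" "f \<in> borel_measurable borel" "AE x in lborel. f x = g x"
  shows "square_integrable f" "L2n f = L2n g"
proof -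
  have m: "g \<in> borel_measurable borel" using assms sqi_meas by auto
  show s: "square_integrable f"
    by (rule sqi_bound[OF assms(1,2)]) (use assms(3) in eventually_elim, auto)
  have "L2n f \<le> L2n g"
    by (rule sqi_bound(2)[OF assms(1,2)]) (use assms(3) in eventually_elim, auto)
  moreover have "L2n g \<le> L2n f"
    by (rule sqi_bound(2)[OF s m]) (use assms(3) in eventually_elim, auto)
  ultimately show "L2n f = L2n g" by simp
qed

lemma sqi_nn:
  assumes "f \<in> borel_measurable borel" "(\<integral>\<^sup>+x. ennreal ((norm (f x))\<^sup>2) \<partial>lborel) \<le> ennreal c" "0 \<le> c"
  shows "square_integrable f" "(L2n f)\<^sup>2 \<le> c"
proof -
  have m[measurable]: "f \<in> borel_measurable borel" by fact
  have i: "integrable lborel (\<lambda>x. (norm (f x))\<^sup>2)"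
    by (rule integrableI_bounded) (use assms in \<open>auto simp: le_less_trans\<close>)
  then show "square_integrable f" using assms by (simp add: square_integrable_def)
  have "ennreal (LINT x|lborel. (norm (f x))\<^sup>2) \<le> ennreal c"
    using assms(2) nn_integral_eq_integral[OF i] by simp
  then show "(L2n f)\<^sup>2 \<le> c" using assms(3) by (simp add: L2n_sq)
qed

lemma nn_L2n:
  assumes "square_integrable f"
  shows "(\<integral>\<^sup>+x. ennreal ((norm (f x))\<^sup>2) \<partial>lborel) = ennreal ((L2n f)\<^sup>2)"
  using nn_integral_eq_integral[OF sqi_integrable[OF assms]] by (simp add: L2n_sq)

lemma sqi_scaleR:
  assumes "square_integrable f"
  shows "square_integrable (\<lambda>x. c *\<^sub>R f x)" "L2n (\<lambda>x. c *\<^sub>R f x) = \<bar>c\<bar> * L2n f"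
  using assms
  by (auto simp: square_integrable_def power_mult_distrib L2n_def real_sqrt_mult)

lemma sqi_mult:
  fixes f :: "'a::euclidean_space \<Rightarrow> real"
  assumes "square_integrable f"
  shows "square_integrable (\<lambda>x. c * f x)" "L2n (\<lambda>x. c * f x) = \<bar>c\<bar> * L2n f"
  using sqi_scaleR[OF assms, of c] by simp_all

lemma sqi_minus:
  assumes "square_integrable f"
  shows "square_integrable (\<lambda>x. - f x)" "L2n (\<lambda>x. - f x) = L2n f"
  using assms by (auto simp: square_integrable_def L2n_def)

lemma sqi_add:
  assumes "square_integrable f" "square_integrable g"
  shows "square_integrable (\<lambda>x. f x + g x)"
proof -
  have [measurable]: "f \<in> borel_measurable borel" "g \<in> borel_measurable borel"
    using assms sqi_meas by auto
  have le: "(norm (f x + g x))\<^sup>2 \<le> 2 * (norm (f x))\<^sup>2 + 2 * (norm (g x))\<^sup>2" for x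
  proof -
    have "(norm (f x + g x))\<^sup>2 \<le> (norm (f x) + norm (g x))\<^sup>2"
      by (intro power_mono norm_triangle_ineq) auto
    also have "\<dots> \<le> 2 * (norm (f x))\<^sup>2 + 2 * (norm (g x))\<^sup>2"
      using sum_squares_bound[of "norm (f x)" "norm (g x)"] by (simp add: power2_sum)
    finally show ?thesis .
  qed
  have "integrable lborel (\<lambda>x. (norm (f x + g x))\<^sup>2)"
    by (rule Bochner_Integration.integrable_bound[where f = "\<lambda>x. 2 * (norm (f x))\<^sup>2 + 2 * (norm (g x))\<^sup>2"])
       (use sqi_integrable[OF assms(1)] sqi_integrable[OF assms(2)] le in auto)
  then show ?thesis by (simp add: square_integrable_def)
qed

lemma sqi_diff:
  assumes "square_integrable f" "square_integrable g"
  shows "square_integrable (\<lambda>x. f x - g x)"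
  using sqi_add[OF assms(1) sqi_minus(1)[OF assms(2)]] by simp

lemma sqi_inner_integrable:
  assumes "square_integrable f" "square_integrable g"
  shows "integrable lborel (\<lambda>x. f x \<bullet> g x)"
proof -
  have [measurable]: "f \<in> borel_measurable borel" "g \<in> borel_measurable borel"
    using assms sqi_meas by auto
  have le: "\<bar>f x \<bullet> g x\<bar> \<le> (norm (f x))\<^sup>2 + (norm (g x))\<^sup>2" for x
  proof -
    have "\<bar>f x \<bullet> g x\<bar> \<le> norm (f x) * norm (g x)" by (rule Cauchy_Schwarz_ineq2)
    also have "\<dots> \<le> 2 * (norm (f x) * norm (g x))" by simp
    finally show ?thesis using sum_squares_bound[of "norm (f x)" "norm (g x)"] by linarith
  qed
  show ?thesis
    by (rule Bochner_Integration.integrable_bound[where f = "\<lambda>x. (norm (f x))\<^sup>2 + (norm (g x))\<^sup>2"])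
       (use sqi_integrable[OF assms(1)] sqi_integrable[OF assms(2)] le in auto)
qed

lemma sqi_mult_integrable:
  fixes f g :: "'a::euclidean_space \<Rightarrow> real"
  assumes "square_integrable f" "square_integrable g"
  shows "integrable lborel (\<lambda>x. f x * g x)"
  using sqi_inner_integrable[OF assms] by simp

lemma sqi_component:
  assumes "square_integrable f"
  shows "square_integrable (\<lambda>x. f x \<bullet> b)" "L2n (\<lambda>x. f x \<bullet> b) \<le> norm b * L2n f"
proof -
  have [measurable]: "f \<in> borel_measurable borel" using assms sqi_meas by auto
  have le: "norm (f x \<bullet> b) \<le> norm (norm b *\<^sub>R f x)" for x
    using Cauchy_Schwarz_ineq2[of "f x" b] by (simp add: mult.commute)
  have "square_integrable (\<lambda>x. norm b *\<^sub>R f x)" using assms by (rule sqi_scaleR)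
  note sqi_bound[OF this, of "\<lambda>x. f x \<bullet> b"]
  then show "square_integrable (\<lambda>x. f x \<bullet> b)" "L2n (\<lambda>x. f x \<bullet> b) \<le> norm b * L2n f"
    using le sqi_scaleR(2)[OF assms, of "norm b"] by auto
qed

lemma L2ip_commute: "L2ip f g = L2ip g f"
  by (simp add: L2ip_def inner_commute)

lemma L2ip_self: "L2ip f f = (L2n f)\<^sup>2"
  by (simp add: L2ip_def L2n_sq power2_norm_eq_inner)

lemma L2ip_diff_left:
  assumes "square_integrable f" "square_integrable g" "square_integrable h"
  shows "L2ip (\<lambda>x. f x - g x) h = L2ip f h - L2ip g h"
  using assms by (simp add: L2ip_def inner_diff_left sqi_inner_integrable)

lemma L2ip_diff_right:
  assumes "square_integrable f" "square_integrable g" "square_integrable h"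
  shows "L2ip h (\<lambda>x. f x - g x) = L2ip h f - L2ip h g"
  using L2ip_diff_left[OF assms] by (simp add: L2ip_commute)

lemma L2ip_scale_left: "L2ip (\<lambda>x. c *\<^sub>R f x) h = c * L2ip f h"
  by (simp add: L2ip_def)

lemma L2n_add_sq:
  assumes "square_integrable f" "square_integrable g"
  shows "(L2n (\<lambda>x. f x + g x))\<^sup>2 = (L2n f)\<^sup>2 + 2 * L2ip f g + (L2n g)\<^sup>2"
proof -
  have "(norm (f x + g x))\<^sup>2 = (norm (f x))\<^sup>2 + 2 * (f x \<bullet> g x) + (norm (g x))\<^sup>2" for x
    by (simp add: power2_norm_eq_inner inner_add_left inner_add_right inner_commute)
  then show ?thesis
    using assms by (simp add: L2n_sq L2ip_def sqi_integrable sqi_inner_integrable)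
qed

lemma L2n_diff_sq:
  assumes "square_integrable f" "square_integrable g"
  shows "(L2n (\<lambda>x. f x - g x))\<^sup>2 = (L2n f)\<^sup>2 - 2 * L2ip f g + (L2n g)\<^sup>2"
proof -
  have "(norm (f x - g x))\<^sup>2 = (norm (f x))\<^sup>2 - 2 * (f x \<bullet> g x) + (norm (g x))\<^sup>2" for x
    by (simp add: power2_norm_eq_inner inner_diff_left inner_diff_right inner_commute)
  then show ?thesis
    using assms by (simp add: L2n_sq L2ip_def sqi_integrable sqi_inner_integrable)
qed

lemma L2n_eq_0_iff:
  assumes "square_integrable f"
  shows "L2n f = 0 \<longleftrightarrow> (AE x in lborel. f x = 0)"
  using integral_nonneg_eq_0_iff_AE[OF sqi_integrable[OF assms]]
  by (simp add: L2n_def)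

lemma L2_Cauchy_Schwarz:
  assumes "square_integrable f" "square_integrable g"
  shows "\<bar>L2ip f g\<bar> \<le> L2n f * L2n g"
proof (cases "L2n g = 0")
  case True
  then have "AE x in lborel. g x = 0" using assms L2n_eq_0_iff by blast
  then have "AE x in lborel. f x \<bullet> g x = 0" by eventually_elim auto
  then have "L2ip f g = 0" unfolding L2ip_def by (rule integral_eq_zero_AE)
  then show ?thesis using True by simp
next
  case False
  \<comment> \<open>The coefficient of the projection of \<open>f\<close> onto \<open>g\<close>; it
    minimises the norm of \<open>f - c g\<close>, and expanding that norm yields the
    inequality.\<close>
  define c where "c = L2ip f g / (L2n g)\<^sup>2"
  have pos: "(L2n g)\<^sup>2 > 0" using False by simp
  have "0 \<le> (L2n (\<lambda>x. f x - c *\<^sub>R g x))\<^sup>2" by simp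
  also have "\<dots> = (L2n f)\<^sup>2 - 2 * (c * L2ip f g) + c\<^sup>2 * (L2n g)\<^sup>2"
    using L2n_diff_sq[OF assms(1) sqi_scaleR(1)[OF assms(2), of c]]
      sqi_scaleR(2)[OF assms(2), of c]
    by (simp add: L2ip_commute[of f] L2ip_scale_left power_mult_distrib)
  also have "\<dots> = (L2n f)\<^sup>2 - (L2ip f g)\<^sup>2 / (L2n g)\<^sup>2"
    using pos by (simp add: c_def field_simps power2_eq_square)
  finally have "(L2ip f g)\<^sup>2 \<le> (L2n f)\<^sup>2 * (L2n g)\<^sup>2"
    using pos by (simp add: divide_le_eq)
  then have "(L2ip f g)\<^sup>2 \<le> (L2n f * L2n g)\<^sup>2" by (simp add: power_mult_distrib)
  then show ?thesis using power2_le_imp_le[of "\<bar>L2ip f g\<bar>" "L2n f * L2n g"] by simp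
qed

lemma L2n_triangle:
  assumes "square_integrable f" "square_integrable g"
  shows "L2n (\<lambda>x. f x + g x) \<le> L2n f + L2n g"
proof (rule power2_le_imp_le)
  have "L2ip f g \<le> L2n f * L2n g" using L2_Cauchy_Schwarz[OF assms] by linarith
  then show "(L2n (\<lambda>x. f x + g x))\<^sup>2 \<le> (L2n f + L2n g)\<^sup>2"
    unfolding L2n_add_sq[OF assms] power2_sum by linarith
qed simp

lemma L2n_triangle_diff:
  assumes "square_integrable f" "square_integrable g" "square_integrable h"
  shows "L2n (\<lambda>x. f x - h x) \<le> L2n (\<lambda>x. f x - g x) + L2n (\<lambda>x. g x - h x)"
  using L2n_triangle[OF sqi_diff[OF assms(1,2)] sqi_diff[OF assms(2,3)]] by simp

lemma L2n_triangle_sub: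
  assumes "square_integrable f" "square_integrable g"
  shows "L2n f \<le> L2n (\<lambda>x. f x - g x) + L2n g"
  using L2n_triangle[OF sqi_diff[OF assms] assms(2)] by simp

text \<open>Fatou for the squared norms. An eventual bound is enough because the liminf is at most
  the limsup; the Cauchy tails in \<open>L2_complete\<close> provide just such a bound.\<close>

lemma L2_fatou:
  fixes f :: "nat \<Rightarrow> 'a::euclidean_space \<Rightarrow> 'b::euclidean_space"
  assumes sq: "\<And>n. square_integrable (f n)" and g: "g \<in> borel_measurable borel"
    and lim: "AE x in lborel. (\<lambda>n. f n x) \<longlonglongrightarrow> g x"
    and le: "\<forall>\<^sub>F n in sequentially. L2n (f n) \<le> c" and c: "0 \<le> c"
  shows "square_integrable g" "L2n g \<le> c"
proof -
  have [measurable]: "f n \<in> borel_measurable borel" for n using sq sqi_meas by auto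
  have [measurable]: "g \<in> borel_measurable borel" by fact
  have "(\<integral>\<^sup>+x. ennreal ((norm (g x))\<^sup>2) \<partial>lborel) = (\<integral>\<^sup>+x. liminf (\<lambda>n. ennreal ((norm (f n x))\<^sup>2)) \<partial>lborel)"
  proof (rule nn_integral_cong_AE, use lim in eventually_elim)
    case (elim x)
    have "(\<lambda>n. ennreal ((norm (f n x))\<^sup>2)) \<longlonglongrightarrow> ennreal ((norm (g x))\<^sup>2)"
      by (intro tendsto_ennrealI tendsto_intros elim)
    then show ?case using lim_imp_Liminf sequentially_bot by metis
  qed
  also have "\<dots> \<le> liminf (\<lambda>n. \<integral>\<^sup>+x. ennreal ((norm (f n x))\<^sup>2) \<partial>lborel)"
    by (rule nn_integral_liminf) auto
  also have "\<dots> = liminf (\<lambda>n. ennreal ((L2n (f n))\<^sup>2))"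
    using nn_L2n[OF sq] by simp
  also have "\<dots> \<le> ennreal (c\<^sup>2)"
  proof -
    have "\<forall>\<^sub>F n in sequentially. ennreal ((L2n (f n))\<^sup>2) \<le> ennreal (c\<^sup>2)"
      using le by eventually_elim (auto intro!: ennreal_leI power_mono)
    then have "Limsup sequentially (\<lambda>n. ennreal ((L2n (f n))\<^sup>2)) \<le> ennreal (c\<^sup>2)"
      by (rule Limsup_bounded)
    then show ?thesis using Liminf_le_Limsup[of sequentially] order_trans sequentially_bot by blast
  qed
  finally have *: "(\<integral>\<^sup>+x. ennreal ((norm (g x))\<^sup>2) \<partial>lborel) \<le> ennreal (c\<^sup>2)" .
  show "square_integrable g" by (rule sqi_nn(1)[OF g *]) simp
  have "(L2n g)\<^sup>2 \<le> c\<^sup>2" by (rule sqi_nn(2)[OF g *]) simp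
  then show "L2n g \<le> c" using c by (rule power2_le_imp_le)
qed

lemma L2_AE_subseq:
  fixes f :: "nat \<Rightarrow> 'a::euclidean_space \<Rightarrow> 'b::euclidean_space"
  assumes sq: "\<And>n. square_integrable (f n)" "square_integrable g"
    and lim: "(\<lambda>n. L2n (\<lambda>x. f n x - g x)) \<longlonglongrightarrow> 0"
  shows "\<exists>r::nat\<Rightarrow>nat. strict_mono r \<and> (AE x in lborel. (\<lambda>n. f (r n) x) \<longlonglongrightarrow> g x)"
proof -
  let ?u = "\<lambda>n x. (norm (f n x - g x))\<^sup>2"
  have "\<exists>r::nat\<Rightarrow>nat. strict_mono r \<and> (AE x in lborel. (\<lambda>n. ?u (r n) x) \<longlonglongrightarrow> 0)"
  proof (rule tendsto_L1_AE_subseq)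
    show "integrable lborel (?u n)" for n using sqi_integrable[OF sqi_diff] sq by auto
    have "(\<lambda>n. (L2n (\<lambda>x. f n x - g x))\<^sup>2) \<longlonglongrightarrow> 0"
      using tendsto_power[OF lim, of 2] by simp
    then show "(\<lambda>n. LINT x|lborel. norm (?u n x)) \<longlonglongrightarrow> 0" by (simp add: L2n_sq)
  qed
  then obtain r :: "nat \<Rightarrow> nat" where r: "strict_mono r" "AE x in lborel. (\<lambda>n. ?u (r n) x) \<longlonglongrightarrow> 0"
    by blast
  have "AE x in lborel. (\<lambda>n. f (r n) x) \<longlonglongrightarrow> g x"
    using r(2)
  proof eventually_elim
    case (elim x)
    then have "(\<lambda>n. sqrt (?u (r n) x)) \<longlonglongrightarrow> sqrt 0" by (rule tendsto_real_sqrt)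
    then show ?case by (simp add: tendsto_norm_zero_iff LIM_zero_iff)
  qed
  with r(1) show ?thesis by blast
qed

text \<open>Riesz-Fischer along a fast subsequence: its increments are summable almost everywhere,
  which defines the limit pointwise, and Fatou turns the Cauchy condition into convergence of the
  whole sequence.\<close>

lemma L2_complete:
  fixes f :: "nat \<Rightarrow> 'a::euclidean_space \<Rightarrow> 'b::euclidean_space"
  assumes sq: "\<And>n. square_integrable (f n)"
    and cauchy: "\<And>e. e > 0 \<Longrightarrow> \<exists>M. \<forall>m\<ge>M. \<forall>n\<ge>M. L2n (\<lambda>x. f m x - f n x) < e"
  shows "\<exists>g. square_integrable g \<and> (\<lambda>n. L2n (\<lambda>x. f n x - g x)) \<longlonglongrightarrow> 0"
proof -
  have [measurable]: "f n \<in> borel_measurable borel" for n using sq sqi_meas by auto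
  have "\<forall>k. \<exists>M. \<forall>m\<ge>M. \<forall>n\<ge>M. L2n (\<lambda>x. f m x - f n x) < (1/2)^k"
    by (intro allI cauchy) simp
  then obtain M where M: "\<And>k m n. m \<ge> M k \<Longrightarrow> n \<ge> M k \<Longrightarrow> L2n (\<lambda>x. f m x - f n x) < (1/2)^k"
    by metis
  \<comment> \<open>Adding up the thresholds makes \<open>r\<close> monotone and at least
    \<open>M k\<close> at each \<open>k\<close>; the summand \<open>k\<close> forces it to
    infinity.\<close>
  define r where "r k = (\<Sum>i\<le>k. M i) + k" for k
  have rM: "r k \<ge> M k" for k
    unfolding r_def using member_le_sum[of k "{..k}" M] by simp
  have rmono: "r k \<le> r (Suc k)" for k by (simp add: r_def)
  have rk: "r k \<ge> k" for k by (simp add: r_def)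
  define D where "D k x = norm (f (r (Suc k)) x - f (r k) x)" for k x
  have [measurable]: "D k \<in> borel_measurable borel" for k unfolding D_def by measurable
  have Dn: "(\<integral>\<^sup>+x. ennreal ((D k x)\<^sup>2) \<partial>lborel) \<le> ennreal ((1/4)^k)" for k
  proof -
    have "(\<integral>\<^sup>+x. ennreal ((D k x)\<^sup>2) \<partial>lborel) = ennreal ((L2n (\<lambda>x. f (r (Suc k)) x - f (r k) x))\<^sup>2)"
      unfolding D_def by (rule nn_L2n[OF sqi_diff[OF sq sq]])
    also have "\<dots> \<le> ennreal (((1/2)^k)\<^sup>2)"
    proof (intro ennreal_leI power_mono)
      have "M k \<le> r (Suc k)" using rM[of k] rmono[of k] by linarith
      then show "L2n (\<lambda>x. f (r (Suc k)) x - f (r k) x) \<le> (1/2)^k"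
        using M[of k "r (Suc k)" "r k"] rM[of k] by simp
    qed simp
    also have "((1/2)^k)\<^sup>2 = (1/4::real)^k"
      by (simp add: power2_eq_square flip: power_mult_distrib)
    finally show ?thesis .
  qed
  \<comment> \<open>The weight \<open>2^k\<close> is affordable because the squared increments
    integrate to at most \<open>(1/4)^k\<close>. It pays for passing from squares to first powers:
    \<open>D k x\<close> is at most \<open>2^k * (D k x)\<^sup>2 + (1/2)^k\<close>.\<close>
  have "(\<integral>\<^sup>+x. (\<Sum>k. ennreal (2^k * (D k x)\<^sup>2)) \<partial>lborel) = (\<Sum>k. \<integral>\<^sup>+x. ennreal (2^k * (D k x)\<^sup>2) \<partial>lborel)"
    by (rule nn_integral_suminf) auto
  also have "\<dots> \<le> (\<Sum>k. ennreal ((1/2)^k))"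
  proof (rule suminf_le)
    fix k
    have "(\<integral>\<^sup>+x. ennreal (2^k * (D k x)\<^sup>2) \<partial>lborel) = ennreal (2^k) * (\<integral>\<^sup>+x. ennreal ((D k x)\<^sup>2) \<partial>lborel)"
      by (subst nn_integral_cmult[symmetric]) (auto simp: ennreal_mult)
    also have "\<dots> \<le> ennreal (2^k) * ennreal ((1/4)^k)" by (intro mult_left_mono Dn) simp
    also have "\<dots> = ennreal ((1/2)^k)"
      by (simp add: ennreal_mult[symmetric] flip: power_mult_distrib)
    finally show "(\<integral>\<^sup>+x. ennreal (2^k * (D k x)\<^sup>2) \<partial>lborel) \<le> ennreal ((1/2)^k)" .
  qed auto
  also have "\<dots> = ennreal (\<Sum>k. (1/2)^k)" by (rule suminf_ennreal2) auto
  also have "\<dots> < \<infinity>" by simp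
  finally have "AE x in lborel. (\<Sum>k. ennreal (2^k * (D k x)\<^sup>2)) \<noteq> \<infinity>"
    by (intro nn_integral_PInf_AE) auto
  then have conv: "AE x in lborel. convergent (\<lambda>k. f (r k) x)"
  proof eventually_elim
    case (elim x)
    have "summable (\<lambda>k. 2^k * (D k x)\<^sup>2)"
      by (rule summable_suminf_not_top) (use elim in auto)
    then have "summable (\<lambda>k. 2^k * (D k x)\<^sup>2 + (1/2)^k)" by (intro summable_add) auto
    then have "summable (\<lambda>k. D k x)"
    proof (rule summable_comparison_test'[where N=0])
      fix k :: nat
      have "0 \<le> (2^k * D k x - 1)\<^sup>2 + 1 + (2^k * D k x)^2 " by simp
      then have "2 * (2^k * D k x) \<le> 2*(2^k * D k x)^2 + 2 " by (simp add: power2_diff)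
      then have "2^k * D k x \<le> 2^k * (2^k * (D k x)\<^sup>2 + (1/2)^k)"
        by (simp add: algebra_simps power2_eq_square flip: power_mult_distrib)
      then have "D k x \<le> 2^k * (D k x)\<^sup>2 + (1/2)^k" by simp
      then show "norm (D k x) \<le> 2^k * (D k x)\<^sup>2 + (1/2)^k" by (simp add: D_def)
    qed
    then have "summable (\<lambda>k. f (r (Suc k)) x - f (r k) x)"
      unfolding D_def by (rule summable_norm_cancel)
    then have "convergent (\<lambda>n. \<Sum>k<n. f (r (Suc k)) x - f (r k) x)"
      by (simp add: summable_iff_convergent)
    then have "convergent (\<lambda>n. f (r n) x - f (r 0) x)"
      using sum_lessThan_telescope[of "\<lambda>k. f (r k) x"] by simp
    then have "convergent (\<lambda>n. (f (r n) x - f (r 0) x) + f (r 0) x)"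
      by (intro convergent_add convergent_const)
    then show ?case by simp
  qed
  define g where "g x = lim (\<lambda>k. f (r k) x)" for x
  have gm[measurable]: "g \<in> borel_measurable borel" unfolding g_def by measurable
  have glim: "AE x in lborel. (\<lambda>k. f (r k) x) \<longlonglongrightarrow> g x"
    using conv by eventually_elim (simp add: g_def convergent_LIMSEQ_iff)
  \<comment> \<open>Fatou in the index \<open>j\<close> of the subsequence, with \<open>n\<close>
    fixed; it also yields square integrability of the difference to the limit.\<close>
  have key: "square_integrable (\<lambda>x. f n x - g x) \<and> L2n (\<lambda>x. f n x - g x) \<le> (1/2)^k" if "n \<ge> M k" for n k
  proof -
    have *: "AE x in lborel. (\<lambda>j. f n x - f (r j) x) \<longlonglongrightarrow> f n x - g x"
      using glim by eventually_elim (intro tendsto_intros)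
    have e: "\<forall>\<^sub>F j in sequentially. L2n (\<lambda>x. f n x - f (r j) x) \<le> (1/2)^k"
      using eventually_ge_at_top[of "M k"]
    proof eventually_elim
      case (elim j)
      then show ?case using M[of k n "r j"] that rk[of j] by simp
    qed
    show ?thesis using L2_fatou[OF sqi_diff[OF sq sq] _ * e] by simp
  qed
  have "square_integrable (\<lambda>x. f (M 0) x - (f (M 0) x - g x))"
    using sqi_diff[OF sq[of "M 0"] conjunct1[OF key[of 0 "M 0"]]] by simp
  then have "square_integrable g" by simp
  moreover have "(\<lambda>n. L2n (\<lambda>x. f n x - g x)) \<longlonglongrightarrow> 0"
  proof (rule LIMSEQ_I)
    fix e :: real assume "e > 0"
    then obtain k where k: "(1/2)^k < e" using real_arch_pow_inv[of e "1/2"] by auto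
    show "\<exists>no. \<forall>n\<ge>no. norm (L2n (\<lambda>x. f n x - g x) - 0) < e"
    proof (intro exI allI impI)
      fix n assume "n \<ge> M k"
      then show "norm (L2n (\<lambda>x. f n x - g x) - 0) < e" using key[of k n] k by auto
    qed
  qed
  ultimately show ?thesis by blast
qed

lemma L2n_tendsto:
  fixes f :: "nat \<Rightarrow> 'a::euclidean_space \<Rightarrow> 'b::euclidean_space"
  assumes "\<And>n. square_integrable (f n)" "square_integrable g" "(\<lambda>n. L2n (\<lambda>x. f n x - g x)) \<longlonglongrightarrow> 0"
  shows "(\<lambda>n. L2n (f n)) \<longlonglongrightarrow> L2n g"
proof (rule LIM_zero_cancel, rule Lim_null_comparison[OF always_eventually assms(3)], rule allI)
  fix n
  have "L2n (f n) \<le> L2n (\<lambda>x. f n x - g x) + L2n g" "L2n g \<le> L2n (\<lambda>x. g x - f n x) + L2n (f n)"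
    by (rule L2n_triangle_sub[OF assms(1,2)], rule L2n_triangle_sub[OF assms(2,1)])
  then show "norm (L2n (f n) - L2n g) \<le> L2n (\<lambda>x. f n x - g x)"
    using L2n_minus_commute[of "f n" g] by simp
qed

lemma L2ip_tendsto:
  fixes f g :: "nat \<Rightarrow> 'a::euclidean_space \<Rightarrow> 'b::euclidean_space"
  assumes f: "\<And>n. square_integrable (f n)" "square_integrable f'" "(\<lambda>n. L2n (\<lambda>x. f n x - f' x)) \<longlonglongrightarrow> 0"
    and g: "\<And>n. square_integrable (g n)" "square_integrable g'" "(\<lambda>n. L2n (\<lambda>x. g n x - g' x)) \<longlonglongrightarrow> 0"
  shows "(\<lambda>n. L2ip (f n) (g n)) \<longlonglongrightarrow> L2ip f' g'"
proof (rule LIM_zero_cancel, rule Lim_null_comparison[OF always_eventually], rule allI)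
  fix n
  have "L2ip (f n) (g n) - L2ip f' g' = L2ip (\<lambda>x. f n x - f' x) (g n) + L2ip f' (\<lambda>x. g n x - g' x)"
    using f g by (simp add: L2ip_diff_left L2ip_diff_right)
  then show "norm (L2ip (f n) (g n) - L2ip f' g') \<le> L2n (\<lambda>x. f n x - f' x) * L2n (g n) + L2n f' * L2n (\<lambda>x. g n x - g' x)"
    using L2_Cauchy_Schwarz[OF sqi_diff[OF f(1)[of n] f(2)] g(1)[of n]]
      L2_Cauchy_Schwarz[OF f(2) sqi_diff[OF g(1)[of n] g(2)]] by simp
next
  have "(\<lambda>n. L2n (\<lambda>x. f n x - f' x) * L2n (g n) + L2n f' * L2n (\<lambda>x. g n x - g' x)) \<longlonglongrightarrow> 0 * L2n g' + L2n f' * 0"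
    by (intro tendsto_intros f g L2n_tendsto)
  then show "(\<lambda>n. L2n (\<lambda>x. f n x - f' x) * L2n (g n) + L2n f' * L2n (\<lambda>x. g n x - g' x)) \<longlonglongrightarrow> 0" by simp
qed

lemma L2ip_cong_AE:
  assumes "square_integrable f" "square_integrable g" "f' \<in> borel_measurable borel" "g' \<in> borel_measurable borel"
    "AE x in lborel. f' x = f x" "AE x in lborel. g' x = g x"
  shows "L2ip f' g' = L2ip f g"
proof -
  have [measurable]: "f \<in> borel_measurable borel" "g \<in> borel_measurable borel" using assms sqi_meas by auto
  note [measurable] = assms(3,4)
  have ae: "AE x in lborel. f' x \<bullet> g' x = f x \<bullet> g x" using assms(5,6) by eventually_elim simp
  show ?thesis unfolding L2ip_def by (rule integral_cong_AE[OF _ _ ae]) measurable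
qed

section \<open>Affine changes of variables\<close>

lemma nn_integral_affine:
  fixes f :: "'a::euclidean_space \<Rightarrow> ennreal"
  assumes [measurable]: "f \<in> borel_measurable borel" and c: "c \<noteq> 0"
  shows "(\<integral>\<^sup>+x. f x \<partial>lborel) = ennreal (\<bar>c\<bar> ^ DIM('a)) * (\<integral>\<^sup>+x. f (t + c *\<^sub>R x) \<partial>lborel)"
  by (subst lborel_affine[OF c, of t])
     (simp add: nn_integral_density nn_integral_distr nn_integral_cmult)

lemma nn_integral_translate:
  fixes f :: "'a::euclidean_space \<Rightarrow> ennreal"
  assumes "f \<in> borel_measurable borel"
  shows "(\<integral>\<^sup>+x. f (x + t) \<partial>lborel) = (\<integral>\<^sup>+x. f x \<partial>lborel)"
  using nn_integral_affine[OF assms, of 1 t] by (simp add: add.commute)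

lemma nn_integral_reflect:
  fixes f :: "'a::euclidean_space \<Rightarrow> ennreal"
  assumes "f \<in> borel_measurable borel"
  shows "(\<integral>\<^sup>+x. f (t - x) \<partial>lborel) = (\<integral>\<^sup>+x. f x \<partial>lborel)"
  using nn_integral_affine[OF assms, of "-1" t] by simp

lemma lborel_integral_affine:
  fixes f :: "'a::euclidean_space \<Rightarrow> 'b::{banach, second_countable_topology}"
  assumes [measurable]: "f \<in> borel_measurable borel" and c: "c \<noteq> 0"
  shows "(LINT x|lborel. f x) = \<bar>c\<bar> ^ DIM('a) *\<^sub>R (LINT x|lborel. f (t + c *\<^sub>R x))"
  by (subst lborel_affine[OF c, of t])
     (simp add: integral_density integral_distr)

lemma lborel_integral_translate:
  fixes f :: "'a::euclidean_space \<Rightarrow> 'b::{banach, second_countable_topology}"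
  assumes "f \<in> borel_measurable borel"
  shows "(LINT x|lborel. f (x + t)) = (LINT x|lborel. f x)"
  using lborel_integral_affine[OF assms, of 1 t] by (simp add: add.commute)

lemma lborel_integral_reflect:
  fixes f :: "'a::euclidean_space \<Rightarrow> 'b::{banach, second_countable_topology}"
  assumes "f \<in> borel_measurable borel"
  shows "(LINT x|lborel. f (t - x)) = (LINT x|lborel. f x)"
  using lborel_integral_affine[OF assms, of "-1" t] by simp

lemma lborel_integrable_translate:
  fixes f :: "'a::euclidean_space \<Rightarrow> 'b::{banach, second_countable_topology}"
  assumes f: "integrable lborel f"
  shows "integrable lborel (\<lambda>x. f (x + t))"
proof -
  have m[measurable]: "f \<in> borel_measurable borel" using f by (simp add: borel_measurable_integrable)
  show ?thesis
    using f nn_integral_translate[of "\<lambda>x. ennreal (norm (f x))" t]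
    unfolding integrable_iff_bounded by simp
qed

lemma sqi_translate:
  fixes f :: "'a::euclidean_space \<Rightarrow> 'b::euclidean_space"
  assumes "square_integrable f"
  shows "square_integrable (\<lambda>x. f (x + t))" "L2n (\<lambda>x. f (x + t)) = L2n f"
proof -
  have m[measurable]: "f \<in> borel_measurable borel" using assms sqi_meas by auto
  show "square_integrable (\<lambda>x. f (x + t))"
    using lborel_integrable_translate[OF sqi_integrable[OF assms], of t]
    by (simp add: square_integrable_def)
  show "L2n (\<lambda>x. f (x + t)) = L2n f"
    unfolding L2n_def by (subst lborel_integral_translate[of "\<lambda>x. (norm (f x))\<^sup>2"]) auto
qed

lemma sqi_reflect:
  fixes f :: "'a::euclidean_space \<Rightarrow> 'b::euclidean_space"
  assumes "square_integrable f"
  shows "square_integrable (\<lambda>x. f (t - x))" "L2n (\<lambda>x. f (t - x)) = L2n f"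
proof -
  have m[measurable]: "f \<in> borel_measurable borel" using assms sqi_meas by auto
  have "(\<integral>\<^sup>+x. ennreal ((norm (f (t - x)))\<^sup>2) \<partial>lborel) = ennreal ((L2n f)\<^sup>2)"
    using nn_integral_reflect[of "\<lambda>x. ennreal ((norm (f x))\<^sup>2)" t] nn_L2n[OF assms] by simp
  then show "square_integrable (\<lambda>x. f (t - x))"
    by (intro sqi_nn(1)[where c = "(L2n f)\<^sup>2"]) auto
  show "L2n (\<lambda>x. f (t - x)) = L2n f"
    unfolding L2n_def by (subst lborel_integral_reflect[of "\<lambda>x. (norm (f x))\<^sup>2"]) auto
qed

section \<open>Smooth functions\<close>

lemma frechet_derivative_eq:
  "(f has_derivative f') (at x) \<Longrightarrow> frechet_derivative f (at x) = f'"
  using frechet_derivative_at by metis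

lemma frechet_derivative_locally_0:
  fixes f :: "'a::euclidean_space \<Rightarrow> real"
  assumes "open S" "x \<in> S" "\<And>y. y \<in> S \<Longrightarrow> f y = 0"
  shows "frechet_derivative f (at x) = (\<lambda>_. 0)"
  using assms
  by (intro frechet_derivative_eq has_derivative_transform_within_open[OF has_derivative_const[of 0 "at x"] assms(1,2)]) simp

text \<open>\<open>Ck_fun\<close> refers to \<open>frechet_derivative\<close>, a choice operator;
  with an explicit derivative in its place the smoothness proofs become inductions on the
  order.\<close>

lemma Ck_SucI:
  assumes "\<And>x. (f has_derivative f' x) (at x)" "\<And>v. Ck_fun k (\<lambda>x. f' x v)"
  shows "Ck_fun (Suc k) f"
proof -
  have "frechet_derivative f (at x) = f' x" for x
    using assms(1) by (rule frechet_derivative_eq)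
  then show ?thesis using assms by (auto simp: differentiable_def)
qed

lemma Ck_SucD: "Ck_fun (Suc k) f \<Longrightarrow> Ck_fun k f"
proof (induction k arbitrary: f)
  case 0
  then show ?case
    by (auto simp: continuous_on_eq_continuous_at differentiable_imp_continuous_within)
next
  case (Suc k)
  then show ?case by auto
qed

lemma Ck_frechet: "Ck_fun (Suc k) f \<Longrightarrow> Ck_fun k (\<lambda>x. frechet_derivative f (at x) v)"
  by simp

lemma Ck_has_derivative:
  "Ck_fun (Suc k) f \<Longrightarrow> (f has_derivative frechet_derivative f (at x)) (at x)"
  by (simp add: frechet_derivative_works)

lemma Ck_const: "Ck_fun k (\<lambda>x. c)"
proof (induction k arbitrary: c)
  case (Suc k)
  show ?case by (rule Ck_SucI[where f' = "\<lambda>x v. 0"]) (auto intro: Suc)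
qed auto

lemma Ck_inner: "Ck_fun k (\<lambda>x. x \<bullet> b)"
proof (cases k)
  case (Suc j)
  show ?thesis unfolding Suc
    by (rule Ck_SucI[where f' = "\<lambda>x v. v \<bullet> b"]) (auto intro!: derivative_eq_intros Ck_const)
qed (auto intro!: continuous_intros)

lemma Ck_add: "Ck_fun k f \<Longrightarrow> Ck_fun k g \<Longrightarrow> Ck_fun k (\<lambda>x. f x + g x)"
proof (induction k arbitrary: f g)
  case (Suc k)
  show ?case
  proof (rule Ck_SucI)
    show "((\<lambda>x. f x + g x) has_derivative
        (\<lambda>v. frechet_derivative f (at x) v + frechet_derivative g (at x) v)) (at x)" for x
      by (intro has_derivative_add Ck_has_derivative[of k] Suc.prems)
    show "Ck_fun k (\<lambda>x. frechet_derivative f (at x) v + frechet_derivative g (at x) v)" for v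
      by (rule Suc.IH[OF Ck_frechet[OF Suc.prems(1)] Ck_frechet[OF Suc.prems(2)]])
  qed
qed (auto intro!: continuous_intros)

lemma Ck_mult: "Ck_fun k f \<Longrightarrow> Ck_fun k g \<Longrightarrow> Ck_fun k (\<lambda>x. f x * g x)"
proof (induction k arbitrary: f g)
  case (Suc k)
  show ?case
  proof (rule Ck_SucI)
    show "((\<lambda>x. f x * g x) has_derivative
        (\<lambda>v. f x * frechet_derivative g (at x) v + frechet_derivative f (at x) v * g x)) (at x)" for x
      by (intro has_derivative_mult Ck_has_derivative[of k] Suc.prems)
    show "Ck_fun k (\<lambda>x. f x * frechet_derivative g (at x) v + frechet_derivative f (at x) v * g x)" for v
      by (rule Ck_add[OF Suc.IH[OF Ck_SucD[OF Suc.prems(1)] Ck_frechet[OF Suc.prems(2)]]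
            Suc.IH[OF Ck_frechet[OF Suc.prems(1)] Ck_SucD[OF Suc.prems(2)]]])
  qed
qed (auto intro!: continuous_intros)

lemma Ck_sum: "(\<And>i. i \<in> A \<Longrightarrow> Ck_fun k (f i)) \<Longrightarrow> Ck_fun k (\<lambda>x. \<Sum>i\<in>A. f i x)"
proof (induction A rule: infinite_finite_induct)
  case (insert a A)
  have "Ck_fun k (\<lambda>x. f a x + (\<Sum>i\<in>A. f i x))" by (rule Ck_add) (use insert in simp_all)
  then show ?case using insert by simp
qed (simp_all add: Ck_const)

text \<open>A whole chain \<open>G\<close> of successive derivatives is carried along, with the
  index generalised in the induction, because differentiating \<open>G n\<close> after
  \<open>f\<close> produces \<open>G (Suc n)\<close> after \<open>f\<close> times a derivative of
  \<open>f\<close>.\<close>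

lemma Ck_compose:
  assumes G: "\<And>n x. (G n has_real_derivative G (Suc n) x) (at x)"
  shows "Ck_fun k f \<Longrightarrow> Ck_fun k (\<lambda>x. G n (f x))"
proof (induction k arbitrary: n f)
  case 0
  have "continuous_on UNIV (G n)"
    by (rule DERIV_continuous_on[OF has_field_derivative_at_within[OF G]])
  then have "continuous_on UNIV (G n \<circ> f)"
    using 0 by (intro continuous_on_compose) (auto intro: continuous_on_subset)
  then show ?case by (simp add: o_def)
next
  case (Suc k)
  show ?case
  proof (rule Ck_SucI[where f' = "\<lambda>x v. G (Suc n) (f x) * frechet_derivative f (at x) v"])
    show "((\<lambda>x. G n (f x)) has_derivative (\<lambda>v. G (Suc n) (f x) * frechet_derivative f (at x) v)) (at x)" for x
      using has_derivative_compose[OF Ck_has_derivative[OF Suc.prems] G[unfolded has_field_derivative_def]]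
      by simp
    show "Ck_fun k (\<lambda>x. G (Suc n) (f x) * frechet_derivative f (at x) v)" for v
      by (rule Ck_mult[OF Suc.IH[OF Ck_SucD[OF Suc.prems]] Ck_frechet[OF Suc.prems]])
  qed
qed

lemma Ck_affine: "Ck_fun k f \<Longrightarrow> Ck_fun k (\<lambda>x. f (t + c *\<^sub>R x))"
proof (induction k arbitrary: f)
  case 0
  then have "continuous_on UNIV (f \<circ> (\<lambda>x. t + c *\<^sub>R x))"
    by (intro continuous_on_compose) (auto intro!: continuous_intros intro: continuous_on_subset)
  then show ?case by (simp add: o_def)
next
  case (Suc k)
  show ?case
  proof (rule Ck_SucI[where f' = "\<lambda>x v. c * frechet_derivative f (at (t + c *\<^sub>R x)) v"])
    fix x
    have "((\<lambda>x. t + c *\<^sub>R x) has_derivative (\<lambda>v. c *\<^sub>R v)) (at x)"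
      by (auto intro!: derivative_eq_intros)
    from has_derivative_compose[OF this Ck_has_derivative[OF Suc.prems]]
    show "((\<lambda>x. f (t + c *\<^sub>R x)) has_derivative (\<lambda>v. c * frechet_derivative f (at (t + c *\<^sub>R x)) v)) (at x)"
      using has_derivative_linear[OF Ck_has_derivative[OF Suc.prems]]
      by (simp add: linear_cmul)
    show "Ck_fun k (\<lambda>x. c * frechet_derivative f (at (t + c *\<^sub>R x)) v)" for v
      by (rule Ck_mult[OF Ck_const Suc.IH[OF Ck_frechet[OF Suc.prems]]])
  qed
qed

text \<open>The classical smooth function \<open>exp (- 1/t)\<close> continued by 0, with a
  polynomial in \<open>1/t\<close> as a factor. The factor makes the class closed under
  differentiation: \<open>p\<close> turns into \<open>X^2 (p - p')\<close>.\<close>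

definition flat :: "real poly \<Rightarrow> real \<Rightarrow> real" where
  "flat p t = (if t > 0 then poly p (1/t) * exp (- (1/t)) else 0)"

lemma tendsto_poly_exp: "((\<lambda>s. poly q s * exp (- s)) \<longlongrightarrow> 0) at_top" for q :: "real poly"
proof -
  have "((\<lambda>s. \<Sum>i\<le>degree q. coeff q i * (s ^ i / exp s)) \<longlongrightarrow> (\<Sum>i\<le>degree q. coeff q i * 0)) at_top"
    by (intro tendsto_intros tendsto_power_div_exp_0)
  then show ?thesis by (simp add: poly_altdef sum_distrib_right sum_divide_distrib exp_minus field_simps)
qed

lemma flat_deriv: "(flat p has_real_derivative flat ([:0,0,1:] * (p - pderiv p)) t) (at t)"
proof -
  consider "t < 0" | "t = 0" | "t > 0" by linarith
  then show ?thesis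
  proof cases
    case 1
    have "((\<lambda>_. 0) has_real_derivative 0) (at t)" by simp
    then have "(flat p has_real_derivative 0) (at t)"
      by (rule has_field_derivative_transform_within_open[where S = "{..<0}"]) (use 1 in \<open>auto simp: flat_def\<close>)
    then show ?thesis using 1 by (simp add: flat_def)
  next
    case 2
    have "((\<lambda>h. flat p h / h) \<longlongrightarrow> 0) (at 0)"
    proof (rule filterlim_split_at_real)
      have "((\<lambda>h::real. 0) \<longlongrightarrow> 0) (at_left 0)" by simp
      then show "((\<lambda>h. flat p h / h) \<longlongrightarrow> 0) (at_left 0)"
        by (rule Lim_transform_eventually)
           (auto simp: flat_def eventually_at_left_field intro: exI[of _ "-1"])
      \<comment> \<open>Dividing by \<open>h\<close> multiplies the polynomial by its variable
        \<open>1/h\<close>, hence \<open>pCons 0 p\<close>; the exponential beats it as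
        \<open>1/h\<close> grows.\<close>
      have "((\<lambda>h. poly (pCons 0 p) (inverse h) * exp (- inverse h)) \<longlongrightarrow> 0) (at_right (0::real))"
        by (rule filterlim_compose[OF tendsto_poly_exp filterlim_inverse_at_top_right])
      then show "((\<lambda>h. flat p h / h) \<longlongrightarrow> 0) (at_right 0)"
        by (rule Lim_transform_eventually)
           (auto simp: flat_def eventually_at_right_field field_simps intro!: exI[of _ 1])
    qed
    then show ?thesis using 2
      by (simp add: has_field_derivative_iff flat_def)
  next
    case 3
    have "((\<lambda>t. poly p (1/t) * exp (- (1/t))) has_real_derivative
        poly ([:0,0,1:] * (p - pderiv p)) (1/t) * exp (- (1/t))) (at t)"
    proof -
      have inv: "((\<lambda>t. 1/t) has_real_derivative - ((1/t) * (1/t))) (at t)"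
        using 3 by (auto intro!: derivative_eq_intros)
      note d1 = DERIV_chain2[OF poly_DERIV[of p] inv]
      have d2: "((\<lambda>t. exp (- (1/t))) has_real_derivative exp (- (1/t)) * ((1/t) * (1/t))) (at t)"
        using DERIV_chain2[OF DERIV_exp DERIV_minus[OF inv]] by simp
      have "poly ([:0,0,1:] * (p - pderiv p)) s = s * s * (poly p s - poly (pderiv p) s)" for s
        by simp
      then show ?thesis
        by (intro DERIV_cong[OF DERIV_mult[OF d1 d2]]) (simp only:, simp add: algebra_simps)
    qed
    then have "(flat p has_real_derivative poly ([:0,0,1:] * (p - pderiv p)) (1/t) * exp (- (1/t))) (at t)"
      by (rule has_field_derivative_transform_within_open[where S = "{0<..}"]) (use 3 in \<open>auto simp: flat_def\<close>)
    then show ?thesis using 3 by (simp add: flat_def)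
  qed
qed

lemma Ck_flat:
  assumes "Ck_fun k f"
  shows "Ck_fun k (\<lambda>x. flat p (f x))"
proof -
  define D :: "real poly \<Rightarrow> real poly" where "D p = [:0,0,1:] * (p - pderiv p)" for p
  define P where "P n = (D ^^ n) p" for n
  have "(flat (P n) has_real_derivative flat (P (Suc n)) x) (at x)" for n x
    using flat_deriv[of "P n" x] unfolding D_def[symmetric] by (simp add: P_def)
  from Ck_compose[where G = "\<lambda>n. flat (P n)", OF this assms, of 0]
  show ?thesis by (simp add: P_def)
qed

section \<open>Test functions\<close>

lemma Ck_norm_sq: "Ck_fun k (\<lambda>x. (norm x)\<^sup>2)"
proof -
  have "(norm x)\<^sup>2 = (\<Sum>b\<in>Basis. (x \<bullet> b) * (x \<bullet> b))" for x :: 'a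
    unfolding power2_norm_eq_inner by (rule euclidean_inner)
  then show ?thesis by (simp only:) (intro Ck_sum Ck_mult Ck_inner)
qed

lemma compact_closure_support:
  fixes f :: "'a::euclidean_space \<Rightarrow> real"
  assumes "\<And>x. norm x > R \<Longrightarrow> f x = 0"
  shows "compact (closure {x. f x \<noteq> 0})"
proof -
  have "{x. f x \<noteq> 0} \<subseteq> cball 0 R" using assms by force
  then have "bounded {x. f x \<noteq> 0}" using bounded_subset bounded_cball by blast
  then show ?thesis by (simp add: compact_closure)
qed

lemma test_functionI:
  assumes "\<And>k. Ck_fun k f" "\<And>x. norm x > R \<Longrightarrow> f x = 0"
  shows "test_function f"
  unfolding test_function_def using assms compact_closure_support by blast

lemma test_supportE:
  assumes "test_function f"
  obtains R where "R > 0" "\<And>x. norm x \<ge> R \<Longrightarrow> f x = 0"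
proof -
  have "bounded (closure {x. f x \<noteq> 0})"
    using assms by (auto simp: test_function_def intro: compact_imp_bounded)
  then have "bounded {x. f x \<noteq> 0}" using bounded_subset closure_subset by blast
  then obtain R where "R > 0" "\<forall>x\<in>{x. f x \<noteq> 0}. norm x \<le> R" using bounded_pos by blast
  then show ?thesis by (intro that[of "R + 1"]) force+
qed

lemma test_Ck: "test_function f \<Longrightarrow> Ck_fun k f"
  by (simp add: test_function_def)

lemma test_derivative: "test_function f \<Longrightarrow> (f has_derivative frechet_derivative f (at x)) (at x)"
  using Ck_has_derivative test_Ck by blast

lemma test_continuous: "test_function f \<Longrightarrow> continuous_on UNIV f"
  using test_Ck[of f 0] by simp

lemma test_measurable: "test_function f \<Longrightarrow> f \<in> borel_measurable borel"
  by (intro borel_measurable_continuous_onI test_continuous)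

lemma test_bounded:
  assumes "test_function f"
  obtains B where "B > 0" "\<And>x. \<bar>f x\<bar> \<le> B"
proof -
  obtain R where R: "\<And>x. norm x \<ge> R \<Longrightarrow> f x = 0" using test_supportE[OF assms] by metis
  have "compact (f ` cball 0 R)"
    by (intro compact_continuous_image continuous_on_subset[OF test_continuous[OF assms]]) auto
  then obtain B where B: "B > 0" "\<And>x. x \<in> cball 0 R \<Longrightarrow> \<bar>f x\<bar> \<le> B"
    using compact_imp_bounded bounded_pos by (metis image_eqI real_norm_def)
  have "\<bar>f x\<bar> \<le> B" for x
    using B R[of x] by (cases "norm x \<le> R") auto
  then show ?thesis using that B(1) by blast
qed

lemma test_mult_Ck:
  assumes "test_function f" "\<And>k. Ck_fun k g"
  shows "test_function (\<lambda>x. g x * f x)"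
proof -
  obtain R where R: "R > 0" "\<And>x. norm x \<ge> R \<Longrightarrow> f x = 0" using test_supportE[OF assms(1)] by metis
  show ?thesis
  proof (rule test_functionI[where R=R])
    show "Ck_fun k (\<lambda>x. g x * f x)" for k by (intro Ck_mult test_Ck assms)
    show "g x * f x = 0" if "R < norm x" for x using R(2)[of x] that by simp
  qed
qed

lemma test_mult: "test_function f \<Longrightarrow> test_function g \<Longrightarrow> test_function (\<lambda>x. f x * g x)"
  by (intro test_mult_Ck test_Ck)

lemma test_cmult: "test_function f \<Longrightarrow> test_function (\<lambda>x. c * f x)"
  by (intro test_mult_Ck Ck_const)

lemma test_affine:
  fixes f :: "'a::euclidean_space \<Rightarrow> real"
  assumes "test_function f" "c \<noteq> 0"
  shows "test_function (\<lambda>x. f (t + c *\<^sub>R x))"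
proof -
  obtain R where R: "R > 0" "\<And>x. norm x \<ge> R \<Longrightarrow> f x = 0" using test_supportE[OF assms(1)] by metis
  show ?thesis
  proof (rule test_functionI[where R = "(R + norm t) / \<bar>c\<bar>"])
    show "Ck_fun k (\<lambda>x. f (t + c *\<^sub>R x))" for k using assms by (intro Ck_affine test_Ck)
    fix x :: 'a assume "(R + norm t) / \<bar>c\<bar> < norm x"
    then have "R + norm t < norm (c *\<^sub>R x)" using assms(2) by (simp add: field_simps)
    moreover have "norm (c *\<^sub>R x) \<le> norm (t + c *\<^sub>R x) + norm t"
      using norm_triangle_ineq[of "t + c *\<^sub>R x" "-t"] by simp
    ultimately show "f (t + c *\<^sub>R x) = 0" by (intro R) linarith
  qed
qed

lemma test_frechet:
  assumes "test_function f"
  shows "test_function (\<lambda>x. frechet_derivative f (at x) v)"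
proof -
  obtain R where R: "R > 0" "\<And>x. norm x \<ge> R \<Longrightarrow> f x = 0" using test_supportE[OF assms(1)] by metis
  show ?thesis
  proof (rule test_functionI[where R=R])
    show "Ck_fun k (\<lambda>x. frechet_derivative f (at x) v)" for k
      using test_Ck[OF assms, of "Suc k"] by simp
    fix x :: 'a assume x: "R < norm x"
    have "open {x::'a. R < norm x}" by (intro open_Collect_less continuous_intros)
    then show "frechet_derivative f (at x) v = 0"
      by (subst frechet_derivative_locally_0) (use x R(2) in auto)
  qed
qed

lemma integrable_indicator_cball: "integrable lborel (indicator (cball a r) :: _ \<Rightarrow> real)"
  by (rule integrable_real_indicator[OF _ emeasure_bounded_finite[OF bounded_cball]]) simp

lemma compact_support_integrable:
  fixes f :: "'a::euclidean_space \<Rightarrow> real"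
  assumes "f \<in> borel_measurable borel" "\<And>x. norm x > R \<Longrightarrow> f x = 0" "\<And>x. \<bar>f x\<bar> \<le> B"
  shows "integrable lborel f"
proof (rule Bochner_Integration.integrable_bound[where f = "\<lambda>x. B * indicator (cball 0 R) x"])
  show "integrable lborel (\<lambda>x. B * indicator (cball (0::'a) R) x)"
    by (intro integrable_mult_right integrable_indicator_cball)
  have "\<bar>f x\<bar> \<le> \<bar>B * indicator (cball 0 R) x\<bar>" for x
    using assms(2)[of x] assms(3)[of x] by (auto simp: indicator_def)
  then show "AE x in lborel. norm (f x) \<le> norm (B * indicator (cball 0 R) x)" by simp
qed (use assms in auto)

lemma compact_support_sqi:
  fixes f :: "'a::euclidean_space \<Rightarrow> real"
  assumes "f \<in> borel_measurable borel" "\<And>x. norm x > R \<Longrightarrow> f x = 0" "\<And>x. \<bar>f x\<bar> \<le> B"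
  shows "square_integrable f"
  unfolding sqi_real_iff
proof
  have "\<bar>(f x)\<^sup>2\<bar> \<le> B\<^sup>2" for x using power_mono[OF assms(3), of x 2] by simp
  then show "integrable lborel (\<lambda>x. (f x)\<^sup>2)"
    by (intro compact_support_integrable[where R=R and B="B\<^sup>2"]) (use assms in auto)
qed fact

lemma test_integrable: "test_function f \<Longrightarrow> integrable lborel f"
  by (meson compact_support_integrable test_measurable test_supportE test_bounded less_imp_le)

lemma test_sqi: "test_function f \<Longrightarrow> square_integrable f"
  by (meson compact_support_sqi test_measurable test_supportE test_bounded less_imp_le)

section \<open>Classical gradients of test functions\<close>

definition grad :: "('a::euclidean_space \<Rightarrow> real) \<Rightarrow> 'a \<Rightarrow> 'a" where
  "grad f x = (\<Sum>b\<in>Basis. frechet_derivative f (at x) b *\<^sub>R b)"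

lemma grad_inner:
  assumes "test_function f"
  shows "grad f x \<bullet> v = frechet_derivative f (at x) v"
proof -
  have lin: "linear (frechet_derivative f (at x))"
    using has_derivative_linear[OF test_derivative[OF assms]] .
  have "frechet_derivative f (at x) v = frechet_derivative f (at x) (\<Sum>b\<in>Basis. (v \<bullet> b) *\<^sub>R b)"
    by (simp add: euclidean_representation)
  also have "\<dots> = (\<Sum>b\<in>Basis. (v \<bullet> b) * frechet_derivative f (at x) b)"
    by (simp add: linear_sum[OF lin] linear_cmul[OF lin])
  also have "\<dots> = grad f x \<bullet> v"
    unfolding grad_def inner_sum_left by (intro sum.cong) (simp_all add: inner_commute mult.commute)
  finally show ?thesis by simp
qed

lemma sqi_vector:
  fixes G :: "'a::euclidean_space \<Rightarrow> 'b::euclidean_space"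
  assumes "\<And>b. b \<in> Basis \<Longrightarrow> square_integrable (\<lambda>x. G x \<bullet> b)"
  shows "square_integrable G"
proof -
  have m: "G \<in> borel_measurable borel"
    using assms sqi_meas by (subst borel_measurable_euclidean_space) auto
  have "(norm (G x))\<^sup>2 = (\<Sum>b\<in>Basis. (G x \<bullet> b)\<^sup>2)" for x
    unfolding power2_norm_eq_inner by (subst euclidean_inner) (simp add: power2_eq_square)
  then show ?thesis using assms m by (auto simp: square_integrable_def)
qed

lemma test_grad_sqi: "test_function f \<Longrightarrow> square_integrable (grad f)"
  by (rule sqi_vector) (simp add: grad_inner test_sqi[OF test_frechet])

lemma test_grad_measurable: "test_function f \<Longrightarrow> grad f \<in> borel_measurable borel"
  using test_grad_sqi sqi_meas by blast

lemma test_grad_continuous: "test_function f \<Longrightarrow> continuous_on UNIV (grad f)"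
  unfolding grad_def by (intro continuous_intros test_continuous test_frechet)

lemma test_grad_bounded:
  assumes "test_function f"
  obtains B where "B > 0" "\<And>x. norm (grad f x) \<le> B"
proof -
  have "\<forall>b. \<exists>B>0. \<forall>x. \<bar>frechet_derivative f (at x) b\<bar> \<le> B"
    using test_bounded[OF test_frechet[OF assms]] by metis
  then obtain B where B: "\<And>b. B b > 0" "\<And>b x. \<bar>frechet_derivative f (at x) b\<bar> \<le> B b" by metis
  have "norm (grad f x) \<le> (\<Sum>b\<in>Basis. B b)" for x
    unfolding grad_def by (intro sum_norm_le) (use B in auto)
  moreover have "(\<Sum>b\<in>(Basis::'a set). B b) > 0" using B by (intro sum_pos) auto
  ultimately show ?thesis using that by blast
qed

lemma test_line_deriv:
  assumes "test_function f"
  shows "((\<lambda>t. f (x + t *\<^sub>R v)) has_real_derivative grad f (x + t *\<^sub>R v) \<bullet> v) (at t within S)"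
proof -
  have "((\<lambda>t. x + t *\<^sub>R v) has_derivative (\<lambda>h. h *\<^sub>R v)) (at t within S)"
    by (auto intro!: derivative_eq_intros)
  from has_derivative_compose[OF this test_derivative[OF assms]]
  have "((\<lambda>t. f (x + t *\<^sub>R v)) has_derivative (\<lambda>h. grad f (x + t *\<^sub>R v) \<bullet> (h *\<^sub>R v))) (at t within S)"
    by (simp only: grad_inner[OF assms])
  then show ?thesis unfolding has_field_derivative_def
    by (simp add: mult.commute[of _ "grad f (x + t *\<^sub>R v) \<bullet> v"])
qed

lemma test_lipschitz:
  assumes "test_function f" "\<And>x. norm (grad f x) \<le> B"
  shows "\<bar>f x - f y\<bar> \<le> B * norm (x - y)"
proof -
  have "norm (f x - f y) \<le> B * norm (x - y)"
  proof (rule differentiable_bound[where S = UNIV])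
    show "(f has_derivative frechet_derivative f (at x)) (at x within UNIV)" for x
      using test_derivative[OF assms(1)] by simp
    show "onorm (frechet_derivative f (at x)) \<le> B" for x
    proof (rule onorm_le)
      fix v
      have "\<bar>grad f x \<bullet> v\<bar> \<le> norm (grad f x) * norm v" by (rule Cauchy_Schwarz_ineq2)
      also have "\<dots> \<le> B * norm v" by (intro mult_right_mono assms) auto
      finally show "norm (frechet_derivative f (at x) v) \<le> B * norm v"
        by (simp add: grad_inner[OF assms(1)])
    qed
  qed auto
  then show ?thesis by simp
qed

text \<open>Integration by parts without boundary: difference quotients integrate to 0 by
  translation invariance, and they converge dominatedly to the derivative. Applied to products it
  gives weak gradients.\<close>

lemma test_integral_deriv_zero:
  assumes f: "test_function f"
  shows "(LINT x|lborel. frechet_derivative f (at x) v) = 0"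
proof -
  obtain R where R: "R > 0" "\<And>x. norm x \<ge> R \<Longrightarrow> f x = 0" using test_supportE[OF f] by metis
  obtain B where B: "B > 0" "\<And>x. norm (grad f x) \<le> B" using test_grad_bounded[OF f] by metis
  have [measurable]: "f \<in> borel_measurable borel" using f by (rule test_measurable)
  have [measurable]: "(\<lambda>x. frechet_derivative f (at x) v) \<in> borel_measurable borel"
    using test_measurable[OF test_frechet[OF f]] .
  define h where "h n = inverse (real (Suc n))" for n
  have h: "h n > 0" "h n \<le> 1" for n by (auto simp: h_def field_simps)
  define q where "q n x = (f (x + h n *\<^sub>R v) - f x) / h n" for n x
  \<comment> \<open>The majorant is the Lipschitz constant on a ball; as \<open>h n\<close> is at
    most 1, the shifted supports stay within radius \<open>R + norm v\<close>.\<close>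
  have "(\<lambda>n. LINT x|lborel. q n x) \<longlonglongrightarrow> (LINT x|lborel. frechet_derivative f (at x) v)"
  proof (rule integral_dominated_convergence[where w = "\<lambda>x. B * norm v * indicator (cball 0 (R + norm v)) x"])
    show "integrable lborel (\<lambda>x. B * norm v * indicator (cball (0::'a) (R + norm v)) x)"
      by (intro integrable_mult_right integrable_indicator_cball)
    show "AE x in lborel. (\<lambda>n. q n x) \<longlonglongrightarrow> frechet_derivative f (at x) v"
    proof (rule AE_I2)
      fix x
      have "((\<lambda>t. f (x + t *\<^sub>R v)) has_real_derivative grad f x \<bullet> v) (at 0)"
        using test_line_deriv[OF f, of x v 0] by simp
      then have "((\<lambda>t. (f (x + t *\<^sub>R v) - f x) / t) \<longlongrightarrow> grad f x \<bullet> v) (at 0)"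
        by (simp add: DERIV_def)
      moreover have "filterlim h (at 0) sequentially"
        using LIMSEQ_inverse_real_of_nat h
        unfolding filterlim_at h_def by (auto simp: less_le)
      ultimately show "(\<lambda>n. q n x) \<longlonglongrightarrow> frechet_derivative f (at x) v"
        unfolding q_def grad_inner[OF f, symmetric] by (rule filterlim_compose)
    qed
    fix n
    show "AE x in lborel. norm (q n x) \<le> B * norm v * indicator (cball 0 (R + norm v)) x"
    proof (rule AE_I2)
      fix x
      show "norm (q n x) \<le> B * norm v * indicator (cball 0 (R + norm v)) x"
      proof (cases "norm x \<le> R + norm v")
        case True
        have "\<bar>f (x + h n *\<^sub>R v) - f x\<bar> \<le> B * norm (x + h n *\<^sub>R v - x)"
          by (rule test_lipschitz[OF f B(2)])
        also have "\<dots> = B * norm v * h n" using h[of n] by simp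
        finally show ?thesis using h[of n] True by (simp add: q_def field_simps)
      next
        case False
        have "norm (h n *\<^sub>R v) \<le> norm v" using h[of n] by (simp add: mult_left_le_one_le)
        moreover have "norm x \<le> norm (x + h n *\<^sub>R v) + norm (h n *\<^sub>R v)"
          using norm_triangle_ineq[of "x + h n *\<^sub>R v" "- (h n *\<^sub>R v)"] by simp
        moreover have "norm v \<ge> 0" by simp
        ultimately have "R \<le> norm (x + h n *\<^sub>R v)" "R \<le> norm x" using False by linarith+
        then have "f (x + h n *\<^sub>R v) = 0" "f x = 0" using R(2) by blast+
        then show ?thesis using False by (simp add: q_def)
      qed
    qed
  qed (auto simp: q_def)
  moreover have "(LINT x|lborel. q n x) = 0" for n
  proof -
    have "(LINT x|lborel. q n x) = ((LINT x|lborel. f (x + h n *\<^sub>R v)) - (LINT x|lborel. f x)) / h n"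
      unfolding q_def
      using test_integrable[OF f] lborel_integrable_translate[OF test_integrable[OF f], of "h n *\<^sub>R v"]
      by simp
    then show ?thesis using lborel_integral_translate[of f "h n *\<^sub>R v"] by simp
  qed
  ultimately have "(\<lambda>n. 0) \<longlonglongrightarrow> (LINT x|lborel. frechet_derivative f (at x) v)" by simp
  then show ?thesis using LIMSEQ_unique[OF tendsto_const] by metis
qed

lemma frechet_mult:
  assumes "test_function f" "test_function g"
  shows "frechet_derivative (\<lambda>x. f x * g x) (at x) v =
    f x * frechet_derivative g (at x) v + frechet_derivative f (at x) v * g x"
  using frechet_derivative_eq[OF has_derivative_mult[OF test_derivative[OF assms(1)] test_derivative[OF assms(2)]]]
  by simp

lemma grad_mult:
  assumes "test_function f" "test_function g"
  shows "grad (\<lambda>x. f x * g x) x = f x *\<^sub>R grad g x + g x *\<^sub>R grad f x"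
  by (simp add: grad_def frechet_mult[OF assms] scaleR_add_left sum.distrib scaleR_sum_right mult.commute)

lemma test_weak_gradient:
  assumes "test_function f"
  shows "is_weak_gradient f (grad f)"
  unfolding is_weak_gradient_def
proof (intro allI impI ballI)
  fix \<phi> :: "'a \<Rightarrow> real" and b :: 'a
  assume \<phi>: "test_function \<phi>"
  have "0 = (LINT x|lborel. frechet_derivative (\<lambda>x. f x * \<phi> x) (at x) b)"
    using test_integral_deriv_zero[OF test_mult[OF assms \<phi>]] by simp
  also have "\<dots> = (LINT x|lborel. f x * frechet_derivative \<phi> (at x) b) + (LINT x|lborel. frechet_derivative f (at x) b * \<phi> x)"
    unfolding frechet_mult[OF assms \<phi>]
    by (intro Bochner_Integration.integral_add sqi_mult_integrable test_sqi test_frechet assms \<phi>)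
  finally show "(LINT x|lborel. f x * frechet_derivative \<phi> (at x) b) = - (LINT x|lborel. grad f x \<bullet> b * \<phi> x)"
    by (simp add: grad_inner[OF assms])
qed

text \<open>The factor \<open>exp 1\<close> normalises the value at the origin to 1, so that
  dilations of \<open>bump\<close> are cutoffs with values between 0 and 1; its integral is
  normalised separately in \<open>mollifier_exists\<close>.\<close>

definition bump :: "'a::euclidean_space \<Rightarrow> real" where
  "bump x = exp 1 * flat 1 (1 - (norm x)\<^sup>2)"

lemma bump_eq: "bump x = (if norm x < 1 then exp (1 - 1 / (1 - (norm x)\<^sup>2)) else 0)"
proof -
  have "(norm x)\<^sup>2 < 1 \<longleftrightarrow> norm x < 1"
    by (simp add: abs_square_less_1)
  then show ?thesis by (simp add: bump_def flat_def flip: exp_add)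
qed

lemma bump_0 [simp]: "bump 0 = 1"
  by (simp add: bump_eq)

lemma bump_nonneg: "0 \<le> bump x"
  by (simp add: bump_eq)

lemma bump_le_1: "bump x \<le> 1"
proof (cases "norm x < 1")
  case True
  then have "(norm x)\<^sup>2 < 1" by (simp add: abs_square_less_1)
  then have "1 / (1 - (norm x)\<^sup>2) \<ge> 1" by (simp add: field_simps)
  then show ?thesis by (simp add: bump_eq)
qed (simp add: bump_eq)

lemma bump_outside: "norm x \<ge> 1 \<Longrightarrow> bump x = 0"
  by (simp add: bump_eq)

lemma bump_test: "test_function bump"
proof (rule test_functionI[where R=1])
  fix k
  have "Ck_fun k (\<lambda>x::'a. 1 + (-1) * (norm x)\<^sup>2)"
    by (rule Ck_add[OF Ck_const Ck_mult[OF Ck_const Ck_norm_sq]])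
  then have "Ck_fun k (\<lambda>x::'a. exp 1 * flat 1 (1 + (-1) * (norm x)\<^sup>2))"
    by (rule Ck_mult[OF Ck_const Ck_flat])
  moreover have "(bump :: 'a \<Rightarrow> real) = (\<lambda>x. exp 1 * flat 1 (1 + (-1) * (norm x)\<^sup>2))"
    by (rule ext) (simp add: bump_def)
  ultimately show "Ck_fun k (bump :: 'a \<Rightarrow> real)" by simp
qed (simp add: bump_outside)

section \<open>Mollification\<close>

definition moll :: "('a::euclidean_space \<Rightarrow> real) \<Rightarrow> ('a \<Rightarrow> real) \<Rightarrow> 'a \<Rightarrow> real" where
  "moll \<eta> f x = (LINT y|lborel. \<eta> (x - y) * f y)"

lemma test_reflect:
  assumes "test_function f"
  shows "test_function (\<lambda>y. f (x - y))"
  using test_affine[OF assms, of "-1" x] by simp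

lemma moll_integrable:
  assumes "test_function \<eta>" "square_integrable f"
  shows "integrable lborel (\<lambda>y. \<eta> (x - y) * f y)"
  by (intro sqi_mult_integrable test_sqi test_reflect assms)

text \<open>Second derivatives are bounded by compact support, so the gradient is Lipschitz; the
  mean value theorem on the segment then bounds the remainder uniformly in \<open>x\<close>, as
  differentiation under the integral requires.\<close>

lemma test_taylor:
  assumes f: "test_function f"
  obtains L where "L > 0" "\<And>x h. \<bar>f (x + h) - f x - grad f x \<bullet> h\<bar> \<le> L * (norm h)\<^sup>2"
proof -
  have "\<forall>b. \<exists>B>0. \<forall>x. norm (grad (\<lambda>x. frechet_derivative f (at x) b) x) \<le> B"
    using test_grad_bounded[OF test_frechet[OF f]] by metis
  then obtain B where B: "\<And>b. B b > 0" "\<And>b x. norm (grad (\<lambda>x. frechet_derivative f (at x) b) x) \<le> B b"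
    by metis
  define L where "L = (\<Sum>b\<in>(Basis::'a set). B b)"
  have "L > 0" unfolding L_def using B by (intro sum_pos) auto
  have lip: "norm (grad f x - grad f y) \<le> L * norm (x - y)" for x y
  proof -
    have "norm (grad f x - grad f y) = norm (\<Sum>b\<in>Basis. (frechet_derivative f (at x) b - frechet_derivative f (at y) b) *\<^sub>R b)"
      by (simp add: grad_def scaleR_diff_left sum_subtractf)
    also have "\<dots> \<le> (\<Sum>b\<in>(Basis::'a set). B b * norm (x - y))"
    proof (rule sum_norm_le)
      fix b :: 'a assume "b \<in> Basis"
      then show "norm ((frechet_derivative f (at x) b - frechet_derivative f (at y) b) *\<^sub>R b) \<le> B b * norm (x - y)"
        using test_lipschitz[OF test_frechet[OF f] B(2)[of b], of x y] by simp
    qed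
    finally show ?thesis by (simp add: L_def sum_distrib_right)
  qed
  have "\<bar>f (x + h) - f x - grad f x \<bullet> h\<bar> \<le> L * (norm h)\<^sup>2" for x h
  proof -
    have "\<exists>z>0. z < 1 \<and> f (x + 1 *\<^sub>R h) - f (x + 0 *\<^sub>R h) = (1 - 0) * (grad f (x + z *\<^sub>R h) \<bullet> h)"
      by (rule MVT2) (auto intro: test_line_deriv[OF f])
    then obtain z where z: "0 < z" "z < 1" "f (x + h) - f x = grad f (x + z *\<^sub>R h) \<bullet> h" by auto
    have "\<bar>f (x + h) - f x - grad f x \<bullet> h\<bar> = \<bar>(grad f (x + z *\<^sub>R h) - grad f x) \<bullet> h\<bar>"
      using z by (simp add: inner_diff_left)
    also have "\<dots> \<le> norm (grad f (x + z *\<^sub>R h) - grad f x) * norm h" by (rule Cauchy_Schwarz_ineq2)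
    also have "\<dots> \<le> (L * norm (x + z *\<^sub>R h - x)) * norm h" by (intro mult_right_mono lip) auto
    also have "\<dots> = (L * (norm h)\<^sup>2) * z" using z by (simp add: power2_eq_square)
    also have "\<dots> \<le> L * (norm h)\<^sup>2" using z \<open>L > 0\<close> by (intro mult_left_le) auto
    finally show ?thesis .
  qed
  with \<open>L > 0\<close> show ?thesis using that by blast
qed

lemma cball_abs_integrable:
  assumes "square_integrable (f :: 'a::euclidean_space \<Rightarrow> real)"
  shows "integrable lborel (\<lambda>y. indicator (cball a r) y * \<bar>f y\<bar>)"
proof (rule sqi_mult_integrable)
  show "square_integrable (indicator (cball a r) :: 'a \<Rightarrow> real)"
  proof -
    have "(\<lambda>y. (indicator (cball a r) y)\<^sup>2) = (indicator (cball a r) :: 'a \<Rightarrow> real)"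
      by (auto simp: indicator_def)
    then show ?thesis unfolding sqi_real_iff using integrable_indicator_cball[of a r] by simp
  qed
  show "square_integrable (\<lambda>y. \<bar>f y\<bar>)" using assms by (auto simp: sqi_real_iff)
qed

text \<open>Differentiation under the integral in quantitative form: the Taylor remainder of \<eta>
  is uniformly quadratic and only points \<open>y\<close> near \<open>x\<close> contribute, where
  \<open>f\<close> is integrable.\<close>

lemma moll_has_derivative:
  assumes \<eta>: "test_function \<eta>" and f: "square_integrable f"
  shows "(moll \<eta> f has_derivative (\<lambda>v. moll (\<lambda>z. frechet_derivative \<eta> (at z) v) f x)) (at x)"
  unfolding has_derivative_at_alt
proof (intro conjI allI impI)
  let ?D = "\<lambda>v. moll (\<lambda>z. frechet_derivative \<eta> (at z) v) f x"
  have "?D v = (\<Sum>b\<in>Basis. ?D b *\<^sub>R b) \<bullet> v" for v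
  proof -
    have "frechet_derivative \<eta> (at z) v = (\<Sum>b\<in>Basis. (v \<bullet> b) * frechet_derivative \<eta> (at z) b)" for z
      unfolding grad_inner[OF \<eta>, of z v, symmetric] grad_def inner_sum_left
      by (simp add: inner_commute mult.commute)
    then have "?D v = (LINT y|lborel. (\<Sum>b\<in>Basis. (v \<bullet> b) * (frechet_derivative \<eta> (at (x - y)) b * f y)))"
      by (simp add: moll_def sum_distrib_right mult.assoc)
    also have "\<dots> = (\<Sum>b\<in>Basis. (v \<bullet> b) * ?D b)"
      unfolding moll_def using moll_integrable[OF test_frechet[OF \<eta>] f]
      by (subst Bochner_Integration.integral_sum) auto
    also have "\<dots> = (\<Sum>b\<in>Basis. ?D b *\<^sub>R b) \<bullet> v"
      unfolding inner_sum_left by (simp add: inner_commute mult.commute)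
    finally show ?thesis .
  qed
  then have D: "?D = (\<lambda>v. (\<Sum>b\<in>Basis. ?D b *\<^sub>R b) \<bullet> v)" by (rule ext)
  show "bounded_linear ?D" by (rule ssubst[OF D, of bounded_linear]) (rule bounded_linear_inner_right)
  fix e :: real assume e: "e > 0"
  obtain L where L: "L > 0" "\<And>x h. \<bar>\<eta> (x + h) - \<eta> x - grad \<eta> x \<bullet> h\<bar> \<le> L * (norm h)\<^sup>2"
    using test_taylor[OF \<eta>] by metis
  obtain R where R: "R > 0" "\<And>x. norm x \<ge> R \<Longrightarrow> \<eta> x = 0" using test_supportE[OF \<eta>] by metis
  have R': "grad \<eta> z = 0" if "norm z > R" for z
  proof -
    have "open {x::'a. R < norm x}" by (intro open_Collect_less continuous_intros)
    then show ?thesis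
      unfolding grad_def by (subst frechet_derivative_locally_0) (use that R(2) in auto)
  qed
  define A where "A = (LINT y|lborel. indicator (cball x (R + 1)) y * \<bar>f y\<bar>)"
  have A: "A \<ge> 0" unfolding A_def by (intro integral_nonneg_AE) auto
  \<comment> \<open>\<open>d \<le> 1\<close> keeps the shifted support inside the ball of radius
    \<open>R + 1\<close>; the other bound gives \<open>L * A * d \<le> e\<close>, one factor
    \<open>norm h\<close> of the quadratic remainder being spent on it.\<close>
  define d where "d = min 1 (e / (L * A + 1))"
  have "L * A + 1 > 0" using L A by (simp add: add_nonneg_pos)
  then have d: "d > 0" "d \<le> 1" "L * A * d \<le> e"
  proof -
    show "d > 0" "d \<le> 1" using e \<open>L * A + 1 > 0\<close> by (auto simp: d_def)
    have "d \<le> e / (L * A + 1)" by (simp add: d_def)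
    then have "d * (L * A + 1) \<le> e" using \<open>L * A + 1 > 0\<close> by (simp only: pos_le_divide_eq)
    then show "L * A * d \<le> e" using \<open>d > 0\<close> by (simp add: algebra_simps)
  qed
  show "\<exists>d>0. \<forall>y. norm (y - x) < d \<longrightarrow> norm (moll \<eta> f y - moll \<eta> f x - ?D (y - x)) \<le> e * norm (y - x)"
  proof (intro exI[of _ d] conjI allI impI d(1))
    fix x' assume x': "norm (x' - x) < d"
    define h where "h = x' - x"
    define g where "g y = (\<eta> (x' - y) - \<eta> (x - y) - frechet_derivative \<eta> (at (x - y)) h) * f y" for y
    note ints = moll_integrable[OF \<eta> f] moll_integrable[OF test_frechet[OF \<eta>] f]
    have "moll \<eta> f x' - moll \<eta> f x - ?D h = (LINT y|lborel. g y)"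
      using ints by (simp add: moll_def g_def left_diff_distrib)
    also have "\<bar>\<dots>\<bar> \<le> (LINT y|lborel. \<bar>g y\<bar>)" by (rule integral_abs_bound)
    also have "\<dots> \<le> (LINT y|lborel. L * (norm h)\<^sup>2 * (indicator (cball x (R + 1)) y * \<bar>f y\<bar>))"
    proof (rule integral_mono)
      show "integrable lborel (\<lambda>y. \<bar>g y\<bar>)"
        unfolding g_def left_diff_distrib
        by (intro integrable_abs Bochner_Integration.integrable_diff ints)
      show "integrable lborel (\<lambda>y. L * (norm h)\<^sup>2 * (indicator (cball x (R + 1)) y * \<bar>f y\<bar>))"
        by (intro integrable_mult_right cball_abs_integrable f)
      fix y
      show "\<bar>g y\<bar> \<le> L * (norm h)\<^sup>2 * (indicator (cball x (R + 1)) y * \<bar>f y\<bar>)"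
      proof (cases "y \<in> cball x (R + 1)")
        case True
        have "\<bar>\<eta> (x' - y) - \<eta> (x - y) - frechet_derivative \<eta> (at (x - y)) h\<bar> \<le> L * (norm h)\<^sup>2"
          using L(2)[of "x - y" h] grad_inner[OF \<eta>, of "x - y" h] by (simp add: h_def)
        then show ?thesis using True
          by (simp add: g_def abs_mult mult_right_mono)
      next
        case False
        then have n: "norm (x - y) > R + 1" by (simp add: dist_norm)
        have "norm (x - y) \<le> norm (x' - y) + norm (x' - x)"
          using norm_triangle_ineq4[of "x' - y" "x' - x"] by (simp add: algebra_simps)
        then have "norm (x' - y) \<ge> R" using n x' d(2) by linarith
        then have "g y = 0" using R(2)[of "x' - y"] R(2)[of "x - y"] R'[of "x - y"] n
          by (simp add: g_def grad_inner[OF \<eta>, symmetric])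
        then show ?thesis using False by simp
      qed
    qed
    also have "\<dots> = L * A * norm h * norm h" by (simp add: A_def power2_eq_square)
    also have "\<dots> \<le> L * A * d * norm h"
      using x' L A by (intro mult_right_mono mult_left_mono) (auto simp: h_def)
    also have "\<dots> \<le> e * norm h" by (intro mult_right_mono d) simp
    finally show "norm (moll \<eta> f x' - moll \<eta> f x - ?D (x' - x)) \<le> e * norm (x' - x)"
      by (simp add: h_def)
  qed
qed

lemma moll_Ck:
  assumes "square_integrable f"
  shows "test_function \<eta> \<Longrightarrow> Ck_fun k (moll \<eta> f)"
proof (induction k arbitrary: \<eta>)
  case 0
  have "continuous_on UNIV (moll \<eta> f)"
    using has_derivative_continuous[OF moll_has_derivative[OF 0 assms]]
    by (simp add: continuous_at_imp_continuous_on)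
  then show ?case by simp
next
  case (Suc k)
  show ?case
    by (rule Ck_SucI[OF moll_has_derivative[OF Suc.prems assms] Suc.IH[OF test_frechet[OF Suc.prems]]])
qed

lemma moll_measurable:
  assumes "test_function \<eta>" "square_integrable f"
  shows "moll \<eta> f \<in> borel_measurable borel"
  using moll_Ck[OF assms(2,1), of 0] by (intro borel_measurable_continuous_onI) simp

lemma moll_test:
  assumes "test_function \<eta>" "square_integrable f"
    and "\<And>x. norm x > r \<Longrightarrow> \<eta> x = 0" "\<And>x. norm x > R \<Longrightarrow> f x = 0"
  shows "test_function (moll \<eta> f)" "\<And>x. norm x > r + R \<Longrightarrow> moll \<eta> f x = 0"
proof -
  show 2: "moll \<eta> f x = 0" if "norm x > r + R" for x
  proof -
    have "\<eta> (x - y) * f y = 0" for y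
    proof (cases "norm y > R")
      case False
      have "norm x \<le> norm (x - y) + norm y" using norm_triangle_ineq[of "x - y" y] by simp
      then show ?thesis using that False assms(3)[of "x - y"] by simp
    qed (simp add: assms(4))
    then show ?thesis unfolding moll_def by (simp only: integral_zero)
  qed
  show "test_function (moll \<eta> f)"
    by (rule test_functionI[OF moll_Ck[OF assms(2,1)] 2])
qed

text \<open>The reflected mollifier \<open>y \<mapsto> \<eta> (x - y)\<close> is itself a test
  function. Its derivative carries a minus sign, which cancels the one in the definition of the weak
  gradient.\<close>

lemma moll_weak_gradient:
  assumes \<eta>: "test_function \<eta>" and u: "square_integrable u" "is_weak_gradient u G" and b: "b \<in> Basis"
  shows "frechet_derivative (moll \<eta> u) (at x) b = moll \<eta> (\<lambda>y. G y \<bullet> b) x"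
proof -
  let ?\<phi> = "\<lambda>y. \<eta> (x - y)"
  have d: "frechet_derivative ?\<phi> (at y) b = - frechet_derivative \<eta> (at (x - y)) b" for y
  proof -
    have "((\<lambda>y. x - y) has_derivative (\<lambda>v. - v)) (at y)" by (auto intro!: derivative_eq_intros)
    from has_derivative_compose[OF this test_derivative[OF \<eta>]]
    have "frechet_derivative ?\<phi> (at y) = (\<lambda>v. frechet_derivative \<eta> (at (x - y)) (- v))"
      by (rule frechet_derivative_eq)
    then show ?thesis
      using linear_neg[OF has_derivative_linear[OF test_derivative[OF \<eta>]]] by metis
  qed
  have "frechet_derivative (moll \<eta> u) (at x) b = moll (\<lambda>z. frechet_derivative \<eta> (at z) b) u x"
    using frechet_derivative_eq[OF moll_has_derivative[OF \<eta> u(1)]] by metis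
  also have "\<dots> = - (LINT y|lborel. u y * frechet_derivative ?\<phi> (at y) b)"
    by (simp add: moll_def d mult.commute)
  also have "\<dots> = (LINT y|lborel. (G y \<bullet> b) * ?\<phi> y)"
    using u(2) b test_reflect[OF \<eta>, of x] unfolding is_weak_gradient_def by simp
  finally show ?thesis by (simp add: moll_def mult.commute)
qed

definition mollifier :: "real \<Rightarrow> ('a::euclidean_space \<Rightarrow> real) \<Rightarrow> bool" where
  "mollifier r \<eta> \<longleftrightarrow> test_function \<eta> \<and> (\<forall>x. 0 \<le> \<eta> x) \<and> (\<forall>x. norm x \<ge> r \<longrightarrow> \<eta> x = 0) \<and> (LINT x|lborel. \<eta> x) = 1"

lemma mollifier_exists:
  assumes "r > 0"
  obtains \<eta> :: "'a::euclidean_space \<Rightarrow> real" where "mollifier r \<eta>"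
proof -
  define g :: "'a \<Rightarrow> real" where "g x = bump (0 + (1/r) *\<^sub>R x)" for x
  have g: "test_function g" unfolding g_def using assms by (intro test_affine bump_test) auto
  have gn: "g x \<ge> 0" for x by (simp add: g_def bump_nonneg)
  define c where "c = (LINT x|lborel. g x)"
  have "c \<noteq> 0"
  proof
    assume "c = 0"
    then have "AE x in lborel. g x = 0"
      unfolding c_def using integral_nonneg_eq_0_iff_AE[OF test_integrable[OF g]] gn by simp
    \<comment> \<open>A vanishing integral would make \<open>g\<close> vanish almost everywhere,
      although it is positive on the half ball. The closed complement of that half ball would then
      have full measure in an open ball around 0 and hence contain 0.\<close>
    then have "AE x\<in>ball 0 r in lebesgue. g x = 0"
      by (auto intro: AE_mp[OF AE_completion])
    have "g x > 0" if "x \<in> ball 0 (r/2)" for x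
      using that assms by (simp add: g_def bump_eq field_simps)
    then have "x \<in> ball 0 r \<longrightarrow> x \<in> - ball 0 (r/2)" if "x \<in> ball 0 r \<longrightarrow> g x = 0" for x
      using that by fastforce
    with \<open>AE x\<in>ball 0 r in lebesgue. g x = 0\<close> have "AE x\<in>ball (0::'a) r in lebesgue. x \<in> - ball 0 (r/2)"
      by (rule eventually_mono)
    then have "0 \<in> - ball (0::'a) (r/2)"
      by (rule mem_closed_if_AE_lebesgue_open[OF open_ball closed_Compl[OF open_ball]])
         (use assms in simp)
    then show False using assms by simp
  qed
  moreover have "c \<ge> 0" unfolding c_def using gn by (intro integral_nonneg_AE) simp
  ultimately have c: "c > 0" by simp
  have "mollifier r (\<lambda>x. (1/c) * g x)"
    unfolding mollifier_def
  proof (intro conjI allI impI test_cmult g)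
    show "0 \<le> (1/c) * g x" for x using c gn by simp
    show "(1/c) * g x = 0" if "r \<le> norm x" for x
      using that assms by (simp add: g_def bump_outside field_simps)
    show "(LINT x|lborel. (1/c) * g x) = 1"
      using c by (simp add: c_def)
  qed
  then show ?thesis by (rule that)
qed

lemma moll_shift: "moll \<eta> f x = (LINT z|lborel. \<eta> z * f (x - z))"
  if "test_function \<eta>" "square_integrable f"
proof -
  have [measurable]: "\<eta> \<in> borel_measurable borel" "f \<in> borel_measurable borel"
    using that test_measurable sqi_meas by auto
  show ?thesis
    using lborel_integral_reflect[of "\<lambda>y. \<eta> (x - y) * f y" x] by (simp add: moll_def)
qed

text \<open>Mollification averages translates: Jensen's inequality for the probability density
  \<eta> bounds the pointwise error, and Tonelli leaves an average of translation errors of size at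
  most \<open>s\<close>.\<close>

lemma moll_approx:
  assumes \<eta>: "mollifier r \<eta>" and f: "square_integrable f" and s: "0 \<le> s"
    and le: "\<And>z. norm z < r \<Longrightarrow> L2n (\<lambda>x. f (x + z) - f x) \<le> s"
  shows "square_integrable (moll \<eta> f)" "square_integrable (\<lambda>x. moll \<eta> f x - f x)"
    "L2n (\<lambda>x. moll \<eta> f x - f x) \<le> s"
proof -
  have t: "test_function \<eta>" and n: "\<And>x. \<eta> x \<ge> 0" and v: "\<And>x. norm x \<ge> r \<Longrightarrow> \<eta> x = 0"
    and i1: "(LINT x|lborel. \<eta> x) = 1"
    using \<eta> by (auto simp: mollifier_def)
  have [measurable]: "\<eta> \<in> borel_measurable borel" "f \<in> borel_measurable borel" "moll \<eta> f \<in> borel_measurable borel"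
    using t f test_measurable sqi_meas moll_measurable by auto
  obtain B where B: "B > 0" "\<And>x. \<bar>\<eta> x\<bar> \<le> B" using test_bounded[OF t] by metis
  have pw: "ennreal ((moll \<eta> f x - f x)\<^sup>2) \<le> (\<integral>\<^sup>+z. ennreal (\<eta> z) * ennreal ((f (x - z) - f x)\<^sup>2) \<partial>lborel)" for x
  proof -
    have fx: "square_integrable (\<lambda>z. f (x - z))" by (rule sqi_reflect[OF f])
    have j1: "integrable lborel (\<lambda>z. \<eta> z * f (x - z))" by (intro sqi_mult_integrable test_sqi t fx)
    have j2: "integrable lborel (\<lambda>z. \<eta> z * (f (x - z))\<^sup>2)"
    proof (rule Bochner_Integration.integrable_bound[where f = "\<lambda>z. B * (f (x - z))\<^sup>2"])
      show "integrable lborel (\<lambda>z. B * (f (x - z))\<^sup>2)" using fx by (simp add: sqi_real_iff)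
      have "\<bar>\<eta> z\<bar> * (f (x - z))\<^sup>2 \<le> B * (f (x - z))\<^sup>2" for z by (intro mult_right_mono B) auto
      then show "AE z in lborel. norm (\<eta> z * (f (x - z))\<^sup>2) \<le> norm (B * (f (x - z))\<^sup>2)"
        using B(1) by (simp add: abs_mult)
    qed measurable
    note j0 = test_integrable[OF t]
    define a where "a = moll \<eta> f x"
    have am: "a = (LINT z|lborel. \<eta> z * f (x - z))" unfolding a_def by (rule moll_shift[OF t f])
    define Q where "Q = (LINT z|lborel. \<eta> z * (f (x - z))\<^sup>2)"
    have eq: "\<eta> z * (f (x - z) - c)\<^sup>2 = \<eta> z * (f (x - z))\<^sup>2 - 2 * c * (\<eta> z * f (x - z)) + c\<^sup>2 * \<eta> z" for z c
      by (simp add: power2_eq_square algebra_simps)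
    have jc: "integrable lborel (\<lambda>z. \<eta> z * (f (x - z) - c)\<^sup>2)" for c
      unfolding eq by (intro Bochner_Integration.integrable_add Bochner_Integration.integrable_diff integrable_mult_right j0 j1 j2)
    have Ic: "(LINT z|lborel. \<eta> z * (f (x - z) - c)\<^sup>2) = Q - 2 * c * a + c\<^sup>2" for c
      unfolding eq using j0 j1 j2 by (simp add: Q_def am i1)
    \<comment> \<open>Jensen via the variance: nonnegativity at the mean \<open>a\<close> says
      \<open>a\<^sup>2 \<le> Q\<close>, and this inserted into \<open>Ic\<close> with the constant
      \<open>f x\<close> gives the estimate.\<close>
    have "0 \<le> (LINT z|lborel. \<eta> z * (f (x - z) - a)\<^sup>2)"
      by (intro integral_nonneg_AE) (simp add: n)
    then have "(a - f x)\<^sup>2 \<le> (LINT z|lborel. \<eta> z * (f (x - z) - f x)\<^sup>2)"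
      unfolding Ic by (simp add: power2_eq_square algebra_simps)
    then have "ennreal ((a - f x)\<^sup>2) \<le> ennreal (LINT z|lborel. \<eta> z * (f (x - z) - f x)\<^sup>2)"
      by (rule ennreal_leI)
    also have "\<dots> = (\<integral>\<^sup>+z. ennreal (\<eta> z * (f (x - z) - f x)\<^sup>2) \<partial>lborel)"
      using nn_integral_eq_integral[OF jc] n by simp
    also have "\<dots> = (\<integral>\<^sup>+z. ennreal (\<eta> z) * ennreal ((f (x - z) - f x)\<^sup>2) \<partial>lborel)"
      by (simp add: ennreal_mult n)
    finally show ?thesis by (simp add: a_def)
  qed
  have "(\<integral>\<^sup>+x. ennreal ((moll \<eta> f x - f x)\<^sup>2) \<partial>lborel)
      \<le> (\<integral>\<^sup>+x. (\<integral>\<^sup>+z. ennreal (\<eta> z) * ennreal ((f (x - z) - f x)\<^sup>2) \<partial>lborel) \<partial>lborel)"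
    by (rule nn_integral_mono) (rule pw)
  also have "\<dots> = (\<integral>\<^sup>+z. (\<integral>\<^sup>+x. ennreal (\<eta> z) * ennreal ((f (x - z) - f x)\<^sup>2) \<partial>lborel) \<partial>lborel)"
    by (rule lborel_pair.Fubini') measurable
  also have "\<dots> = (\<integral>\<^sup>+z. ennreal (\<eta> z) * (\<integral>\<^sup>+x. ennreal ((f (x + (- z)) - f x)\<^sup>2) \<partial>lborel) \<partial>lborel)"
    by (subst nn_integral_cmult) auto
  also have "\<dots> = (\<integral>\<^sup>+z. ennreal (\<eta> z) * ennreal ((L2n (\<lambda>x. f (x + (-z)) - f x))\<^sup>2) \<partial>lborel)"
    using nn_L2n[OF sqi_diff[OF sqi_translate(1)[OF f] f], of "- _"]
    by (simp only: real_norm_def power2_abs)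
  also have "\<dots> \<le> (\<integral>\<^sup>+z. ennreal (\<eta> z) * ennreal (s\<^sup>2) \<partial>lborel)"
  proof (rule nn_integral_mono)
    fix z
    show "ennreal (\<eta> z) * ennreal ((L2n (\<lambda>x. f (x + (-z)) - f x))\<^sup>2) \<le> ennreal (\<eta> z) * ennreal (s\<^sup>2)"
    proof (cases "norm z < r")
      case True
      then show ?thesis using le[of "-z"] by (intro mult_left_mono ennreal_leI power_mono) auto
    qed (simp add: v)
  qed
  also have "\<dots> = ennreal (s\<^sup>2)"
    using nn_integral_eq_integral[OF test_integrable[OF t]] n i1
    by (simp add: nn_integral_multc)
  finally have *: "(\<integral>\<^sup>+x. ennreal ((norm (moll \<eta> f x - f x))\<^sup>2) \<partial>lborel) \<le> ennreal (s\<^sup>2)" by simp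
  show 1: "square_integrable (\<lambda>x. moll \<eta> f x - f x)"
    by (rule sqi_nn(1)[OF _ *]) auto
  have "(L2n (\<lambda>x. moll \<eta> f x - f x))\<^sup>2 \<le> s\<^sup>2"
    by (rule sqi_nn(2)[OF _ *]) auto
  then show "L2n (\<lambda>x. moll \<eta> f x - f x) \<le> s" using s by (rule power2_le_imp_le)
  show "square_integrable (moll \<eta> f)" using sqi_add[OF 1 f] by simp
qed

section \<open>Continuity of translations\<close>

text \<open>Sequential form, so that dominated convergence applies directly.\<close>

definition L1_trans_cont :: "('a::euclidean_space \<Rightarrow> real) \<Rightarrow> bool" where
  "L1_trans_cont F \<longleftrightarrow> (\<forall>X. X \<longlonglongrightarrow> 0 \<longrightarrow> (\<lambda>n. LINT x|lborel. \<bar>F (x + X n) - F x\<bar>) \<longlonglongrightarrow> 0)"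

text \<open>The usual three-term estimate: the approximation error and its translate have the same
  L1 norm.\<close>

lemma L1_trans_cont_limit:
  fixes F :: "'a::euclidean_space \<Rightarrow> real"
  assumes F: "integrable lborel F"
    and approx: "\<And>e. e > 0 \<Longrightarrow> \<exists>G. integrable lborel G \<and> L1_trans_cont G \<and> (LINT x|lborel. \<bar>F x - G x\<bar>) < e"
  shows "L1_trans_cont F"
  unfolding L1_trans_cont_def
proof (intro allI impI LIMSEQ_I)
  fix X :: "nat \<Rightarrow> 'a" and e :: real assume X: "X \<longlonglongrightarrow> 0" and e: "e > 0"
  obtain G where G: "integrable lborel G" "L1_trans_cont G" "(LINT x|lborel. \<bar>F x - G x\<bar>) < e / 3"
    using approx[of "e/3"] e by auto
  have "(\<lambda>n. LINT x|lborel. \<bar>G (x + X n) - G x\<bar>) \<longlonglongrightarrow> 0"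
    using G(2) X by (auto simp: L1_trans_cont_def)
  then obtain N where N: "\<And>n. n \<ge> N \<Longrightarrow> (LINT x|lborel. \<bar>G (x + X n) - G x\<bar>) < e / 3"
    using e LIMSEQ_D[of _ 0 "e/3"] by (force simp del: divide_less_eq_numeral1 less_divide_eq_numeral1)
  show "\<exists>no. \<forall>n\<ge>no. norm ((LINT x|lborel. \<bar>F (x + X n) - F x\<bar>) - 0) < e"
  proof (intro exI allI impI)
    fix n assume n: "n \<ge> N"
    note Ft = lborel_integrable_translate[OF F, of "X n"] and Gt = lborel_integrable_translate[OF G(1), of "X n"]
    have "(LINT x|lborel. \<bar>F (x + X n) - F x\<bar>) \<le>
        (LINT x|lborel. \<bar>F (x + X n) - G (x + X n)\<bar> + \<bar>G (x + X n) - G x\<bar> + \<bar>F x - G x\<bar>)"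
      by (rule integral_mono) (use F G Ft Gt in \<open>auto intro!: integrable_abs\<close>)
    also have "\<dots> = (LINT x|lborel. \<bar>F (x + X n) - G (x + X n)\<bar>) + (LINT x|lborel. \<bar>G (x + X n) - G x\<bar>)
        + (LINT x|lborel. \<bar>F x - G x\<bar>)"
      using F G Ft Gt by (simp add: integrable_abs)
    also have "(LINT x|lborel. \<bar>F (x + X n) - G (x + X n)\<bar>) = (LINT x|lborel. \<bar>F x - G x\<bar>)"
      using F G by (intro lborel_integral_translate[of "\<lambda>x. \<bar>F x - G x\<bar>"])
        (auto simp: borel_measurable_integrable[simplified])
    finally have "(LINT x|lborel. \<bar>F (x + X n) - F x\<bar>) < e" using N[OF n] G(3) by linarith
    moreover have "(LINT x|lborel. \<bar>F (x + X n) - F x\<bar>) \<ge> 0" by (intro integral_nonneg_AE) auto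
    ultimately show "norm ((LINT x|lborel. \<bar>F (x + X n) - F x\<bar>) - 0) < e" by simp
  qed
qed

text \<open>Openness makes a point of \<open>U\<close> stay in \<open>U\<close> under small shifts,
  so the loss \<open>max 0 (?I x - ?I (x + X n))\<close> tends to 0 pointwise. The gain has the same
  integral as the loss, since translation preserves the measure of \<open>U\<close>.\<close>

lemma L1_trans_cont_open:
  fixes U :: "'a::euclidean_space set"
  assumes U: "open U" and fin: "emeasure lborel U < \<infinity>"
  shows "L1_trans_cont (\<lambda>x. c * indicator U x)"
  unfolding L1_trans_cont_def
proof (intro allI impI)
  fix X :: "nat \<Rightarrow> 'a" assume X: "X \<longlonglongrightarrow> 0"
  have [measurable]: "U \<in> sets borel" using U by simp
  let ?I = "indicator U :: 'a \<Rightarrow> real"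
  have I: "integrable lborel ?I" using fin by (intro integrable_real_indicator) auto
  note It = lborel_integrable_translate[OF I]
  have lim: "(\<lambda>n. LINT x|lborel. max 0 (?I x - ?I (x + X n))) \<longlonglongrightarrow> (LINT x|(lborel :: 'a measure). (0::real))"
  proof (rule integral_dominated_convergence[where w = ?I and f = "\<lambda>_. 0" and s = "\<lambda>n x. max 0 (?I x - ?I (x + X n))"])
    show "AE x in lborel. (\<lambda>n. max 0 (?I x - ?I (x + X n))) \<longlonglongrightarrow> 0"
    proof (rule AE_I2)
      fix x
      show "(\<lambda>n. max 0 (?I x - ?I (x + X n))) \<longlonglongrightarrow> 0"
      proof (cases "x \<in> U")
        case True
        have "(\<lambda>n. x + X n) \<longlonglongrightarrow> x + 0" by (intro tendsto_intros X)
        then have "\<forall>\<^sub>F n in sequentially. x + X n \<in> U"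
          using topological_tendstoD[of _ "x + 0" sequentially U] U True by simp
        then have "\<forall>\<^sub>F n in sequentially. max 0 (?I x - ?I (x + X n)) = 0"
          by eventually_elim (simp add: indicator_def)
        then show ?thesis by (rule tendsto_eventually)
      next
        case False
        then have "max 0 (?I x - ?I (x + X n)) = 0" for n by (simp add: indicator_def)
        then show ?thesis by simp
      qed
    qed
    show "AE x in lborel. norm (max 0 (?I x - ?I (x + X n))) \<le> ?I x" for n
      by (rule AE_I2) (auto simp: indicator_def)
  qed (use I in auto)
  have eq: "(LINT x|lborel. \<bar>c * ?I (x + X n) - c * ?I x\<bar>) = \<bar>c\<bar> * (2 * (LINT x|lborel. max 0 (?I x - ?I (x + X n))))" for n
  proof -
    have m: "integrable lborel (\<lambda>x. max 0 (?I x - ?I (x + X n)))"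
      using I It[of "X n"] by (intro integrable_max) auto
    have "(LINT x|lborel. \<bar>c * ?I (x + X n) - c * ?I x\<bar>) = (LINT x|lborel. \<bar>c\<bar> * (2 * max 0 (?I x - ?I (x + X n)) - (?I x - ?I (x + X n))))"
      by (rule Bochner_Integration.integral_cong) (auto simp: indicator_def)
    also have "\<dots> = \<bar>c\<bar> * (2 * (LINT x|lborel. max 0 (?I x - ?I (x + X n))) - ((LINT x|lborel. ?I x) - (LINT x|lborel. ?I (x + X n))))"
      using I It[of "X n"] m by (simp del: integral_indicator)
    also have "(LINT x|lborel. ?I (x + X n)) = (LINT x|lborel. ?I x)"
      by (rule lborel_integral_translate) simp
    finally show ?thesis by simp
  qed
  show "(\<lambda>n. LINT x|lborel. \<bar>c * ?I (x + X n) - c * ?I x\<bar>) \<longlonglongrightarrow> 0"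
    unfolding eq using tendsto_mult_left[OF tendsto_mult_left[OF lim, of 2], of "\<bar>c\<bar>"] by simp
qed

text \<open>Induction over integrable functions; the base case replaces a Borel set by an open
  superset of slightly larger measure, given by outer regularity.\<close>

lemma L1_trans_cont_integrable:
  fixes F :: "'a::euclidean_space \<Rightarrow> real"
  assumes "integrable lborel F"
  shows "L1_trans_cont F"
  using assms
proof (induction rule: integrable_induct)
  case (base A c)
  have Ab[measurable]: "A \<in> sets borel" using base by simp
  have IA: "integrable lborel (indicator A :: 'a \<Rightarrow> real)" using base by (intro integrable_real_indicator)
  have "L1_trans_cont (\<lambda>x. c * indicator A x)"
  proof (rule L1_trans_cont_limit)
    show "integrable lborel (\<lambda>x. c * indicator A x)" by (intro integrable_mult_right IA)
    fix e :: real assume e: "e > 0"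
    define d where "d = e / (\<bar>c\<bar> + 1)"
    have d: "d > 0" "\<bar>c\<bar> * d < e" using e by (auto simp: d_def field_simps)
    obtain U where U: "open U" "A \<subseteq> U" "emeasure lborel (U - A) \<le> ennreal d"
      using outer_regular_lborel_le[OF Ab d(1)] by metis
    have [measurable]: "U \<in> sets borel" using U by simp
    have "emeasure lborel U = emeasure lborel A + emeasure lborel (U - A)"
      using U(2) by (subst plus_emeasure) (auto simp: Un_absorb1)
    also have "\<dots> < \<infinity>" using base(2) U(3) by (auto simp: le_less_trans)
    finally have fin: "emeasure lborel U < \<infinity>" .
    have IU: "integrable lborel (indicator U :: 'a \<Rightarrow> real)" using fin by (intro integrable_real_indicator) auto
    have "(LINT x|lborel. \<bar>c * indicator A x - c * indicator U x\<bar>) = (LINT x|lborel. \<bar>c\<bar> * indicator (U - A) x)"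
      using U(2) by (intro Bochner_Integration.integral_cong) (auto simp: indicator_def)
    also have "\<dots> = \<bar>c\<bar> * measure lborel (U - A)" by simp
    also have "\<dots> \<le> \<bar>c\<bar> * d"
      using U(3) d(1) by (intro mult_left_mono) (auto simp: measure_def enn2real_leI)
    also have "\<dots> < e" by (rule d)
    finally show "\<exists>G. integrable lborel G \<and> L1_trans_cont G \<and> (LINT x|lborel. \<bar>c * indicator A x - G x\<bar>) < e"
      using L1_trans_cont_open[OF U(1) fin, of c] IU by (intro exI[of _ "\<lambda>x. c * indicator U x"]) auto
  qed
  then show ?case by (simp add: mult.commute)
next
  case (add f g)
  show ?case unfolding L1_trans_cont_def
  proof (intro allI impI)
    fix X :: "nat \<Rightarrow> 'a" assume X: "X \<longlonglongrightarrow> 0"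
    have l: "(\<lambda>n. (LINT x|lborel. \<bar>f (x + X n) - f x\<bar>) + (LINT x|lborel. \<bar>g (x + X n) - g x\<bar>)) \<longlonglongrightarrow> 0 + 0"
      using add X unfolding L1_trans_cont_def by (intro tendsto_add) auto
    have le: "(LINT x|lborel. \<bar>(f (x + X n) + g (x + X n)) - (f x + g x)\<bar>)
        \<le> (LINT x|lborel. \<bar>f (x + X n) - f x\<bar>) + (LINT x|lborel. \<bar>g (x + X n) - g x\<bar>)" for n
    proof -
      note ft = lborel_integrable_translate[OF add.hyps(1), of "X n"] and gt = lborel_integrable_translate[OF add.hyps(2), of "X n"]
      have "(LINT x|lborel. \<bar>(f (x + X n) + g (x + X n)) - (f x + g x)\<bar>)
        \<le> (LINT x|lborel. \<bar>f (x + X n) - f x\<bar> + \<bar>g (x + X n) - g x\<bar>)"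
        by (rule integral_mono) (use add.hyps ft gt in \<open>auto intro!: integrable_abs\<close>)
      then show ?thesis using add.hyps ft gt by (simp add: integrable_abs)
    qed
    show "(\<lambda>n. LINT x|lborel. \<bar>(f (x + X n) + g (x + X n)) - (f x + g x)\<bar>) \<longlonglongrightarrow> 0"
      by (rule tendsto_sandwich[OF _ _ tendsto_const l[simplified]])
         (auto intro!: always_eventually le integral_nonneg_AE)
  qed
next
  case (lim f s)
  show ?case
  proof (rule L1_trans_cont_limit[OF lim.hyps(4)])
    fix e :: real assume e: "e > 0"
    \<comment> \<open>The induction principle supplies
      \<open>\<bar>s n x\<bar> \<le> 2 * \<bar>f x\<bar>\<close>, whence the majorant with factor
      3.\<close>
    have "(\<lambda>n. LINT x|lborel. \<bar>f x - s n x\<bar>) \<longlonglongrightarrow> (LINT x|(lborel :: 'a measure). (0::real))"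
    proof (rule integral_dominated_convergence[where w = "\<lambda>x. 3 * \<bar>f x\<bar>"])
      show "AE x in lborel. (\<lambda>n. \<bar>f x - s n x\<bar>) \<longlonglongrightarrow> 0"
      proof (rule AE_I2)
        fix x
        have "(\<lambda>n. \<bar>f x - s n x\<bar>) \<longlonglongrightarrow> \<bar>f x - f x\<bar>" using lim.hyps(2)[of x] by (intro tendsto_intros) auto
        then show "(\<lambda>n. \<bar>f x - s n x\<bar>) \<longlonglongrightarrow> 0" by simp
      qed
      show "AE x in lborel. norm \<bar>f x - s n x\<bar> \<le> 3 * \<bar>f x\<bar>" for n
      proof (rule AE_I2)
        fix x
        show "norm \<bar>f x - s n x\<bar> \<le> 3 * \<bar>f x\<bar>" using lim.hyps(3)[of x n] by (simp add: abs_if split: if_splits)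
      qed
    qed (use lim.hyps(1,4) in \<open>auto intro!: integrable_abs\<close>)
    then obtain n where "(LINT x|lborel. \<bar>f x - s n x\<bar>) < e"
      using e by (auto dest!: LIMSEQ_D[where r = e])
    then show "\<exists>G. integrable lborel G \<and> L1_trans_cont G \<and> (LINT x|lborel. \<bar>f x - G x\<bar>) < e"
      using lim.hyps(1) lim.IH by blast
  qed
qed

text \<open>The signed square \<open>a * \<bar>a\<bar>\<close> loses no sign information, so the L1
  distance of signed squares controls the L2 distance of the functions. The constant 2 is attained
  at \<open>b = - a\<close>.\<close>

lemma sq_diff_le_signed:
  "(a - b)\<^sup>2 \<le> 2 * \<bar>a * \<bar>a\<bar> - b * \<bar>b\<bar>\<bar>" for a b :: real
proof -
  have *: "(a - b)\<^sup>2 \<le> 2 * \<bar>a * \<bar>a\<bar> - b * \<bar>b\<bar>\<bar>" if "b \<le> a" for a b :: real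
  proof -
    consider "0 \<le> b" | "b < 0" "0 \<le> a" | "a < 0" using that by linarith
    then show ?thesis
    proof cases
      case 1
      have "0 \<le> (a - b) * (a + 3 * b)" using 1 that by (intro mult_nonneg_nonneg) auto
      moreover have "b * b \<le> a * a" using 1 that by (intro mult_mono) auto
      ultimately show ?thesis using 1 that by (simp add: power2_eq_square algebra_simps)
    next
      case 2
      have "0 \<le> (a + b)\<^sup>2" by simp
      then have "(a - b)\<^sup>2 \<le> 2 * (a * a + b * b)" by (simp add: power2_eq_square algebra_simps)
      then show ?thesis using 2 by (simp add: abs_of_nonneg)
    next
      case 3
      have "0 \<le> (a - b) * (- b - 3 * a)" using 3 that by (intro mult_nonneg_nonneg) auto
      moreover have "0 \<le> (a - b) * (- a - b)" using 3 that by (intro mult_nonneg_nonneg) auto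
      ultimately show ?thesis using 3 that by (simp add: power2_eq_square algebra_simps)
    qed
  qed
  show ?thesis
  proof (cases "b \<le> a")
    case False
    then have "(b - a)\<^sup>2 \<le> 2 * \<bar>b * \<bar>b\<bar> - a * \<bar>a\<bar>\<bar>" by (intro *) auto
    then show ?thesis by (simp add: power2_commute abs_minus_commute)
  qed (rule *)
qed

text \<open>Applying the \<open>L\<^sup>1\<close> statement to \<open>f * \<bar>f\<bar>\<close> avoids a separate density argument in \<open>L\<^sup>2\<close>.\<close>

lemma L2_trans_cont:
  fixes f :: "'a::euclidean_space \<Rightarrow> real"
  assumes f: "square_integrable f" and s: "s > 0"
  obtains d where "d > 0" "\<And>z. norm z < d \<Longrightarrow> L2n (\<lambda>x. f (x + z) - f x) < s"
proof -
  define F where "F x = f x * \<bar>f x\<bar>" for x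
  have [measurable]: "f \<in> borel_measurable borel" using f sqi_meas by auto
  have F: "integrable lborel F"
    unfolding F_def by (intro sqi_mult_integrable f) (use f in \<open>auto simp: sqi_real_iff\<close>)
  have "\<exists>d>0. \<forall>z. norm z < d \<longrightarrow> L2n (\<lambda>x. f (x + z) - f x) < s"
  proof (rule ccontr)
    assume "\<not> ?thesis"
    then have "\<forall>n::nat. \<exists>z. norm z < inverse (real (Suc n)) \<and> L2n (\<lambda>x. f (x + z) - f x) \<ge> s"
      by (metis inverse_positive_iff_positive not_less of_nat_0_less_iff zero_less_Suc)
    then obtain X where X: "\<And>n. norm (X n) < inverse (real (Suc n))" "\<And>n. L2n (\<lambda>x. f (x + X n) - f x) \<ge> s"
      by metis
    have "X \<longlonglongrightarrow> 0"
      by (rule Lim_null_comparison[OF _ LIMSEQ_inverse_real_of_nat])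
         (use X(1) in \<open>auto intro!: always_eventually less_imp_le\<close>)
    then have l: "(\<lambda>n. LINT x|lborel. \<bar>F (x + X n) - F x\<bar>) \<longlonglongrightarrow> 0"
      using L1_trans_cont_integrable[OF F] by (auto simp: L1_trans_cont_def)
    have "s\<^sup>2 \<le> 2 * (LINT x|lborel. \<bar>F (x + X n) - F x\<bar>)" for n
    proof -
      have "s\<^sup>2 \<le> (L2n (\<lambda>x. f (x + X n) - f x))\<^sup>2" using X(2) s by (intro power_mono) auto
      also have "\<dots> = (LINT x|lborel. (f (x + X n) - f x)\<^sup>2)" by (rule L2n_real_sq)
      also have "\<dots> \<le> (LINT x|lborel. 2 * \<bar>F (x + X n) - F x\<bar>)"
      proof (rule integral_mono)
        show "integrable lborel (\<lambda>x. (f (x + X n) - f x)\<^sup>2)"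
          using sqi_diff[OF sqi_translate(1)[OF f] f] by (simp add: sqi_real_iff)
        show "integrable lborel (\<lambda>x. 2 * \<bar>F (x + X n) - F x\<bar>)"
          using F lborel_integrable_translate[OF F] by (auto intro!: integrable_abs)
      qed (auto simp: F_def sq_diff_le_signed)
      finally show ?thesis by simp
    qed
    then have "s\<^sup>2 \<le> 2 * 0"
      by (intro LIMSEQ_le_const[OF tendsto_mult_left[OF l, of 2]]) auto
    then show False using s by simp
  qed
  then show ?thesis using that by blast
qed

section \<open>Weak gradients\<close>

text \<open>Each value of a mollification of \<open>f\<close> is a pairing of \<open>f\<close> with
  a test function, hence 0; but mollifications come arbitrarily close to \<open>f\<close> in
  L2.\<close>

lemma fundamental_lemma:
  fixes f :: "'a::euclidean_space \<Rightarrow> real"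
  assumes f: "square_integrable f" and z: "\<And>\<phi>. test_function \<phi> \<Longrightarrow> (LINT x|lborel. f x * \<phi> x) = 0"
  shows "AE x in lborel. f x = 0"
proof -
  have "L2n f \<le> s" if s: "s > 0" for s
  proof -
    obtain d where d: "d > 0" "\<And>z. norm z < d \<Longrightarrow> L2n (\<lambda>x. f (x + z) - f x) < s"
      using L2_trans_cont[OF f s] by metis
    obtain \<eta> :: "'a \<Rightarrow> real" where \<eta>: "mollifier d \<eta>" using mollifier_exists[OF d(1)] by metis
    have "moll \<eta> f x = 0" for x
      using z[OF test_reflect[of \<eta> x]] \<eta> by (simp add: moll_def mollifier_def mult.commute)
    moreover have "L2n (\<lambda>x. moll \<eta> f x - f x) \<le> s"
      by (rule moll_approx[OF \<eta> f]) (use s d(2) in \<open>auto intro: less_imp_le\<close>)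
    ultimately show ?thesis by (simp add: L2n_def)
  qed
  then have "L2n f \<le> 0" by (rule field_le_epsilon[of _ 0, simplified])
  then have "L2n f = 0" using L2n_nonneg[of f] by linarith
  then show ?thesis using L2n_eq_0_iff[OF f] by simp
qed

lemma AE_eq_if_inner_Basis:
  fixes G H :: "'a::euclidean_space \<Rightarrow> 'b::euclidean_space"
  assumes "\<And>b. b \<in> Basis \<Longrightarrow> AE x in lborel. G x \<bullet> b = H x \<bullet> b"
  shows "AE x in lborel. G x = H x"
proof -
  have "AE x in lborel. \<forall>b\<in>Basis. G x \<bullet> b = H x \<bullet> b"
    using assms by (subst AE_finite_all) auto
  then show ?thesis by eventually_elim (rule euclidean_eqI, simp)
qed

lemma weak_gradient_unique:
  assumes "is_weak_gradient u G" "is_weak_gradient u H" "square_integrable G" "square_integrable H"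
  shows "AE x in lborel. G x = H x"
proof (rule AE_eq_if_inner_Basis)
  fix b :: 'a assume b: "b \<in> Basis"
  have "AE x in lborel. G x \<bullet> b - H x \<bullet> b = 0"
  proof (rule fundamental_lemma)
    show "square_integrable (\<lambda>x. G x \<bullet> b - H x \<bullet> b)" by (intro sqi_diff sqi_component assms)
    fix \<phi> :: "'a \<Rightarrow> real" assume \<phi>: "test_function \<phi>"
    have "integrable lborel (\<lambda>x. G x \<bullet> b * \<phi> x)" "integrable lborel (\<lambda>x. H x \<bullet> b * \<phi> x)"
      by (intro sqi_mult_integrable sqi_component test_sqi assms \<phi>)+
    moreover have "(LINT x|lborel. G x \<bullet> b * \<phi> x) = (LINT x|lborel. H x \<bullet> b * \<phi> x)"
      using assms(1,2) \<phi> b unfolding is_weak_gradient_def by fastforce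
    ultimately show "(LINT x|lborel. (G x \<bullet> b - H x \<bullet> b) * \<phi> x) = 0"
      by (simp add: left_diff_distrib)
  qed
  then show "AE x in lborel. G x \<bullet> b = H x \<bullet> b" by eventually_elim simp
qed

lemma W12_D:
  assumes "u \<in> W12"
  shows "square_integrable u" "square_integrable (weak_grad u)" "is_weak_gradient u (weak_grad u)"
proof -
  show "square_integrable u" using assms by (simp add: W12_def)
  have "\<exists>G. square_integrable G \<and> is_weak_gradient u G" using assms by (simp add: W12_def)
  then have "square_integrable (weak_grad u) \<and> is_weak_gradient u (weak_grad u)"
    unfolding weak_grad_def by (rule someI_ex)
  then show "square_integrable (weak_grad u)" "is_weak_gradient u (weak_grad u)" by auto
qed

lemma weak_grad_eq:
  assumes "square_integrable u" "square_integrable G" "is_weak_gradient u G"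
  shows "u \<in> W12" "AE x in lborel. weak_grad u x = G x"
proof -
  show "u \<in> W12" using assms by (auto simp: W12_def)
  from weak_gradient_unique[OF W12_D(3)[OF this] assms(3) W12_D(2)[OF this] assms(2)]
  show "AE x in lborel. weak_grad u x = G x" .
qed

lemma weak_gradient_add:
  assumes "is_weak_gradient u G" "is_weak_gradient v H"
    "square_integrable u" "square_integrable v" "square_integrable G" "square_integrable H"
  shows "is_weak_gradient (\<lambda>x. u x + v x) (\<lambda>x. G x + H x)"
  unfolding is_weak_gradient_def
proof (intro allI impI ballI)
  fix \<phi> :: "'a \<Rightarrow> real" and b :: 'a assume \<phi>: "test_function \<phi>" and b: "b \<in> Basis"
  have i: "integrable lborel (\<lambda>x. u x * frechet_derivative \<phi> (at x) b)"
    "integrable lborel (\<lambda>x. v x * frechet_derivative \<phi> (at x) b)"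
    "integrable lborel (\<lambda>x. G x \<bullet> b * \<phi> x)" "integrable lborel (\<lambda>x. H x \<bullet> b * \<phi> x)"
    by (intro sqi_mult_integrable sqi_component test_sqi test_frechet assms \<phi>)+
  have "(LINT x|lborel. u x * frechet_derivative \<phi> (at x) b) = - (LINT x|lborel. G x \<bullet> b * \<phi> x)"
    "(LINT x|lborel. v x * frechet_derivative \<phi> (at x) b) = - (LINT x|lborel. H x \<bullet> b * \<phi> x)"
    using assms(1,2) \<phi> b by (auto simp: is_weak_gradient_def)
  then show "(LINT x|lborel. (u x + v x) * frechet_derivative \<phi> (at x) b) = - (LINT x|lborel. (G x + H x) \<bullet> b * \<phi> x)"
    using i by (simp add: distrib_right inner_add_left)
qed

lemma weak_gradient_scale:
  assumes "is_weak_gradient u G"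
  shows "is_weak_gradient (\<lambda>x. c * u x) (\<lambda>x. c *\<^sub>R G x)"
  using assms unfolding is_weak_gradient_def by (simp add: mult.assoc)

text \<open>The product of \<kappa> with a test function is again one and may be inserted into the
  identity for \<open>u\<close>; the product rule sorts the terms.\<close>

lemma weak_gradient_cutoff:
  assumes u: "is_weak_gradient u G" "square_integrable u" "square_integrable G" and \<kappa>: "test_function \<kappa>"
  shows "is_weak_gradient (\<lambda>x. \<kappa> x * u x) (\<lambda>x. \<kappa> x *\<^sub>R G x + u x *\<^sub>R grad \<kappa> x)"
  unfolding is_weak_gradient_def
proof (intro allI impI ballI)
  fix \<phi> :: "'a \<Rightarrow> real" and b :: 'a assume \<phi>: "test_function \<phi>" and b: "b \<in> Basis"
  have t: "test_function (\<lambda>x. \<kappa> x * \<phi> x)" by (intro test_mult \<phi> \<kappa>)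
  have i1: "integrable lborel (\<lambda>x. u x * (\<kappa> x * frechet_derivative \<phi> (at x) b))"
    by (intro sqi_mult_integrable u test_sqi test_mult \<kappa> test_frechet \<phi>)
  have i2: "integrable lborel (\<lambda>x. u x * (frechet_derivative \<kappa> (at x) b * \<phi> x))"
    by (intro sqi_mult_integrable u test_sqi test_mult \<kappa> test_frechet \<phi>)
  have i3: "integrable lborel (\<lambda>x. G x \<bullet> b * (\<kappa> x * \<phi> x))"
    by (intro sqi_mult_integrable sqi_component u test_sqi test_mult \<kappa> \<phi>)
  have "(LINT x|lborel. u x * (\<kappa> x * frechet_derivative \<phi> (at x) b)) + (LINT x|lborel. u x * (frechet_derivative \<kappa> (at x) b * \<phi> x))
      = - (LINT x|lborel. G x \<bullet> b * (\<kappa> x * \<phi> x))"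
  proof -
    have "(LINT x|lborel. u x * frechet_derivative (\<lambda>x. \<kappa> x * \<phi> x) (at x) b) = - (LINT x|lborel. G x \<bullet> b * (\<kappa> x * \<phi> x))"
      using u(1) t b unfolding is_weak_gradient_def by blast
    then show ?thesis using i1 i2 by (simp add: frechet_mult[OF \<kappa> \<phi>] distrib_left)
  qed
  then have "(LINT x|lborel. u x * (\<kappa> x * frechet_derivative \<phi> (at x) b))
      = - ((LINT x|lborel. G x \<bullet> b * (\<kappa> x * \<phi> x)) + (LINT x|lborel. u x * (frechet_derivative \<kappa> (at x) b * \<phi> x)))"
    by linarith
  also have "\<dots> = - (LINT x|lborel. G x \<bullet> b * (\<kappa> x * \<phi> x) + u x * (frechet_derivative \<kappa> (at x) b * \<phi> x))"
    using i2 i3 by simp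
  finally show "(LINT x|lborel. (\<kappa> x * u x) * frechet_derivative \<phi> (at x) b)
      = - (LINT x|lborel. (\<kappa> x *\<^sub>R G x + u x *\<^sub>R grad \<kappa> x) \<bullet> b * \<phi> x)"
    by (simp add: inner_add_left grad_inner[OF \<kappa>] algebra_simps)
qed

lemma test_W12:
  assumes "test_function \<phi>"
  shows "\<phi> \<in> W12" "AE x in lborel. weak_grad \<phi> x = grad \<phi> x"
  using weak_grad_eq[OF test_sqi[OF assms] test_grad_sqi[OF assms] test_weak_gradient[OF assms]] .

section \<open>The space W\<close>

lemma L2_dominated:
  fixes f :: "nat \<Rightarrow> 'a::euclidean_space \<Rightarrow> 'b::euclidean_space"
  assumes [measurable]: "\<And>n. f n \<in> borel_measurable borel" and g: "square_integrable g"
    and lim: "AE x in lborel. (\<lambda>n. f n x) \<longlonglongrightarrow> 0"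
    and le: "\<And>n. AE x in lborel. norm (f n x) \<le> norm (g x)"
  shows "(\<lambda>n. L2n (f n)) \<longlonglongrightarrow> 0"
proof -
  have "(\<lambda>n. LINT x|lborel. (norm (f n x))\<^sup>2) \<longlonglongrightarrow> (LINT x|(lborel::'a measure). (0::real))"
  proof (rule integral_dominated_convergence[where w = "\<lambda>x. (norm (g x))\<^sup>2"])
    show "integrable lborel (\<lambda>x. (norm (g x))\<^sup>2)" by (rule sqi_integrable[OF g])
    show "AE x in lborel. (\<lambda>n. (norm (f n x))\<^sup>2) \<longlonglongrightarrow> 0"
      using lim
    proof eventually_elim
      case (elim x)
      have "(\<lambda>n. (norm (f n x))\<^sup>2) \<longlonglongrightarrow> (norm (0::'b))\<^sup>2" by (intro tendsto_intros elim)
      then show ?case by simp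
    qed
    show "AE x in lborel. norm ((norm (f n x))\<^sup>2) \<le> (norm (g x))\<^sup>2" for n
      using le[of n] by eventually_elim (auto intro: power_mono)
  qed auto
  then have "(\<lambda>n. sqrt (LINT x|lborel. (norm (f n x))\<^sup>2)) \<longlonglongrightarrow> sqrt 0"
    by (intro tendsto_real_sqrt) simp
  then show ?thesis by (simp add: L2n_def[abs_def])
qed

lemma L2n_vector_le:
  fixes G :: "'a::euclidean_space \<Rightarrow> 'b::euclidean_space"
  assumes "square_integrable G"
  shows "L2n G \<le> (\<Sum>b\<in>Basis. L2n (\<lambda>x. G x \<bullet> b))"
proof (rule power2_le_imp_le)
  have "(norm (G x))\<^sup>2 = (\<Sum>b\<in>Basis. (G x \<bullet> b)\<^sup>2)" for x
    unfolding power2_norm_eq_inner by (subst euclidean_inner) (simp add: power2_eq_square)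
  then have "(L2n G)\<^sup>2 = (\<Sum>b\<in>Basis. (L2n (\<lambda>x. G x \<bullet> b))\<^sup>2)"
    unfolding L2n_sq using sqi_integrable[OF sqi_component(1)[OF assms]]
    by (simp add: Bochner_Integration.integral_sum)
  also have "\<dots> \<le> (\<Sum>b\<in>Basis. L2n (\<lambda>x. G x \<bullet> b))\<^sup>2"
    using power_mono[OF L2_set_le_sum[of Basis "\<lambda>b. L2n (\<lambda>x. G x \<bullet> b)"], of 2]
    by (simp add: L2_set_def sum_nonneg)
  finally show "(L2n G)\<^sup>2 \<le> (\<Sum>b\<in>Basis. L2n (\<lambda>x. G x \<bullet> b))\<^sup>2" .
qed (simp add: sum_nonneg)

lemma weak_gradient_cong:
  assumes "is_weak_gradient u G" "AE x in lborel. v x = u x" "AE x in lborel. H x = G x"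
    "u \<in> borel_measurable borel" "v \<in> borel_measurable borel"
    "G \<in> borel_measurable borel" "H \<in> borel_measurable borel"
  shows "is_weak_gradient v H"
  unfolding is_weak_gradient_def
proof (intro allI impI ballI)
  fix \<phi> :: "'a \<Rightarrow> real" and b :: 'a assume \<phi>: "test_function \<phi>" and b: "b \<in> Basis"
  have [measurable]: "\<phi> \<in> borel_measurable borel" "(\<lambda>x. frechet_derivative \<phi> (at x) b) \<in> borel_measurable borel"
    using test_measurable \<phi> test_frechet[OF \<phi>] by blast+
  note [measurable] = assms(4-7)
  have "(LINT x|lborel. v x * frechet_derivative \<phi> (at x) b) = (LINT x|lborel. u x * frechet_derivative \<phi> (at x) b)"
    by (rule integral_cong_AE) (use assms(2) in \<open>auto elim!: eventually_mono\<close>)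
  also have "\<dots> = - (LINT x|lborel. G x \<bullet> b * \<phi> x)"
    using assms(1) \<phi> b by (simp add: is_weak_gradient_def)
  also have "(LINT x|lborel. G x \<bullet> b * \<phi> x) = (LINT x|lborel. H x \<bullet> b * \<phi> x)"
    by (rule integral_cong_AE) (use assms(3) in \<open>auto elim!: eventually_mono\<close>)
  finally show "(LINT x|lborel. v x * frechet_derivative \<phi> (at x) b) = - (LINT x|lborel. H x \<bullet> b * \<phi> x)" .
qed

text \<open>Both sides of the defining identity are L2 pairings with a fixed function.\<close>

lemma weak_gradient_limit:
  fixes u :: "'a::euclidean_space \<Rightarrow> real"
  assumes u: "\<And>n. is_weak_gradient (U n) (H n)" "\<And>n. square_integrable (U n)" "\<And>n. square_integrable (H n)"
    "square_integrable u" "square_integrable G"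
    and l1: "(\<lambda>n. L2n (\<lambda>x. U n x - u x)) \<longlonglongrightarrow> 0"
    and l2: "(\<lambda>n. L2n (\<lambda>x. H n x - G x)) \<longlonglongrightarrow> 0"
  shows "is_weak_gradient u G"
  unfolding is_weak_gradient_def
proof (intro allI impI ballI)
  fix \<phi> :: "'a \<Rightarrow> real" and b :: 'a assume \<phi>: "test_function \<phi>" and b: "b \<in> Basis"
  have conv: "(\<lambda>n. L2ip (A n) \<psi>) \<longlonglongrightarrow> L2ip a \<psi>"
    if "\<And>n. square_integrable (A n)" "square_integrable a" "square_integrable \<psi>" "(\<lambda>n. L2n (\<lambda>x. A n x - a x)) \<longlonglongrightarrow> 0"
    for A and a \<psi> :: "'a \<Rightarrow> 'b::euclidean_space"
  proof -
    have "(\<lambda>n. L2ip (A n) \<psi> - L2ip a \<psi>) \<longlonglongrightarrow> 0"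
    proof (rule Lim_null_comparison[OF always_eventually])
      show "(\<lambda>n. L2n (\<lambda>x. A n x - a x) * L2n \<psi>) \<longlonglongrightarrow> 0"
        using tendsto_mult_right[OF that(4), of "L2n \<psi>"] by simp
      show "\<forall>n. norm (L2ip (A n) \<psi> - L2ip a \<psi>) \<le> L2n (\<lambda>x. A n x - a x) * L2n \<psi>"
        using L2_Cauchy_Schwarz[OF sqi_diff[OF that(1,2)] that(3)] L2ip_diff_left[OF that(1,2,3)] by simp
    qed
    then show ?thesis by (simp add: LIM_zero_iff)
  qed
  let ?d = "\<lambda>x. frechet_derivative \<phi> (at x) b"
  have 1: "(\<lambda>n. L2ip (U n) ?d) \<longlonglongrightarrow> L2ip u ?d"
    by (intro conv u l1 test_sqi test_frechet \<phi>)
  have sb: "square_integrable (\<lambda>x. \<phi> x *\<^sub>R b)"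
    by (rule sqi_vector) (use \<phi> test_sqi[OF test_cmult[OF \<phi>]] in \<open>simp add: mult.commute[of "\<phi> _"]\<close>)
  have 2: "(\<lambda>n. L2ip (H n) (\<lambda>x. \<phi> x *\<^sub>R b)) \<longlonglongrightarrow> L2ip G (\<lambda>x. \<phi> x *\<^sub>R b)"
    by (intro conv u l2 sb)
  have "L2ip (U n) ?d = - L2ip (H n) (\<lambda>x. \<phi> x *\<^sub>R b)" for n
    using u(1)[of n] \<phi> b by (simp add: is_weak_gradient_def L2ip_def mult.commute)
  then have "(\<lambda>n. L2ip (U n) ?d) \<longlonglongrightarrow> - L2ip G (\<lambda>x. \<phi> x *\<^sub>R b)"
    using tendsto_minus[OF 2] by simp
  then have "L2ip u ?d = - L2ip G (\<lambda>x. \<phi> x *\<^sub>R b)"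
    using 1 LIMSEQ_unique by metis
  then show "(LINT x|lborel. u x * ?d x) = - (LINT x|lborel. G x \<bullet> b * \<phi> x)"
    by (simp add: L2ip_def mult.commute)
qed

lemma filterlim_at_infinity_ge:
  fixes V :: "'a::euclidean_space \<Rightarrow> real"
  assumes "filterlim V at_top at_infinity"
  obtains R where "R > 0" "\<And>x. norm x \<ge> R \<Longrightarrow> V x \<ge> M"
proof -
  have "\<forall>\<^sub>F x in at_infinity. V x \<ge> M" using assms by (simp add: filterlim_at_top)
  then obtain R where "\<And>x. norm x \<ge> R \<Longrightarrow> V x \<ge> M" by (auto simp: eventually_at_infinity)
  then show ?thesis by (intro that[of "max R 1"]) auto
qed

text \<open>The map \<open>u \<mapsto> wpair V (weak_grad u) u\<close> embeds \<open>W\<close> isometrically into \<open>L\<^sup>2\<close> with values in \<open>'a \<times> real\<close>.\<close>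

definition wpair :: "('a::euclidean_space \<Rightarrow> real) \<Rightarrow> ('a \<Rightarrow> 'a) \<Rightarrow> ('a \<Rightarrow> real) \<Rightarrow> 'a \<Rightarrow> 'a \<times> real" where
  "wpair V G u x = (G x, sqrt (V x) * u x)"

locale potential =
  fixes V :: "'a::euclidean_space \<Rightarrow> real" and aV :: real
  assumes V_cont: "continuous_on UNIV V"
    and V_lim: "filterlim V at_top at_infinity"
    and aV_pos: "aV > 0"
    and V_ge: "V x \<ge> aV"
begin

lemma V_pos: "V x > 0"
  using V_ge[of x] aV_pos by linarith

lemma V_measurable [measurable]: "V \<in> borel_measurable borel"
  by (rule borel_measurable_continuous_onI[OF V_cont])

lemma norm_wpair: "(norm (wpair V G u x))\<^sup>2 = (norm (G x))\<^sup>2 + V x * (u x)\<^sup>2"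
  using less_imp_le[OF V_pos[of x]] by (simp add: wpair_def norm_Pair power_mult_distrib)

lemma wpair_measurable [measurable]:
  assumes [measurable]: "G \<in> borel_measurable borel" "u \<in> borel_measurable borel"
  shows "wpair V G u \<in> borel_measurable borel"
proof -
  have "(\<lambda>x. sqrt (V x) * u x) \<in> borel_measurable borel"
    by (intro borel_measurable_times borel_measurable_continuous_onI continuous_on_real_sqrt V_cont assms)
  with assms(1) show ?thesis unfolding wpair_def[abs_def] by (rule borel_measurable_Pair)
qed

lemma wpair_diff: "wpair V (\<lambda>x. G x - H x) (\<lambda>x. u x - v x) x = wpair V G u x - wpair V H v x"
  by (simp add: wpair_def algebra_simps)

lemma wpair_le:
  "norm (G x) \<le> norm (wpair V G u x)" "\<bar>u x\<bar> \<le> norm ((1 / sqrt aV) *\<^sub>R wpair V G u x)"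
proof -
  show "norm (G x) \<le> norm (wpair V G u x)"
    by (rule power2_le_imp_le) (use V_pos[of x] in \<open>auto simp: norm_wpair\<close>)
  have "aV * (u x)\<^sup>2 \<le> V x * (u x)\<^sup>2" by (intro mult_right_mono V_ge) auto
  then have "aV * (u x)\<^sup>2 \<le> (norm (wpair V G u x))\<^sup>2" by (simp add: norm_wpair add_increasing)
  then have "(u x)\<^sup>2 \<le> (norm ((1 / sqrt aV) *\<^sub>R wpair V G u x))\<^sup>2"
    using aV_pos by (simp add: power_divide field_simps)
  then show "\<bar>u x\<bar> \<le> norm ((1 / sqrt aV) *\<^sub>R wpair V G u x)"
    by (rule abs_le_square_iff[THEN iffD2, of _ "norm _", simplified abs_norm_cancel])
qed

lemma sqi_wpair_D:
  assumes "square_integrable (wpair V G u)" "u \<in> borel_measurable borel" "G \<in> borel_measurable borel"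
  shows "square_integrable G" "square_integrable u" "L2n G \<le> L2n (wpair V G u)"
    "L2n u \<le> L2n (wpair V G u) / sqrt aV" "integrable lborel (\<lambda>x. V x * (u x)\<^sup>2)"
proof -
  show G: "square_integrable G" "L2n G \<le> L2n (wpair V G u)"
    using sqi_bound[OF assms(1,3)] wpair_le by auto
  show "square_integrable u" "L2n u \<le> L2n (wpair V G u) / sqrt aV"
    using sqi_bound[OF sqi_scaleR(1)[OF assms(1), of "1 / sqrt aV"] assms(2)] wpair_le
      sqi_scaleR(2)[OF assms(1), of "1 / sqrt aV"] aV_pos by auto
  have "integrable lborel (\<lambda>x. (norm (wpair V G u x))\<^sup>2 - (norm (G x))\<^sup>2)"
    by (intro Bochner_Integration.integrable_diff sqi_integrable assms G)
  then show "integrable lborel (\<lambda>x. V x * (u x)\<^sup>2)" by (simp add: norm_wpair)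
qed

abbreviation F :: "('a \<Rightarrow> real) \<Rightarrow> 'a \<Rightarrow> 'a \<times> real" where
  "F u \<equiv> wpair V (weak_grad u) u"

lemma W_norm_eq: "W_norm V u = L2n (F u)"
  by (simp add: W_norm_def L2n_def norm_wpair)

lemma W_D:
  assumes "u \<in> W_space V"
  shows "u \<in> W12" "square_integrable u" "square_integrable (weak_grad u)" "is_weak_gradient u (weak_grad u)"
    "square_integrable (F u)" "u \<in> borel_measurable borel" "weak_grad u \<in> borel_measurable borel"
    "integrable lborel (\<lambda>x. V x * (u x)\<^sup>2)"
proof -
  show w: "u \<in> W12" and i: "integrable lborel (\<lambda>x. V x * (u x)\<^sup>2)"
    using assms by (auto simp: W_space_def)
  show s: "square_integrable u" "square_integrable (weak_grad u)" "is_weak_gradient u (weak_grad u)"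
    using W12_D[OF w] by auto
  show [measurable]: "u \<in> borel_measurable borel" "weak_grad u \<in> borel_measurable borel"
    using s sqi_meas by auto
  have "F u \<in> borel_measurable borel" by measurable
  then show "square_integrable (F u)"
    using sqi_integrable[OF s(2)] i by (simp add: square_integrable_def norm_wpair)
qed

text \<open>\<open>weak_grad\<close> is an arbitrary choice, fixed only up to null sets. This frees
  computations from it: membership and norm may be read off from any explicit weak gradient.\<close>

lemma W_I:
  assumes "square_integrable (wpair V G u)" "u \<in> borel_measurable borel" "G \<in> borel_measurable borel"
    "is_weak_gradient u G"
  shows "u \<in> W_space V" "AE x in lborel. weak_grad u x = G x" "AE x in lborel. F u x = wpair V G u x"
    "W_norm V u = L2n (wpair V G u)"
proof -
  note s = sqi_wpair_D[OF assms(1-3)]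
  show ae: "AE x in lborel. weak_grad u x = G x" using weak_grad_eq[OF s(2,1) assms(4)] by simp
  show W: "u \<in> W_space V" using weak_grad_eq[OF s(2,1) assms(4)] s(5) by (simp add: W_space_def)
  show ae2: "AE x in lborel. F u x = wpair V G u x"
    using ae by eventually_elim (simp add: wpair_def)
  show "W_norm V u = L2n (wpair V G u)"
    unfolding W_norm_eq
    by (rule sqi_cong_AE(2)[OF assms(1) sqi_meas[OF W_D(5)[OF W]] ae2])
qed

lemma W_I':
  assumes "square_integrable u" "square_integrable G" "is_weak_gradient u G" "integrable lborel (\<lambda>x. V x * (u x)\<^sup>2)"
  shows "square_integrable (wpair V G u)" "u \<in> W_space V"
proof -
  have [measurable]: "u \<in> borel_measurable borel" "G \<in> borel_measurable borel"
    using assms sqi_meas by auto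
  have "wpair V G u \<in> borel_measurable borel" by measurable
  then show s: "square_integrable (wpair V G u)"
    using sqi_integrable[OF assms(2)] assms(4) by (simp add: square_integrable_def norm_wpair)
  show "u \<in> W_space V" by (rule W_I[OF s _ _ assms(3)]) measurable
qed

lemma L2_le_W: "u \<in> W_space V \<Longrightarrow> L2n u \<le> W_norm V u / sqrt aV"
  unfolding W_norm_eq by (rule sqi_wpair_D(4)) (auto intro: W_D)

lemma grad_le_W: "u \<in> W_space V \<Longrightarrow> L2n (weak_grad u) \<le> W_norm V u"
  unfolding W_norm_eq by (rule sqi_wpair_D(3)) (auto intro: W_D)

lemma W_cong:
  assumes "u \<in> W_space V" "v \<in> borel_measurable borel" "AE x in lborel. v x = u x"
  shows "v \<in> W_space V" "AE x in lborel. F v x = F u x" "W_norm V v = W_norm V u"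
proof -
  note u = W_D[OF assms(1)]
  have g: "is_weak_gradient v (weak_grad u)"
    by (rule weak_gradient_cong[OF u(4) assms(3) _ u(6) assms(2) u(7) u(7)]) simp
  have ae: "AE x in lborel. wpair V (weak_grad u) v x = F u x"
    using assms(3) by eventually_elim (simp add: wpair_def)
  have s: "square_integrable (wpair V (weak_grad u) v)" "L2n (wpair V (weak_grad u) v) = L2n (F u)"
    using sqi_cong_AE[OF u(5) wpair_measurable[OF u(7) assms(2)] ae] by auto
  note W = W_I[OF s(1) assms(2) u(7) g]
  show "v \<in> W_space V" by (rule W)
  show "AE x in lborel. F v x = F u x" using W(3) ae by eventually_elim simp
  show "W_norm V v = W_norm V u" using W(4) s(2) by (simp add: W_norm_eq)
qed

lemma W_scale:
  assumes "u \<in> W_space V"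
  shows "(\<lambda>x. c * u x) \<in> W_space V" "AE x in lborel. F (\<lambda>x. c * u x) x = c *\<^sub>R F u x"
    "AE x in lborel. weak_grad (\<lambda>x. c * u x) x = c *\<^sub>R weak_grad u x"
proof -
  note u = W_D[OF assms]
  have eq: "wpair V (\<lambda>x. c *\<^sub>R weak_grad u x) (\<lambda>x. c * u x) = (\<lambda>x. c *\<^sub>R F u x)"
    by (auto simp: wpair_def fun_eq_iff)
  have "square_integrable (wpair V (\<lambda>x. c *\<^sub>R weak_grad u x) (\<lambda>x. c * u x))"
    unfolding eq by (rule sqi_scaleR[OF u(5)])
  note W = W_I[OF this _ _ weak_gradient_scale[OF u(4)]]
  show "(\<lambda>x. c * u x) \<in> W_space V" "AE x in lborel. F (\<lambda>x. c * u x) x = c *\<^sub>R F u x"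
    "AE x in lborel. weak_grad (\<lambda>x. c * u x) x = c *\<^sub>R weak_grad u x"
    using W u(6,7) unfolding eq by auto
qed

lemma W_add:
  assumes "u \<in> W_space V" "v \<in> W_space V"
  shows "(\<lambda>x. u x + v x) \<in> W_space V" "AE x in lborel. F (\<lambda>x. u x + v x) x = F u x + F v x"
proof -
  note u = W_D[OF assms(1)] and v = W_D[OF assms(2)]
  have eq: "wpair V (\<lambda>x. weak_grad u x + weak_grad v x) (\<lambda>x. u x + v x) = (\<lambda>x. F u x + F v x)"
    by (auto simp: wpair_def fun_eq_iff distrib_left)
  have "square_integrable (wpair V (\<lambda>x. weak_grad u x + weak_grad v x) (\<lambda>x. u x + v x))"
    unfolding eq by (rule sqi_add[OF u(5) v(5)])
  note W = W_I[OF this _ _ weak_gradient_add[OF u(4) v(4) u(2) v(2) u(3) v(3)]]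
  show "(\<lambda>x. u x + v x) \<in> W_space V" "AE x in lborel. F (\<lambda>x. u x + v x) x = F u x + F v x"
    using W u(6,7) v(6,7) unfolding eq by auto
qed

lemma W_diff:
  assumes "u \<in> W_space V" "v \<in> W_space V"
  shows "(\<lambda>x. u x - v x) \<in> W_space V" "AE x in lborel. F (\<lambda>x. u x - v x) x = F u x - F v x"
    "W_norm V (\<lambda>x. u x - v x) = L2n (\<lambda>x. F u x - F v x)"
proof -
  note s = W_scale[OF assms(2), of "-1"]
  note a = W_add[OF assms(1) s(1)]
  show m: "(\<lambda>x. u x - v x) \<in> W_space V" using a(1) by simp
  have "AE x in lborel. F (\<lambda>x. u x + -1 * v x) x = F u x - F v x"
    using a(2) s(2) by eventually_elim simp
  then show e: "AE x in lborel. F (\<lambda>x. u x - v x) x = F u x - F v x" by simp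
  show "W_norm V (\<lambda>x. u x - v x) = L2n (\<lambda>x. F u x - F v x)"
    unfolding W_norm_eq
    by (rule sqi_cong_AE(2)[OF sqi_diff[OF W_D(5)[OF assms(1)] W_D(5)[OF assms(2)]] sqi_meas[OF W_D(5)[OF m]] e])
qed

lemma compact_V_bounded:
  obtains M where "M > 0" "\<And>x. norm x \<le> R \<Longrightarrow> V x \<le> M"
proof -
  have "compact (V ` cball 0 R)"
    by (intro compact_continuous_image continuous_on_subset[OF V_cont]) auto
  then obtain M where M: "M > 0" "\<And>y. y \<in> V ` cball 0 R \<Longrightarrow> norm y \<le> M"
    using compact_imp_bounded bounded_pos by metis
  have "V x \<le> M" if "norm x \<le> R" for x using M(2)[of "V x"] that by (simp add: abs_le_iff)
  then show ?thesis using that M(1) by blast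
qed

lemma compact_support_V_integrable:
  assumes u: "square_integrable u" "\<And>x. norm x > R \<Longrightarrow> u x = 0"
    and M: "\<And>x. norm x \<le> R \<Longrightarrow> V x \<le> M" "M > 0"
  shows "integrable lborel (\<lambda>x. V x * (u x)\<^sup>2)" "square_integrable (\<lambda>x. sqrt (V x) * u x)"
    "L2n (\<lambda>x. sqrt (V x) * u x) \<le> sqrt M * L2n u"
proof -
  have [measurable]: "u \<in> borel_measurable borel" using u sqi_meas by auto
  have "norm (sqrt (V x) * u x) \<le> norm (sqrt M * u x)" for x
    using u(2)[of x] M(1)[of x] V_pos[of x] M(2)
    by (cases "norm x \<le> R") (auto simp: abs_mult intro!: mult_right_mono)
  then have *: "square_integrable (\<lambda>x. sqrt (V x) * u x)" "L2n (\<lambda>x. sqrt (V x) * u x) \<le> L2n (\<lambda>x. sqrt M * u x)"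
    using sqi_bound[OF sqi_mult(1)[OF u(1), of "sqrt M"], of "\<lambda>x. sqrt (V x) * u x"] by auto
  then show "square_integrable (\<lambda>x. sqrt (V x) * u x)" by simp
  show "L2n (\<lambda>x. sqrt (V x) * u x) \<le> sqrt M * L2n u"
    using * sqi_mult(2)[OF u(1), of "sqrt M"] M(2) by simp
  show "integrable lborel (\<lambda>x. V x * (u x)\<^sup>2)"
    using *(1) less_imp_le[OF V_pos] by (simp add: sqi_real_iff power_mult_distrib)
qed

lemma test_W:
  assumes "test_function \<phi>"
  shows "\<phi> \<in> W_space V" "AE x in lborel. F \<phi> x = wpair V (grad \<phi>) \<phi> x"
    "square_integrable (wpair V (grad \<phi>) \<phi>)"
proof -
  obtain R where R: "\<And>x. norm x \<ge> R \<Longrightarrow> \<phi> x = 0" using test_supportE[OF assms] by metis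
  obtain M where M: "M > 0" "\<And>x. norm x \<le> R \<Longrightarrow> V x \<le> M" using compact_V_bounded[of R] by metis
  have i: "integrable lborel (\<lambda>x. V x * (\<phi> x)\<^sup>2)"
    by (rule compact_support_V_integrable(1)[OF test_sqi[OF assms] _ M(2,1)]) (use R in auto)
  note a = W_I'[OF test_sqi[OF assms] test_grad_sqi[OF assms] test_weak_gradient[OF assms] i]
  show "\<phi> \<in> W_space V" "square_integrable (wpair V (grad \<phi>) \<phi>)" by (rule a)+
  show "AE x in lborel. F \<phi> x = wpair V (grad \<phi>) \<phi> x"
    by (rule W_I(3)[OF a(1) test_measurable[OF assms] test_grad_measurable[OF assms] test_weak_gradient[OF assms]])
qed

lemma test_grad_le_W:
  assumes \<phi>: "test_function \<phi>"
  shows "L2n (grad \<phi>) \<le> W_norm V \<phi>"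
proof -
  have "L2n (grad \<phi>) = L2n (weak_grad \<phi>)"
    using test_W12(2)[OF \<phi>]
    by (intro sqi_cong_AE(2)[OF W_D(3)[OF test_W(1)[OF \<phi>]] test_grad_measurable[OF \<phi>]]) (auto elim: eventually_mono)
  then show ?thesis using grad_le_W[OF test_W(1)[OF \<phi>]] by simp
qed

lemma W_zero: "(\<lambda>x. 0) \<in> W_space V"
proof -
  have "test_function (\<lambda>x::'a. 0)"
    using test_cmult[OF bump_test, of 0] by simp
  then show ?thesis by (rule test_W)
qed

text \<open>The image of \<open>W\<close> under \<open>wpair\<close> is closed in L2: from a limit
  \<open>H\<close> the function is recovered by dividing the last component by
  \<open>sqrt (V x)\<close>, which is positive, and weak gradients pass to L2 limits.\<close>

lemma W_complete:
  assumes u: "\<And>n. u n \<in> W_space V"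
    and c: "\<And>e. e > 0 \<Longrightarrow> \<exists>M. \<forall>m\<ge>M. \<forall>n\<ge>M. W_norm V (\<lambda>x. u m x - u n x) < e"
  shows "\<exists>v\<in>W_space V. (\<lambda>n. W_norm V (\<lambda>x. u n x - v x)) \<longlonglongrightarrow> 0"
proof -
  have "\<exists>H. square_integrable H \<and> (\<lambda>n. L2n (\<lambda>x. F (u n) x - H x)) \<longlonglongrightarrow> 0"
  proof (rule L2_complete)
    show "square_integrable (F (u n))" for n by (rule W_D[OF u])
    show "\<exists>M. \<forall>m\<ge>M. \<forall>n\<ge>M. L2n (\<lambda>x. F (u m) x - F (u n) x) < e" if "e > 0" for e
      using c[OF that] unfolding W_diff(3)[OF u u] .
  qed
  then obtain H where H: "square_integrable H" "(\<lambda>n. L2n (\<lambda>x. F (u n) x - H x)) \<longlonglongrightarrow> 0" by blast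
  define G where "G x = fst (H x)" for x
  define v where "v x = snd (H x) / sqrt (V x)" for x
  have [measurable]: "H \<in> borel_measurable borel" using H sqi_meas by blast
  have [measurable]: "G \<in> borel_measurable borel" unfolding G_def[abs_def]
    by (rule borel_measurable_continuous_on[where f = fst, OF _ \<open>H \<in> borel_measurable borel\<close>]) (intro continuous_intros)
  have [measurable]: "(\<lambda>x. snd (H x)) \<in> borel_measurable borel"
    by (rule borel_measurable_continuous_on[where f = snd, OF _ \<open>H \<in> borel_measurable borel\<close>]) (intro continuous_intros)
  have [measurable]: "v \<in> borel_measurable borel" unfolding v_def[abs_def] by measurable
  have wH: "wpair V G v = H"
  proof
    fix x show "wpair V G v x = H x"
      using V_pos[of x] by (simp add: wpair_def G_def v_def)
  qed
  have s: "square_integrable (wpair V G v)" using H(1) wH by simp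
  note Gv = sqi_wpair_D[OF s \<open>v \<in> _\<close> \<open>G \<in> _\<close>]
  have "is_weak_gradient v G"
  proof (rule weak_gradient_limit[where U = u and H = "\<lambda>n. weak_grad (u n)"])
    have d: "square_integrable (wpair V (\<lambda>x. weak_grad (u n) x - G x) (\<lambda>x. u n x - v x))"
      "L2n (wpair V (\<lambda>x. weak_grad (u n) x - G x) (\<lambda>x. u n x - v x)) = L2n (\<lambda>x. F (u n) x - H x)" for n
      using sqi_diff[OF W_D(5)[OF u[of n]] H(1)] wH by (auto simp: wpair_diff[abs_def] fun_eq_iff)
    have m: "(\<lambda>x. u n x - v x) \<in> borel_measurable borel" "(\<lambda>x. weak_grad (u n) x - G x) \<in> borel_measurable borel" for n
      using W_D(6,7)[OF u[of n]] by measurable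
    note b = sqi_wpair_D(3,4)[OF d(1) m]
    show "(\<lambda>n. L2n (\<lambda>x. u n x - v x)) \<longlonglongrightarrow> 0"
    proof (rule Lim_null_comparison[OF always_eventually])
      show "(\<lambda>n. L2n (\<lambda>x. F (u n) x - H x) / sqrt aV) \<longlonglongrightarrow> 0"
        using tendsto_divide_zero[OF H(2)] .
      show "\<forall>n. norm (L2n (\<lambda>x. u n x - v x)) \<le> L2n (\<lambda>x. F (u n) x - H x) / sqrt aV"
        using b(2) d(2) by simp
    qed
    show "(\<lambda>n. L2n (\<lambda>x. weak_grad (u n) x - G x)) \<longlonglongrightarrow> 0"
    proof (rule Lim_null_comparison[OF always_eventually])
      show "\<forall>n. norm (L2n (\<lambda>x. weak_grad (u n) x - G x)) \<le> L2n (\<lambda>x. F (u n) x - H x)"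
        using b(1) d(2) by simp
    qed (rule H(2))
  qed (use W_D[OF u] Gv in auto)
  note v = W_I[OF s \<open>v \<in> _\<close> \<open>G \<in> _\<close> this]
  have WH: "W_norm V (\<lambda>x. u n x - v x) = L2n (\<lambda>x. F (u n) x - H x)" for n
    unfolding W_diff(3)[OF u v(1)]
  proof (rule sqi_cong_AE(2)[OF sqi_diff[OF W_D(5)[OF u] H(1)]])
    show "(\<lambda>x. F (u n) x - F v x) \<in> borel_measurable borel"
      by (rule sqi_meas[OF sqi_diff[OF W_D(5)[OF u] W_D(5)[OF v(1)]]])
    show "AE x in lborel. F (u n) x - F v x = F (u n) x - H x"
      using v(3) by eventually_elim (simp add: wH)
  qed
  show ?thesis by (rule bexI[OF _ v(1)]) (simp only: WH H(2))
qed

text \<open>The cutoffs are dilations of \<open>bump\<close>. They tend to 1 pointwise and their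
  gradients are of order \<open>1/n\<close>, so dominated convergence makes the error small in the
  norm of \<open>W\<close>.\<close>

lemma W_cutoff_approx:
  assumes u: "u \<in> W_space V" and e: "e > 0"
  obtains v G R where "R > 0" "square_integrable v" "square_integrable G" "is_weak_gradient v G"
    "\<And>x. norm x > R \<Longrightarrow> v x = 0"
    "square_integrable (wpair V G v)" "L2n (\<lambda>x. F u x - wpair V G v x) < e"
proof -
  note u' = W_D[OF u]
  note [measurable] = u'(6,7)
  define k where "k n x = bump (0 + (1 / real (Suc n)) *\<^sub>R x)" for n and x :: 'a
  have k: "test_function (k n)" for n unfolding k_def by (intro test_affine bump_test) auto
  note [measurable] = test_measurable[OF k] test_grad_measurable[OF k]
  have k01: "0 \<le> k n x" "k n x \<le> 1" for n x by (simp_all add: k_def bump_nonneg bump_le_1)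
  have kout: "k n x = 0" if "norm x > real (Suc n)" for n x
    using that by (auto simp: k_def field_simps intro!: bump_outside)
  have klim: "(\<lambda>n. k n x) \<longlonglongrightarrow> 1" for x
  proof -
    have "(\<lambda>n. 0 + (1 / real (Suc n)) *\<^sub>R x) \<longlonglongrightarrow> 0 + 0 *\<^sub>R x"
      using LIMSEQ_inverse_real_of_nat by (intro tendsto_intros) (simp add: inverse_eq_divide)
    then have "(\<lambda>n. bump (0 + (1 / real (Suc n)) *\<^sub>R x)) \<longlonglongrightarrow> bump (0::'a)"
      using continuous_on_tendsto_compose[OF test_continuous[OF bump_test], of _ 0 sequentially] by simp
    then show ?thesis by (simp add: k_def)
  qed
  obtain B where B: "B > 0" "\<And>x. norm (grad bump (x::'a)) \<le> B" using test_grad_bounded[OF bump_test] by metis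
  have gk: "grad (k n) x = (1 / real (Suc n)) *\<^sub>R grad bump (0 + (1 / real (Suc n)) *\<^sub>R x)" for n x
  proof -
    have "((\<lambda>x. 0 + (1 / real (Suc n)) *\<^sub>R x) has_derivative (\<lambda>v. (1 / real (Suc n)) *\<^sub>R v)) (at x)"
      by (auto intro!: derivative_eq_intros)
    from has_derivative_compose[OF this test_derivative[OF bump_test]]
    have "frechet_derivative (k n) (at x) =
      (\<lambda>v. frechet_derivative bump (at (0 + (1 / real (Suc n)) *\<^sub>R x)) ((1 / real (Suc n)) *\<^sub>R v))"
      unfolding k_def by (rule frechet_derivative_eq)
    then have "frechet_derivative (k n) (at x) v =
      (1 / real (Suc n)) * frechet_derivative bump (at (0 + (1 / real (Suc n)) *\<^sub>R x)) v" for v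
      by (simp only: linear_cmul[OF has_derivative_linear[OF test_derivative[OF bump_test]]] real_scaleR_def)
    then show ?thesis by (simp add: grad_def scaleR_sum_right)
  qed
  have gkB: "norm (grad (k n) x) \<le> B / real (Suc n)" for n x
  proof -
    have "norm (grad (k n) x) = norm (grad bump (0 + (1 / real (Suc n)) *\<^sub>R x)) / real (Suc n)"
      unfolding gk norm_scaleR by simp
    also have "\<dots> \<le> B / real (Suc n)" by (intro divide_right_mono B) simp
    finally show ?thesis .
  qed
  have gkB1: "norm (grad (k n) x) \<le> B" for n x
  proof -
    have "B / real (Suc n) \<le> B / 1" using B(1) by (intro divide_left_mono) auto
    then show ?thesis using gkB[of n x] by simp
  qed
  have gklim: "(\<lambda>n. grad (k n) x) \<longlonglongrightarrow> 0" for x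
  proof (rule Lim_null_comparison[OF always_eventually])
    show "\<forall>n. norm (grad (k n) x) \<le> B / real (Suc n)" using gkB by blast
    show "(\<lambda>n. B / real (Suc n)) \<longlonglongrightarrow> 0"
      using tendsto_mult_right_zero[OF LIMSEQ_inverse_real_of_nat, of B] by (simp add: field_simps)
  qed
  define G where "G n x = k n x *\<^sub>R weak_grad u x + u x *\<^sub>R grad (k n) x" for n x
  define v where "v n x = k n x * u x" for n x
  have [measurable]: "v n \<in> borel_measurable borel" "G n \<in> borel_measurable borel" for n
    unfolding v_def G_def by measurable
  have wv: "is_weak_gradient (v n) (G n)" for n
    unfolding v_def G_def by (rule weak_gradient_cutoff[OF u'(4,2,3) k])
  define b where "b x = 2 *\<^sub>R F u x" for x
  define c where "c x = (B * u x) *\<^sub>R (0::'a, 1::real)" for x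
  have sv: "square_integrable (v n)" for n
    by (rule sqi_bound(1)[OF u'(2)]) (auto simp: v_def abs_mult k01 mult_left_le_one_le)
  have sG: "square_integrable (G n)" for n
    unfolding G_def
  proof (rule sqi_add)
    show "square_integrable (\<lambda>x. k n x *\<^sub>R weak_grad u x)"
      by (rule sqi_bound(1)[OF u'(3)]) (auto simp: k01 mult_left_le_one_le)
    have "norm (u x *\<^sub>R grad (k n) x) \<le> norm (B * u x)" for x
      using mult_left_mono[OF gkB1[of n x], of "\<bar>u x\<bar>"] B(1) by (simp add: abs_mult mult.commute)
    then show "square_integrable (\<lambda>x. u x *\<^sub>R grad (k n) x)"
      by (intro sqi_bound(1)[OF sqi_mult(1)[OF u'(2), of B]] AE_I2) measurable
  qed
  have iV: "integrable lborel (\<lambda>x. V x * (v n x)\<^sup>2)" for n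
  proof (rule Bochner_Integration.integrable_bound[OF u'(8)])
    have "(v n x)\<^sup>2 \<le> (u x)\<^sup>2" for x
      unfolding v_def power_mult_distrib using k01[of n x] by (intro mult_left_le_one_le) (auto simp: power_le_one)
    then show "AE x in lborel. norm (V x * (v n x)\<^sup>2) \<le> norm (V x * (u x)\<^sup>2)"
      using less_imp_le[OF V_pos] by (auto intro!: AE_I2 simp: abs_mult mult_left_mono)
  qed measurable
  note ws = W_I'(1)[OF sv sG wv iV]
  have "(\<lambda>n. L2n (\<lambda>x. F u x - wpair V (G n) (v n) x)) \<longlonglongrightarrow> 0"
  proof (rule L2_dominated[where g = "\<lambda>x. (norm (F u x) + B * \<bar>u x\<bar>)"])
    show "(\<lambda>x. F u x - wpair V (G n) (v n) x) \<in> borel_measurable borel" for n by measurable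
    show "square_integrable (\<lambda>x. norm (F u x) + B * \<bar>u x\<bar>)"
    proof (intro sqi_add sqi_mult)
      show "square_integrable (\<lambda>x. norm (F u x))" "square_integrable (\<lambda>x. \<bar>u x\<bar>)"
        using u'(2,5) by (auto simp: square_integrable_def)
    qed
    have eq: "F u x - wpair V (G n) (v n) x = (1 - k n x) *\<^sub>R F u x - u x *\<^sub>R (grad (k n) x, 0)" for n x
      by (simp add: wpair_def G_def v_def algebra_simps)
    show "AE x in lborel. (\<lambda>n. F u x - wpair V (G n) (v n) x) \<longlonglongrightarrow> 0"
    proof (rule AE_I2)
      fix x
      have "(\<lambda>n. (1 - k n x) *\<^sub>R F u x - u x *\<^sub>R (grad (k n) x, 0::real)) \<longlonglongrightarrow> (1 - 1) *\<^sub>R F u x - u x *\<^sub>R (0, 0)"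
        by (intro tendsto_intros klim gklim)
      then show "(\<lambda>n. F u x - wpair V (G n) (v n) x) \<longlonglongrightarrow> 0"
        unfolding eq by (simp add: zero_prod_def[symmetric])
    qed
    show "AE x in lborel. norm (F u x - wpair V (G n) (v n) x) \<le> norm (norm (F u x) + B * \<bar>u x\<bar>)" for n
    proof (rule AE_I2)
      fix x
      have "norm (F u x - wpair V (G n) (v n) x) \<le> norm ((1 - k n x) *\<^sub>R F u x) + norm (u x *\<^sub>R (grad (k n) x, 0::real))"
        unfolding eq by (rule norm_triangle_ineq4)
      also have "\<dots> \<le> norm (F u x) + B * \<bar>u x\<bar>"
        using k01[of n x] gkB1[of n x]
        by (intro add_mono) (auto simp: mult_left_le_one_le norm_Pair mult.commute[of B] intro!: mult_left_mono)
      also have "\<dots> = norm (norm (F u x) + B * \<bar>u x\<bar>)" using B by simp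
      finally show "norm (F u x - wpair V (G n) (v n) x) \<le> norm (norm (F u x) + B * \<bar>u x\<bar>)" .
    qed
  qed
  then obtain n where n: "L2n (\<lambda>x. F u x - wpair V (G n) (v n) x) < e"
    using e LIMSEQ_D[of _ 0 e] by force
  show ?thesis
  proof (rule that[of "real (Suc n)" "v n" "G n"])
    show "v n x = 0" if "norm x > real (Suc n)" for x using kout[OF that] by (simp add: v_def)
  qed (use sv sG wv ws n in auto)
qed

text \<open>Mollifying directly would clash with the unbounded \<open>V\<close>. After the cutoff
  everything lives in the ball of radius \<open>R + 1\<close>, where \<open>V \<le> M\<close>, and
  each ingredient of the norm is controlled by L2 translation errors.\<close>

theorem W_density:
  assumes u: "u \<in> W_space V" and e: "e > 0"
  obtains \<phi> where "test_function \<phi>" "W_norm V (\<lambda>x. u x - \<phi> x) < e"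
proof -
  obtain v G R where v: "R > 0" "square_integrable v" "square_integrable G" "is_weak_gradient v G"
    "\<And>x. norm x > R \<Longrightarrow> v x = 0" "square_integrable (wpair V G v)" "L2n (\<lambda>x. F u x - wpair V G v x) < e / 2"
    by (rule W_cutoff_approx[OF u half_gt_zero[OF e]]) blast
  obtain M where M: "M > 0" "\<And>x. norm x \<le> R + 1 \<Longrightarrow> V x \<le> M" using compact_V_bounded[of "R + 1"] by metis
  \<comment> \<open>The mollification error is at most \<open>sqrt M * s\<close> from the potential
    and \<open>DIM('a) * s\<close> from the gradient components, so this choice keeps it below
    \<open>e / 2\<close>.\<close>
  define s where "s = e / 4 / (sqrt M + DIM('a))"
  have sM: "sqrt M + DIM('a) > 0" using M(1) by (intro add_pos_pos) auto
  have "(sqrt M + DIM('a)) * s = e / 4" unfolding s_def using sM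
    by (metis less_irrefl nonzero_mult_div_cancel_left times_divide_eq_right)
  then have s: "s > 0" "(sqrt M + DIM('a)) * s < e / 2"
    using e sM by (simp add: s_def, linarith)
  obtain d0 where d0: "d0 > 0" "\<And>z. norm z < d0 \<Longrightarrow> L2n (\<lambda>x. v (x + z) - v x) < s"
    by (rule L2_trans_cont[OF v(2) s(1)]) blast
  have "\<exists>d>0. \<forall>z. norm z < d \<longrightarrow> L2n (\<lambda>x. G (x + z) \<bullet> b - G x \<bullet> b) < s" for b
    by (rule L2_trans_cont[OF sqi_component(1)[OF v(3)] s(1), of b]) blast
  then obtain D where D: "\<And>b. D b > 0" "\<And>b z. norm z < D b \<Longrightarrow> L2n (\<lambda>x. G (x + z) \<bullet> b - G x \<bullet> b) < s"
    by metis
  \<comment> \<open>\<open>r \<le> 1\<close> confines the support of the mollification to radius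
    \<open>R + 1\<close>; the other entries make the translation errors of \<open>v\<close> and of
    all components of \<open>G\<close> at most \<open>s\<close>.\<close>
  define r where "r = Min (insert 1 (insert d0 (D ` Basis)))"
  have r: "r > 0" "r \<le> 1" "r \<le> d0"
    using D d0 by (auto simp: r_def)
  have r4: "r \<le> D b" if "b \<in> Basis" for b
    unfolding r_def by (rule Min_le) (use that in auto)
  obtain \<eta> :: "'a \<Rightarrow> real" where \<eta>: "mollifier r \<eta>" using mollifier_exists[OF r(1)] by metis
  then have t: "test_function \<eta>" and \<eta>0: "\<And>x. norm x \<ge> r \<Longrightarrow> \<eta> x = 0" by (auto simp: mollifier_def)
  define \<phi> where "\<phi> = moll \<eta> v"
  note mt = moll_test[OF t v(2) \<eta>0[OF less_imp_le] v(5)]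
  have \<phi>: "test_function \<phi>" "\<And>x. norm x > r + R \<Longrightarrow> \<phi> x = 0"
    unfolding \<phi>_def using mt by simp_all
  have gr: "grad \<phi> x \<bullet> b = moll \<eta> (\<lambda>x. G x \<bullet> b) x" if "b \<in> Basis" for b x
    unfolding grad_inner[OF \<phi>(1)] unfolding \<phi>_def by (rule moll_weak_gradient[OF t v(2,4) that])
  have a1: "square_integrable (\<lambda>x. \<phi> x - v x)" "L2n (\<lambda>x. \<phi> x - v x) \<le> s"
  proof -
    have "L2n (\<lambda>x. v (x + z) - v x) \<le> s" if "norm z < r" for z
      using d0(2)[of z] that r(3) by simp
    then show "square_integrable (\<lambda>x. \<phi> x - v x)" "L2n (\<lambda>x. \<phi> x - v x) \<le> s"
      using moll_approx[OF \<eta> v(2), of s] s unfolding \<phi>_def by auto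
  qed
  have a2: "L2n (\<lambda>x. (grad \<phi> x - G x) \<bullet> b) \<le> s" if b: "b \<in> Basis" for b
  proof -
    have "L2n (\<lambda>x. G (x + z) \<bullet> b - G x \<bullet> b) \<le> s" if "norm z < r" for z
      using D(2)[of z b] that r4[OF b] by simp
    then have "L2n (\<lambda>x. moll \<eta> (\<lambda>x. G x \<bullet> b) x - G x \<bullet> b) \<le> s"
      using s by (intro moll_approx(3)[OF \<eta> sqi_component(1)[OF v(3)]]) auto
    then show ?thesis by (simp add: inner_diff_left gr[OF b])
  qed
  have a3: "square_integrable (\<lambda>x. grad \<phi> x - G x)" by (intro sqi_diff test_grad_sqi \<phi> v)
  have "L2n (\<lambda>x. grad \<phi> x - G x) \<le> (\<Sum>b\<in>(Basis::'a set). s)"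
    using L2n_vector_le[OF a3] by (rule order_trans) (intro sum_mono a2)
  then have a4: "L2n (\<lambda>x. grad \<phi> x - G x) \<le> DIM('a) * s" by simp
  have a5: "square_integrable (\<lambda>x. sqrt (V x) * (\<phi> x - v x))" "L2n (\<lambda>x. sqrt (V x) * (\<phi> x - v x)) \<le> sqrt M * L2n (\<lambda>x. \<phi> x - v x)"
  proof -
    have "\<phi> x - v x = 0" if "norm x > R + 1" for x using \<phi>(2)[of x] v(5)[of x] r(2) that by simp
    note cs = compact_support_V_integrable[where R = "R + 1", OF a1(1) this M(2,1)]
    show "square_integrable (\<lambda>x. sqrt (V x) * (\<phi> x - v x))"
      "L2n (\<lambda>x. sqrt (V x) * (\<phi> x - v x)) \<le> sqrt M * L2n (\<lambda>x. \<phi> x - v x)"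
      using cs(2,3) by simp_all
  qed
  let ?W = "\<lambda>x. wpair V G v x - wpair V (grad \<phi>) \<phi> x"
  have "L2n ?W \<le> (sqrt M + DIM('a)) * s"
  proof (rule power2_le_imp_le)
    have "(norm (?W x))\<^sup>2 = (norm (grad \<phi> x - G x))\<^sup>2 + (norm (sqrt (V x) * (\<phi> x - v x)))\<^sup>2" for x
    proof -
      have "norm (?W x) = norm (wpair V (\<lambda>x. grad \<phi> x - G x) (\<lambda>x. \<phi> x - v x) x)"
        unfolding wpair_diff by (rule norm_minus_commute)
      then show ?thesis using less_imp_le[OF V_pos[of x]]
        by (simp only: norm_wpair) (simp add: power_mult_distrib)
    qed
    then have "(L2n ?W)\<^sup>2 = (L2n (\<lambda>x. grad \<phi> x - G x))\<^sup>2 + (L2n (\<lambda>x. sqrt (V x) * (\<phi> x - v x)))\<^sup>2"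
      unfolding L2n_sq using sqi_integrable[OF a3] sqi_integrable[OF a5(1)] by (simp only: Bochner_Integration.integral_add)
    also have "\<dots> \<le> (DIM('a) * s)\<^sup>2 + (sqrt M * s)\<^sup>2"
    proof (intro add_mono power_mono a4 L2n_nonneg)
      have "sqrt M * L2n (\<lambda>x. \<phi> x - v x) \<le> sqrt M * s" using a1(2) M(1) by (intro mult_left_mono) auto
      then show "L2n (\<lambda>x. sqrt (V x) * (\<phi> x - v x)) \<le> sqrt M * s" using a5(2) by linarith
    qed
    also have "\<dots> \<le> ((sqrt M + DIM('a)) * s)\<^sup>2"
    proof -
      have "0 \<le> 2 * (DIM('a) * s) * (sqrt M * s)" using s(1) M(1) by (intro mult_nonneg_nonneg) auto
      then show ?thesis by (simp add: power2_eq_square algebra_simps)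
    qed
    finally show "(L2n ?W)\<^sup>2 \<le> ((sqrt M + DIM('a)) * s)\<^sup>2" .
    show "0 \<le> (sqrt M + DIM('a)) * s" using sM s(1) by (intro mult_nonneg_nonneg) auto
  qed
  then have W2: "L2n ?W < e / 2" using s(2) by linarith
  note tw = test_W[OF \<phi>(1)]
  have "W_norm V (\<lambda>x. u x - \<phi> x) = L2n (\<lambda>x. F u x - wpair V (grad \<phi>) \<phi> x)"
    unfolding W_diff(3)[OF u tw(1)]
  proof (rule sqi_cong_AE(2)[OF sqi_diff[OF W_D(5)[OF u] tw(3)]])
    show "(\<lambda>x. F u x - F \<phi> x) \<in> borel_measurable borel"
      by (rule sqi_meas[OF sqi_diff[OF W_D(5)[OF u] W_D(5)[OF tw(1)]]])
    show "AE x in lborel. F u x - F \<phi> x = F u x - wpair V (grad \<phi>) \<phi> x"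
      using tw(2) by eventually_elim simp
  qed
  also have "\<dots> \<le> L2n (\<lambda>x. F u x - wpair V G v x) + L2n ?W"
    by (rule L2n_triangle_diff[OF W_D(5)[OF u] v(6) tw(3)])
  also have "\<dots> < e" using v(7) W2 by linarith
  finally show ?thesis using that \<phi>(1) by blast
qed

end

section \<open>Compactness\<close>

text \<open>The weight is split as \<open>sqrt (1 / w) * sqrt w\<close>. Weight 1 yields the
  translation estimate, a power of \<open>t\<close> yields Hardy's inequality; values in
  \<open>ennreal\<close> are ready for Tonelli.\<close>

lemma ftc_Cauchy_Schwarz:
  fixes f g w :: "real \<Rightarrow> real"
  assumes ab: "a \<le> b" and d: "\<And>t. (f has_real_derivative g t) (at t)" and c: "\<And>t. isCont g t"
    and w[measurable]: "w \<in> borel_measurable borel" and wpos: "\<And>t. a \<le> t \<Longrightarrow> t \<le> b \<Longrightarrow> 0 < w t"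
  shows "ennreal ((f b - f a)\<^sup>2) \<le> (\<integral>\<^sup>+t. ennreal (1 / w t) * indicator {a..b} t \<partial>lborel) *
    (\<integral>\<^sup>+t. ennreal (w t * (g t)\<^sup>2) * indicator {a..b} t \<partial>lborel)"
proof -
  have [measurable]: "g \<in> borel_measurable borel"
    by (rule borel_measurable_continuous_onI) (simp add: c continuous_at_imp_continuous_on)
  define p where "p t = ennreal (sqrt (1 / w t)) * indicator {a..b} t" for t
  define q where "q t = ennreal (sqrt (w t) * \<bar>g t\<bar>) * indicator {a..b} t" for t
  have [measurable]: "p \<in> borel_measurable lborel" "q \<in> borel_measurable lborel"
    unfolding p_def q_def by measurable
  have h: "has_bochner_integral lborel (\<lambda>x. g x * indicator {a..b} x) (f b - f a)"
    by (rule has_bochner_integral_FTC_Icc_real[OF ab d c])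
  then have i: "integrable lborel (\<lambda>x. g x * indicator {a..b} x)" by (rule integrable.intros)
  have "ennreal \<bar>f b - f a\<bar> = ennreal \<bar>LINT x|lborel. g x * indicator {a..b} x\<bar>"
    using has_bochner_integral_integral_eq[OF h] by simp
  also have "\<dots> \<le> ennreal (LINT x|lborel. \<bar>g x * indicator {a..b} x\<bar>)"
    by (intro ennreal_leI integral_abs_bound)
  also have "\<dots> = (\<integral>\<^sup>+x. ennreal \<bar>g x * indicator {a..b} x\<bar> \<partial>lborel)"
    by (rule nn_integral_eq_integral[symmetric]) (use i in \<open>auto intro: integrable_abs\<close>)
  also have "\<dots> = (\<integral>\<^sup>+x. p x * q x \<partial>lborel)"
  proof (rule nn_integral_cong)
    fix x
    show "ennreal \<bar>g x * indicator {a..b} x\<bar> = p x * q x"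
    proof (cases "x \<in> {a..b}")
      case True
      then have "sqrt (1 / w x) * (sqrt (w x) * \<bar>g x\<bar>) = \<bar>g x\<bar>"
        using wpos[of x] by (simp add: real_sqrt_divide)
      then show ?thesis using True wpos[of x] by (simp add: p_def q_def flip: ennreal_mult)
    qed (simp add: p_def q_def)
  qed
  finally have "(ennreal \<bar>f b - f a\<bar>)\<^sup>2 \<le> (\<integral>\<^sup>+x. p x * q x \<partial>lborel)\<^sup>2" by (rule power_mono) simp
  also have "\<dots> \<le> (\<integral>\<^sup>+x. (p x)\<^sup>2 \<partial>lborel) * (\<integral>\<^sup>+x. (q x)\<^sup>2 \<partial>lborel)"
    by (rule Cauchy_Schwarz_nn_integral) auto
  also have "(\<integral>\<^sup>+x. (p x)\<^sup>2 \<partial>lborel) = (\<integral>\<^sup>+t. ennreal (1 / w t) * indicator {a..b} t \<partial>lborel)"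
  proof (rule nn_integral_cong)
    fix x show "(p x)\<^sup>2 = ennreal (1 / w x) * indicator {a..b} x"
      using wpos[of x] by (cases "x \<in> {a..b}") (simp_all add: p_def ennreal_power)
  qed
  also have "(\<integral>\<^sup>+x. (q x)\<^sup>2 \<partial>lborel) = (\<integral>\<^sup>+t. ennreal (w t * (g t)\<^sup>2) * indicator {a..b} t \<partial>lborel)"
  proof (rule nn_integral_cong)
    fix x show "(q x)\<^sup>2 = ennreal (w x * (g x)\<^sup>2) * indicator {a..b} x"
      using wpos[of x] by (cases "x \<in> {a..b}") (simp_all add: q_def ennreal_power power_mult_distrib)
  qed
  finally show ?thesis by (simp add: ennreal_power)
qed

text \<open>Cauchy-Schwarz along the segment from \<open>x\<close> to \<open>x + z\<close>, then
  Tonelli: every translate of the gradient has the same L2 norm.\<close>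

lemma test_translation:
  assumes \<phi>: "test_function (\<phi> :: 'a::euclidean_space \<Rightarrow> real)"
  shows "L2n (\<lambda>x. \<phi> (x + z) - \<phi> x) \<le> norm z * L2n (grad \<phi>)"
proof -
  have [measurable]: "\<phi> \<in> borel_measurable borel" "grad \<phi> \<in> borel_measurable borel"
    using \<phi> test_measurable test_grad_measurable by auto
  have pw: "ennreal ((\<phi> (x + z) - \<phi> x)\<^sup>2) \<le> (\<integral>\<^sup>+t. ennreal ((grad \<phi> (x + t *\<^sub>R z) \<bullet> z)\<^sup>2) * indicator {0..1} t \<partial>lborel)" for x
  proof -
    have "ennreal ((\<phi> (x + 1 *\<^sub>R z) - \<phi> (x + 0 *\<^sub>R z))\<^sup>2)
      \<le> (\<integral>\<^sup>+t. ennreal (1 / 1) * indicator {0..1::real} t \<partial>lborel) *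
        (\<integral>\<^sup>+t. ennreal (1 * (grad \<phi> (x + t *\<^sub>R z) \<bullet> z)\<^sup>2) * indicator {0..1} t \<partial>lborel)"
    proof (rule ftc_Cauchy_Schwarz)
      show "((\<lambda>t. \<phi> (x + t *\<^sub>R z)) has_real_derivative grad \<phi> (x + t *\<^sub>R z) \<bullet> z) (at t)" for t
        by (rule test_line_deriv[OF \<phi>])
      show "isCont (\<lambda>t. grad \<phi> (x + t *\<^sub>R z) \<bullet> z) t" for t
        by (intro continuous_intros continuous_on_interior[OF test_grad_continuous[OF \<phi>]]
            isCont_o2[of _ _ "grad \<phi>"]) auto
    qed auto
    then show ?thesis by simp
  qed
  have "(\<integral>\<^sup>+x. ennreal ((norm (\<phi> (x + z) - \<phi> x))\<^sup>2) \<partial>lborel) \<le>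
    (\<integral>\<^sup>+x. (\<integral>\<^sup>+t. ennreal ((grad \<phi> (x + t *\<^sub>R z) \<bullet> z)\<^sup>2) * indicator {0..1} t \<partial>lborel) \<partial>lborel)"
    by (rule nn_integral_mono) (use pw in simp)
  also have "\<dots> = (\<integral>\<^sup>+t. (\<integral>\<^sup>+x. ennreal ((grad \<phi> (x + t *\<^sub>R z) \<bullet> z)\<^sup>2) * indicator {0..1} t \<partial>lborel) \<partial>(lborel::real measure))"
    by (rule lborel_pair.Fubini') measurable
  also have "\<dots> \<le> (\<integral>\<^sup>+t. ennreal ((norm z * L2n (grad \<phi>))\<^sup>2) * indicator {0..1} t \<partial>(lborel::real measure))"
  proof (rule nn_integral_mono)
    fix t :: real
    have "(\<integral>\<^sup>+x. ennreal ((grad \<phi> (x + t *\<^sub>R z) \<bullet> z)\<^sup>2) * indicator {0..1} t \<partial>lborel)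
      = (\<integral>\<^sup>+x. ennreal ((grad \<phi> (x + t *\<^sub>R z) \<bullet> z)\<^sup>2) \<partial>lborel) * indicator {0..1} t"
      by (rule nn_integral_multc) measurable
    also have "(\<integral>\<^sup>+x. ennreal ((grad \<phi> (x + t *\<^sub>R z) \<bullet> z)\<^sup>2) \<partial>lborel) = (\<integral>\<^sup>+x. ennreal ((norm (grad \<phi> x \<bullet> z))\<^sup>2) \<partial>lborel)"
      by (subst nn_integral_translate[of "\<lambda>x. ennreal ((grad \<phi> x \<bullet> z)\<^sup>2)" "t *\<^sub>R z"]) auto
    also have "\<dots> = ennreal ((L2n (\<lambda>x. grad \<phi> x \<bullet> z))\<^sup>2)"
      by (rule nn_L2n[OF sqi_component(1)[OF test_grad_sqi[OF \<phi>]]])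
    also have "\<dots> \<le> ennreal ((norm z * L2n (grad \<phi>))\<^sup>2)"
      by (intro ennreal_leI power_mono sqi_component test_grad_sqi \<phi>) simp
    finally show "(\<integral>\<^sup>+x. ennreal ((grad \<phi> (x + t *\<^sub>R z) \<bullet> z)\<^sup>2) * indicator {0..1} t \<partial>lborel)
      \<le> ennreal ((norm z * L2n (grad \<phi>))\<^sup>2) * indicator {0..1} t"
      by (simp add: mult_right_mono)
  qed
  also have "\<dots> = ennreal ((norm z * L2n (grad \<phi>))\<^sup>2)"
    by (simp add: nn_integral_cmult_indicator)
  finally have "(L2n (\<lambda>x. \<phi> (x + z) - \<phi> x))\<^sup>2 \<le> (norm z * L2n (grad \<phi>))\<^sup>2"
    by (intro sqi_nn(2)) auto
  then show ?thesis by (rule power2_le_imp_le) simp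
qed

text \<open>Bolzano-Weierstrass for each row and Cantor's diagonal; only a tail of the diagonal is a
  subsequence of the choice made for row \<open>i\<close>, hence the offset
  \<open>Suc i\<close>.\<close>

lemma diagonal_bounded:
  fixes c :: "nat \<Rightarrow> nat \<Rightarrow> real"
  assumes "\<And>i. \<exists>B. \<forall>n. \<bar>c i n\<bar> \<le> B"
  obtains r :: "nat \<Rightarrow> nat" where "strict_mono r" "\<And>i. convergent (\<lambda>n. c i (r n))"
proof -
  interpret subseqs "\<lambda>i s. convergent (\<lambda>n. c i (s n))"
  proof
    fix i and s :: "nat \<Rightarrow> nat"
    obtain B where B: "\<And>n. \<bar>c i n\<bar> \<le> B" using assms by blast
    have "bounded (range (\<lambda>n. c i (s n)))" unfolding bounded_iff using B by (intro exI[of _ B]) auto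
    then obtain l r where "strict_mono r" "((\<lambda>n. c i (s n)) \<circ> r) \<longlonglongrightarrow> l"
      using bounded_imp_convergent_subsequence by blast
    then show "\<exists>r'. strict_mono r' \<and> convergent (\<lambda>n. c i ((s \<circ> r') n))"
      by (intro exI[of _ r]) (auto simp: convergent_def o_def)
  qed
  have "convergent (\<lambda>n. c i (diagseq n))" for i
  proof -
    have "convergent (\<lambda>n. c i ((diagseq \<circ> (+) (Suc i)) n))"
    proof (rule diagseq_holds)
      fix r s :: "nat \<Rightarrow> nat" and n
      assume "strict_mono r" "convergent (\<lambda>k. c n (s k))"
      then show "convergent (\<lambda>k. c n ((s \<circ> r) k))"
        using LIMSEQ_subseq_LIMSEQ[of "\<lambda>k. c n (s k)" _ r] by (auto simp: convergent_def o_def)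
    qed
    then obtain l where "(\<lambda>n. c i (diagseq (n + Suc i))) \<longlonglongrightarrow> l"
      by (auto simp: convergent_def add.commute)
    then have "(\<lambda>n. c i (diagseq n)) \<longlonglongrightarrow> l" by (rule LIMSEQ_offset)
    then show ?thesis by (auto simp: convergent_def)
  qed
  with subseq_diagseq that show ?thesis by blast
qed

lemma moll_abs_le:
  assumes "test_function \<eta>" "square_integrable f"
  shows "\<bar>moll \<eta> f x\<bar> \<le> L2n \<eta> * L2n f"
proof -
  have "moll \<eta> f x = L2ip (\<lambda>y. \<eta> (x - y)) f" by (simp add: moll_def L2ip_def)
  then show ?thesis
    using L2_Cauchy_Schwarz[OF sqi_reflect(1)[OF test_sqi[OF assms(1)], of x] assms(2)]
      sqi_reflect(2)[OF test_sqi[OF assms(1)], of x] by simp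
qed

text \<open>The shift is moved from \<eta> onto \<open>f\<close>, so that the modulus of continuity
  is the translation modulus of \<open>f\<close>, which is uniform on bounded subsets of
  \<open>W\<close>.\<close>

lemma moll_equicontinuous:
  assumes \<eta>: "test_function \<eta>" and f: "square_integrable f"
  shows "\<bar>moll \<eta> f x - moll \<eta> f y\<bar> \<le> L2n \<eta> * L2n (\<lambda>w. f (w + (x - y)) - f w)"
proof -
  let ?g = "\<lambda>w. f (w + (x - y)) - f w"
  have g: "square_integrable ?g" by (rule sqi_diff[OF sqi_translate(1)[OF f] f])
  have i: "integrable lborel (\<lambda>z. \<eta> z * f (a - z))" for a
    by (intro sqi_mult_integrable test_sqi \<eta> sqi_reflect f)
  have "moll \<eta> f x - moll \<eta> f y = L2ip \<eta> (\<lambda>z. ?g (y - z))"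
    unfolding moll_shift[OF \<eta> f] L2ip_def using i[of x] i[of y]
    by (simp add: right_diff_distrib algebra_simps)
  then show ?thesis
    using L2_Cauchy_Schwarz[OF test_sqi[OF \<eta>] sqi_reflect(1)[OF g, of y]] sqi_reflect(2)[OF g, of y]
    by simp
qed

lemma moll_diff:
  assumes "test_function \<eta>" "square_integrable f" "square_integrable g"
  shows "moll \<eta> (\<lambda>x. f x - g x) x = moll \<eta> f x - moll \<eta> g x"
  using moll_integrable[OF assms(1,2), of x] moll_integrable[OF assms(1,3), of x]
  by (simp add: moll_def right_diff_distrib)

lemma sqi_indicator:
  fixes f :: "'a::euclidean_space \<Rightarrow> real"
  assumes f: "square_integrable f" and B[measurable]: "B \<in> sets borel"
  shows "square_integrable (\<lambda>x. indicator B x * f x)" "L2n (\<lambda>x. indicator B x * f x) \<le> L2n f"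
proof -
  have [measurable]: "f \<in> borel_measurable borel" using f by (rule sqi_meas)
  have "(\<lambda>x. indicator B x * f x) \<in> borel_measurable borel" by measurable
  from sqi_bound[OF f this]
  show "square_integrable (\<lambda>x. indicator B x * f x)" "L2n (\<lambda>x. indicator B x * f x) \<le> L2n f"
    by (auto simp: indicator_def)
qed

section \<open>Translation estimate and compact embedding of W into L2\<close>

context potential
begin

lemma W_translation:
  assumes u: "u \<in> W_space V"
  shows "L2n (\<lambda>x. u (x + z) - u x) \<le> norm z * W_norm V u"
proof (rule field_le_epsilon)
  fix e :: real assume e: "e > 0"
  \<comment> \<open>The cost of replacing \<open>u\<close> by \<phi>: two L2 distances, each at most
    the \<open>W\<close> distance divided by \<open>sqrt aV\<close>, and \<open>norm z\<close> times
    the change of the gradient norm.\<close>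
  define C where "C = 2 / sqrt aV + norm z"
  have C: "C > 0" using aV_pos by (auto simp: C_def intro!: add_pos_nonneg)
  then have "e / C > 0" using e by simp
  from W_density[OF u this] obtain \<phi> where \<phi>: "test_function \<phi>" "W_norm V (\<lambda>x. u x - \<phi> x) < e / C" by blast
  note tw = test_W[OF \<phi>(1)] and su = W_D(2)[OF u] and s\<phi> = test_sqi[OF \<phi>(1)]
  note ut = sqi_translate[OF su, of z] and \<phi>t = sqi_translate[OF s\<phi>, of z]
  define d where "d = W_norm V (\<lambda>x. u x - \<phi> x)"
  have l2: "L2n (\<lambda>x. u x - \<phi> x) \<le> d / sqrt aV" unfolding d_def by (rule L2_le_W[OF W_diff(1)[OF u tw(1)]])
  have "L2n (\<lambda>x. u (x + z) - u x) \<le> L2n (\<lambda>x. u (x + z) - \<phi> (x + z)) + L2n (\<lambda>x. \<phi> (x + z) - u x)"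
    by (rule L2n_triangle_diff[OF ut(1) \<phi>t(1) su])
  also have "L2n (\<lambda>x. \<phi> (x + z) - u x) \<le> L2n (\<lambda>x. \<phi> (x + z) - \<phi> x) + L2n (\<lambda>x. \<phi> x - u x)"
    by (rule L2n_triangle_diff[OF \<phi>t(1) s\<phi> su])
  also have "L2n (\<lambda>x. u (x + z) - \<phi> (x + z)) = L2n (\<lambda>x. u x - \<phi> x)"
    by (rule sqi_translate(2)[OF sqi_diff[OF su s\<phi>]])
  also have "L2n (\<lambda>x. \<phi> x - u x) = L2n (\<lambda>x. u x - \<phi> x)" by (rule L2n_minus_commute)
  finally have 1: "L2n (\<lambda>x. u (x + z) - u x) \<le> 2 * (d / sqrt aV) + L2n (\<lambda>x. \<phi> (x + z) - \<phi> x)"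
    using l2 by linarith
  have "L2n (grad \<phi>) \<le> W_norm V \<phi>" by (rule test_grad_le_W[OF \<phi>(1)])
  also have "\<dots> \<le> L2n (\<lambda>x. F \<phi> x - F u x) + L2n (F u)"
    unfolding W_norm_eq by (rule L2n_triangle_sub[OF W_D(5)[OF tw(1)] W_D(5)[OF u]])
  also have "L2n (\<lambda>x. F \<phi> x - F u x) = d"
    unfolding d_def W_diff(3)[OF u tw(1)] by (rule L2n_minus_commute)
  finally have "L2n (grad \<phi>) \<le> d + W_norm V u" by (simp add: W_norm_eq)
  then have "norm z * L2n (grad \<phi>) \<le> norm z * (d + W_norm V u)" by (intro mult_left_mono) auto
  then have "L2n (\<lambda>x. u (x + z) - u x) \<le> 2 * (d / sqrt aV) + norm z * (d + W_norm V u)"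
    using 1 test_translation[OF \<phi>(1), of z] by linarith
  also have "\<dots> = norm z * W_norm V u + C * d" by (simp add: C_def algebra_simps)
  also have "\<dots> \<le> norm z * W_norm V u + e"
    using \<phi>(2) C unfolding d_def by (simp add: pos_less_divide_eq mult.commute)
  finally show "L2n (\<lambda>x. u (x + z) - u x) \<le> norm z * W_norm V u + e" .
qed

lemma W_norm_nonneg: "0 \<le> W_norm V u"
  by (simp add: W_norm_eq)

lemma W_norm_diff_le:
  assumes "u \<in> W_space V" "v \<in> W_space V"
  shows "W_norm V (\<lambda>x. u x - v x) \<le> W_norm V u + W_norm V v"
  unfolding W_diff(3)[OF assms] W_norm_eq
  using L2n_triangle[OF W_D(5)[OF assms(1)] sqi_minus(1)[OF W_D(5)[OF assms(2)]]]
    sqi_minus(2)[OF W_D(5)[OF assms(2)]] by simp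

text \<open>Arzela-Ascoli by hand: values at a countable dense set converge along a diagonal
  subsequence, chosen for all mollifiers at once by coding pairs as one index, and equicontinuity
  spreads the convergence to every point.\<close>

lemma moll_convergent_subseq:
  assumes u: "\<And>n. u n \<in> W_space V" and K: "\<And>n. W_norm V (u n) \<le> K"
    and \<eta>: "\<And>k. test_function (\<eta> k)"
  obtains r :: "nat \<Rightarrow> nat" where "strict_mono r" "\<And>(k::nat) x. convergent (\<lambda>n. moll (\<eta> k) (u (r n)) x)"
proof -
  have K0: "K \<ge> 0" using K[of 0] W_norm_nonneg[of "u 0"] by linarith
  obtain D :: "'a set" where D: "countable D" "\<And>X. open X \<Longrightarrow> X \<noteq> {} \<Longrightarrow> \<exists>d\<in>D. d \<in> X"
    by (rule countable_dense_setE) blast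
  have "D \<noteq> {}" using D(2)[of UNIV] by auto
  then have range: "range (from_nat_into D) = D" using D(1) by (rule range_from_nat_into)
  define c where "c i n = (case prod_decode i of (k, j) \<Rightarrow> moll (\<eta> k) (u n) (from_nat_into D j))" for i n
  have su: "square_integrable (u n)" for n by (rule W_D(2)[OF u])
  have l2: "L2n (u n) \<le> K / sqrt aV" for n
    using L2_le_W[OF u, of n] divide_right_mono[OF K[of n], of "sqrt aV"] aV_pos by simp
  have "\<exists>B. \<forall>n. \<bar>c i n\<bar> \<le> B" for i
  proof (cases "prod_decode i")
    case (Pair k j)
    have "\<bar>c i n\<bar> \<le> L2n (\<eta> k) * (K / sqrt aV)" for n
      using order_trans[OF moll_abs_le[OF \<eta> su] mult_left_mono[OF l2 L2n_nonneg]]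
      by (simp add: c_def Pair)
    then show ?thesis by blast
  qed
  then obtain r :: "nat \<Rightarrow> nat" where r: "strict_mono r" "\<And>i. convergent (\<lambda>n. c i (r n))"
    by (rule diagonal_bounded[of c]) blast
  have cD: "convergent (\<lambda>n. moll (\<eta> k) (u (r n)) q)" if q: "q \<in> D" for k q
  proof -
    obtain j where "q = from_nat_into D j" using q range by blast
    then show ?thesis using r(2)[of "prod_encode (k, j)"] by (simp add: c_def)
  qed
  have "convergent (\<lambda>n. moll (\<eta> k) (u (r n)) x)" for k x
  proof (rule Cauchy_convergent, rule metric_CauchyI)
    fix e :: real assume e: "e > 0"
    define L where "L = L2n (\<eta> k) * K + 1"
    have L: "L > 0" using K0 by (auto simp: L_def intro!: add_nonneg_pos mult_nonneg_nonneg)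
    obtain q where q: "q \<in> D" "dist x q < e / 3 / L"
    proof -
      have "e / 3 / L > 0" using e L by (intro divide_pos_pos) auto
      then have "\<exists>d\<in>D. d \<in> ball x (e / 3 / L)" by (intro D(2)) simp_all
      then show ?thesis using that by (meson mem_ball)
    qed
    have near: "\<bar>moll (\<eta> k) (u n) x - moll (\<eta> k) (u n) q\<bar> < e / 3" for n
    proof -
      have "\<bar>moll (\<eta> k) (u n) x - moll (\<eta> k) (u n) q\<bar> \<le> L2n (\<eta> k) * L2n (\<lambda>w. u n (w + (x - q)) - u n w)"
        by (rule moll_equicontinuous[OF \<eta> su])
      also have "\<dots> \<le> L2n (\<eta> k) * (norm (x - q) * K)"
        using order_trans[OF W_translation[OF u] mult_left_mono[OF K norm_ge_zero]]
        by (intro mult_left_mono) auto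
      also have "\<dots> \<le> L * dist x q" by (simp add: L_def dist_norm algebra_simps)
      also have "\<dots> < e / 3" using q(2) L by (simp only: pos_less_divide_eq mult.commute[of L])
      finally show ?thesis .
    qed
    have "Cauchy (\<lambda>n. moll (\<eta> k) (u (r n)) q)" using cD[OF q(1)] by (rule convergent_Cauchy)
    then obtain M where M: "\<And>m n. m \<ge> M \<Longrightarrow> n \<ge> M \<Longrightarrow> dist (moll (\<eta> k) (u (r m)) q) (moll (\<eta> k) (u (r n)) q) < e / 3"
      using metric_CauchyD[of _ "e / 3"] e by (metis divide_pos_pos zero_less_numeral)
    show "\<exists>M. \<forall>m\<ge>M. \<forall>n\<ge>M. dist (moll (\<eta> k) (u (r m)) x) (moll (\<eta> k) (u (r n)) x) < e"
    proof (intro exI[of _ M] allI impI)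
      fix m n assume "M \<le> m" "M \<le> n"
      from M[OF this] near[of "r m"] near[of "r n"]
      show "dist (moll (\<eta> k) (u (r m)) x) (moll (\<eta> k) (u (r n)) x) < e"
        unfolding dist_real_def by linarith
    qed
  qed
  with r(1) that show ?thesis by blast
qed

text \<open>Outside \<open>B\<close> the potential energy dominates \<open>M\<close> times the
  squared L2 norm. With \<open>V\<close> growing to infinity this prevents mass from
  escaping.\<close>

lemma W_tail:
  assumes w: "w \<in> W_space V" and M: "M > 0" "\<And>x. x \<notin> B \<Longrightarrow> V x \<ge> M" and B[measurable]: "B \<in> sets borel"
  shows "square_integrable (\<lambda>x. indicator (- B) x * w x)" "L2n (\<lambda>x. indicator (- B) x * w x) \<le> W_norm V w / sqrt M"
proof -
  note [measurable] = W_D(6)[OF w]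
  have le: "\<bar>indicator (- B) x * w x\<bar> \<le> norm ((1 / sqrt M) *\<^sub>R F w x)" for x
  proof (cases "x \<in> B")
    case False
    have "M * (w x)\<^sup>2 \<le> V x * (w x)\<^sup>2" by (intro mult_right_mono M(2) False) auto
    also have "\<dots> \<le> (norm (F w x))\<^sup>2" by (simp add: norm_wpair)
    finally have "(w x)\<^sup>2 \<le> (norm ((1 / sqrt M) *\<^sub>R F w x))\<^sup>2"
      using M(1) by (simp add: power_divide field_simps)
    then have "\<bar>w x\<bar> \<le> norm ((1 / sqrt M) *\<^sub>R F w x)"
      by (rule abs_le_square_iff[THEN iffD2, of _ "norm _", simplified abs_norm_cancel])
    then show ?thesis using False by simp
  qed simp
  have "(\<lambda>x. indicator (- B) x * w x) \<in> borel_measurable borel" by measurable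
  note b = sqi_bound[OF sqi_scaleR(1)[OF W_D(5)[OF w], of "1 / sqrt M"] this]
  show "square_integrable (\<lambda>x. indicator (- B) x * w x)" by (rule b) (use le in simp)
  have "L2n (\<lambda>x. indicator (- B) x * w x) \<le> L2n (\<lambda>x. (1 / sqrt M) *\<^sub>R F w x)" by (rule b) (use le in simp)
  then show "L2n (\<lambda>x. indicator (- B) x * w x) \<le> W_norm V w / sqrt M"
    using sqi_scaleR(2)[OF W_D(5)[OF w], of "1 / sqrt M"] M(1) by (simp add: W_norm_eq)
qed

text \<open>Rellich's argument on all of space. A difference of two members is split into its part
  outside a large ball, small by \<open>W_tail\<close>, the mollification error on the ball, small
  by \<open>W_translation\<close>, and the mollified part there, which converges by dominated
  convergence.\<close>

theorem W_compact:
  assumes u: "\<And>n. u n \<in> W_space V" and K: "\<And>n. W_norm V (u n) \<le> K"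
  obtains r :: "nat \<Rightarrow> nat" where "strict_mono r"
    "\<And>e. e > 0 \<Longrightarrow> \<exists>M. \<forall>m\<ge>M. \<forall>n\<ge>M. L2n (\<lambda>x. u (r m) x - u (r n) x) < e"
proof -
  have K0: "K \<ge> 0" using K[of 0] W_norm_nonneg[of "u 0"] by linarith
  have su: "square_integrable (u n)" for n by (rule W_D(2)[OF u])
  define eps where "eps k = inverse (real (Suc k))" for k
  have eps: "eps k > 0" for k by (simp add: eps_def)
  have "\<exists>\<eta> :: 'a \<Rightarrow> real. mollifier (eps k) \<eta>" for k using mollifier_exists[OF eps[of k]] by blast
  then obtain \<eta> :: "nat \<Rightarrow> 'a \<Rightarrow> real" where \<eta>: "\<And>k. mollifier (eps k) (\<eta> k)" by metis
  then have t: "test_function (\<eta> k)" for k by (simp add: mollifier_def)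
  obtain r :: "nat \<Rightarrow> nat" where r: "strict_mono r" "\<And>k x. convergent (\<lambda>n. moll (\<eta> k) (u (r n)) x)"
    by (rule moll_convergent_subseq[where u = u and K = K and \<eta> = \<eta>, OF u K t]) blast
  have "\<exists>M. \<forall>m\<ge>M. \<forall>n\<ge>M. L2n (\<lambda>x. u (r m) x - u (r n) x) < e" if e: "e > 0" for e
  proof -
    \<comment> \<open>Differences of members have norm at most \<open>2 * K\<close>; this makes
      \<open>2 * K / sqrt T \<le> e / 4\<close>, and the summand 1 keeps \<open>T\<close> positive
      when \<open>K = 0\<close>.\<close>
    define T where "T = (8 * K / e + 1)\<^sup>2"
    have "8 * K / e \<ge> 0" using K0 e by simp
    then have T: "T > 0" "sqrt T = 8 * K / e + 1" by (simp_all add: T_def)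
    have T2: "2 * K / sqrt T \<le> e / 4"
      using e \<open>8 * K / e \<ge> 0\<close> by (simp add: T(2) field_simps add_nonneg_pos)
    obtain R where R: "R > 0" "\<And>x. norm x \<ge> R \<Longrightarrow> V x \<ge> T" by (rule filterlim_at_infinity_ge[OF V_lim]) blast
    define B where "B = cball (0::'a) R"
    have B[measurable]: "B \<in> sets borel" by (simp add: B_def)
    have "\<exists>k. eps k < e / (8 * K + 8)"
      unfolding eps_def by (rule reals_Archimedean) (use e K0 in \<open>simp add: add_nonneg_pos\<close>)
    then obtain k where k: "eps k < e / (8 * K + 8)" by blast
    have k2: "eps k * (2 * K) \<le> e / 4"
    proof -
      have "eps k * (8 * K + 8) < e" using k K0 by (simp add: pos_less_divide_eq add_nonneg_pos)
      then show ?thesis using eps[of k] by (simp add: algebra_simps)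
    qed
    define g where "g n x = moll (\<eta> k) (u (r n)) x" for n x
    have [measurable]: "g n \<in> borel_measurable borel" for n
      unfolding g_def using moll_measurable[OF t su] .
    \<comment> \<open>Pointwise limit of the mollified subsequence. The uniform bound
      \<open>C\<close> makes a constant on the ball an admissible majorant.\<close>
    define p where "p x = lim (\<lambda>n. g n x)" for x
    have [measurable]: "p \<in> borel_measurable borel" unfolding p_def by measurable
    have gp: "(\<lambda>n. g n x) \<longlonglongrightarrow> p x" for x
      using r(2)[of k x] by (simp add: p_def g_def convergent_LIMSEQ_iff)
    define C where "C = L2n (\<eta> k) * (K / sqrt aV)"
    have gC: "\<bar>g n x\<bar> \<le> C" for n x
    proof -
      have "L2n (u (r n)) \<le> K / sqrt aV"
        using L2_le_W[OF u, of "r n"] divide_right_mono[OF K[of "r n"], of "sqrt aV"] aV_pos by simp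
      then show ?thesis
        unfolding g_def C_def by (rule order_trans[OF moll_abs_le[OF t su] mult_left_mono[OF _ L2n_nonneg]])
    qed
    have pC: "\<bar>p x\<bar> \<le> C" for x
      by (rule LIMSEQ_le_const2[OF tendsto_rabs[OF gp]]) (use gC in auto)
    have sB: "square_integrable (\<lambda>x. indicator B x * h x)"
      if "h \<in> borel_measurable borel" "\<And>x. \<bar>h x\<bar> \<le> D" for h :: "'a \<Rightarrow> real" and D
    proof (rule compact_support_sqi[where R = R and B = D])
      show "(\<lambda>x. indicator B x * h x) \<in> borel_measurable borel" using that(1) by measurable
      show "\<bar>indicator B x * h x\<bar> \<le> D" for x
        using that(2)[of x] by (auto simp: indicator_def intro: order_trans[OF abs_ge_zero])
    qed (simp add: B_def)
    have lim: "(\<lambda>n. L2n (\<lambda>x. indicator B x * (g n x - p x))) \<longlonglongrightarrow> 0"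
    proof (rule L2_dominated[where g = "\<lambda>x. indicator B x * (2 * C)"])
      show "square_integrable (\<lambda>x. indicator B x * (2 * C))"
        by (rule sB[where D = "\<bar>2 * C\<bar>"]) auto
      show "AE x in lborel. (\<lambda>n. indicator B x * (g n x - p x)) \<longlonglongrightarrow> 0"
      proof (rule AE_I2)
        fix x
        have "(\<lambda>n. indicator B x * (g n x - p x)) \<longlonglongrightarrow> indicator B x * (p x - p x)"
          by (intro tendsto_intros gp)
        then show "(\<lambda>n. indicator B x * (g n x - p x)) \<longlonglongrightarrow> 0" by simp
      qed
      show "AE x in lborel. norm (indicator B x * (g n x - p x)) \<le> norm (indicator B x * (2 * C))" for n
      proof (rule AE_I2)
        fix x
        have "\<bar>g n x - p x\<bar> \<le> \<bar>2 * C\<bar>" using gC[of n x] pC[of x] by linarith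
        then show "norm (indicator B x * (g n x - p x)) \<le> norm (indicator B x * (2 * C))"
          by (simp add: indicator_def)
      qed
    qed measurable
    then obtain M where M: "\<And>n. n \<ge> M \<Longrightarrow> L2n (\<lambda>x. indicator B x * (g n x - p x)) < e / 8"
    proof -
      have "0 < e / 8" using e by simp
      from LIMSEQ_D[OF lim this] show ?thesis using that by (simp only: diff_zero real_norm_def abs_of_nonneg[OF L2n_nonneg]) blast
    qed
    show ?thesis
    proof (intro exI[of _ M] allI impI)
      fix m n assume mn: "M \<le> m" "M \<le> n"
      define w where "w x = u (r m) x - u (r n) x" for x
      have w: "w \<in> W_space V" unfolding w_def by (rule W_diff(1)[OF u u])
      have sw: "square_integrable w" by (rule W_D(2)[OF w])
      have wK: "W_norm V w \<le> 2 * K"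
        unfolding w_def using W_norm_diff_le[OF u u, of "r m" "r n"] K[of "r m"] K[of "r n"] by linarith
      have tr: "L2n (\<lambda>x. w (x + z) - w x) \<le> eps k * (2 * K)" if "norm z < eps k" for z
        using W_translation[OF w, of z] mult_mono[of "norm z" "eps k" "W_norm V w" "2 * K"] that wK
          W_norm_nonneg[of w] eps[of k] by auto
      have "0 \<le> eps k * (2 * K)" using eps[of k] K0 by simp
      note ma = moll_approx[OF \<eta>[of k] sw this tr]
      have mw: "moll (\<eta> k) w x = g m x - g n x" for x
        unfolding w_def g_def by (rule moll_diff[OF t su su])
      have d1: "L2n (\<lambda>x. indicator (- B) x * w x) \<le> e / 4"
      proof -
        have "L2n (\<lambda>x. indicator (- B) x * w x) \<le> W_norm V w / sqrt T"
          by (rule W_tail[OF w T(1) _ B]) (use R(2) in \<open>simp add: B_def\<close>)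
        also have "\<dots> \<le> 2 * K / sqrt T" using wK T(1) by (intro divide_right_mono) auto
        finally show ?thesis using T2 by linarith
      qed
      have sd: "square_integrable (\<lambda>x. w x - moll (\<eta> k) w x)" "L2n (\<lambda>x. w x - moll (\<eta> k) w x) \<le> e / 4"
        using sqi_minus[OF ma(2)] ma(3) k2 by simp_all
      have d2: "L2n (\<lambda>x. indicator B x * (w x - moll (\<eta> k) w x)) \<le> e / 4"
        using sqi_indicator(2)[OF sd(1) B] sd(2) by linarith
      have s1: "square_integrable (\<lambda>x. indicator B x * (g i x - p x))" for i
      proof (rule sB[where D = "2 * C"])
        show "\<bar>g i x - p x\<bar> \<le> 2 * C" for x using gC[of i x] pC[of x] by linarith
      qed measurable
      have "L2n (\<lambda>x. indicator B x * (g m x - p x) - indicator B x * (g n x - p x))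
          \<le> L2n (\<lambda>x. indicator B x * (g m x - p x)) + L2n (\<lambda>x. indicator B x * (g n x - p x))"
        using L2n_triangle[OF s1 sqi_minus(1)[OF s1]] sqi_minus(2)[OF s1] by simp
      also have "\<dots> < e / 4" using M[OF mn(1)] M[OF mn(2)] by linarith
      also have "(\<lambda>x. indicator B x * (g m x - p x) - indicator B x * (g n x - p x)) = (\<lambda>x. indicator B x * moll (\<eta> k) w x)"
        by (auto simp: mw algebra_simps fun_eq_iff)
      finally have d3: "L2n (\<lambda>x. indicator B x * moll (\<eta> k) w x) < e / 4" .
      note i2 = sqi_indicator(1)[OF sd(1) B] and i3 = sqi_indicator(1)[OF ma(1) B]
      have i1: "square_integrable (\<lambda>x. indicator (- B) x * w x)"
        by (rule sqi_indicator(1)[OF sw]) measurable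
      have "L2n (\<lambda>x. indicator (- B) x * w x + (indicator B x * (w x - moll (\<eta> k) w x) + indicator B x * moll (\<eta> k) w x))
        \<le> L2n (\<lambda>x. indicator (- B) x * w x) + (L2n (\<lambda>x. indicator B x * (w x - moll (\<eta> k) w x)) + L2n (\<lambda>x. indicator B x * moll (\<eta> k) w x))"
        using L2n_triangle[OF i1 sqi_add[OF i2 i3]] L2n_triangle[OF i2 i3] by linarith
      also have "\<dots> < e" using d1 d2 d3 e by linarith
      also have "(\<lambda>x. indicator (- B) x * w x + (indicator B x * (w x - moll (\<eta> k) w x) + indicator B x * moll (\<eta> k) w x)) = w"
        by (auto simp: indicator_def fun_eq_iff)
      finally show "L2n (\<lambda>x. u (r m) x - u (r n) x) < e" by (simp add: w_def)
    qed
  qed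
  with r(1) that show ?thesis by blast
qed

end

section \<open>Hardy inequality and the Coulomb-type kernels\<close>

lemma nn_integral_powr_tail:
  assumes a: "a > (0::real)"
  shows "(\<integral>\<^sup>+t. ennreal (t powr (- 1 - a)) * indicator {1..} t \<partial>lborel) = ennreal (1 / a)"
proof -
  have "(\<integral>\<^sup>+t. ennreal (t powr (- 1 - a)) * indicator {1..} t \<partial>lborel) = ennreal (0 - (- (1 powr (- a)) / a))"
  proof (rule nn_integral_FTC_atLeast[where F = "\<lambda>t. - (t powr (- a)) / a"])
    fix t :: real assume t: "1 \<le> t"
    have "((\<lambda>t. t powr (- a)) has_real_derivative - a * t powr (- a - 1)) (at t)"
      using t by (intro has_real_derivative_powr) auto
    then have "((\<lambda>t. - (t powr (- a)) / a) has_real_derivative - (- a * t powr (- a - 1)) / a) (at t)"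
      by (intro DERIV_cdivide DERIV_minus)
    moreover have "- (- a * t powr (- a - 1)) / a = t powr (- a - 1)" using a by simp
    moreover have "- a - 1 = - 1 - a" by simp
    ultimately show "((\<lambda>t. - (t powr (- a)) / a) has_real_derivative t powr (- 1 - a)) (at t)" by (simp only:)
  next
    have "((\<lambda>t::real. t powr (- a)) \<longlongrightarrow> 0) at_top"
      using a by (intro tendsto_neg_powr filterlim_ident) auto
    then have "((\<lambda>t::real. - (t powr (- a)) / a) \<longlongrightarrow> - 0 / a) at_top"
      by (intro tendsto_divide tendsto_minus tendsto_const) (use a in auto)
    then show "((\<lambda>t::real. - (t powr (- a)) / a) \<longlongrightarrow> 0) at_top" by simp
  qed auto
  then show ?thesis using a by simp
qed

text \<open>The derivative is integrated along the ray through \<open>x\<close> from parameter 1 to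
  beyond the support. The weight \<open>t powr (1 + a)\<close> is chosen so that its reciprocal is
  integrable at infinity, with integral \<open>1 / a\<close>.\<close>

lemma hardy_ray:
  fixes \<phi> :: "'a::euclidean_space \<Rightarrow> real"
  assumes \<phi>: "test_function \<phi>" and x: "x \<noteq> 0" and a: "a > (0::real)"
  shows "ennreal ((\<phi> x)\<^sup>2) \<le> ennreal (1 / a) *
    (\<integral>\<^sup>+t. ennreal (t powr (1 + a) * ((norm (grad \<phi> (t *\<^sub>R x)))\<^sup>2 * (norm x)\<^sup>2)) * indicator {1..} t \<partial>lborel)"
proof -
  obtain R where R: "R > 0" "\<And>x. norm x \<ge> R \<Longrightarrow> \<phi> x = 0" using test_supportE[OF \<phi>] by metis
  have [measurable]: "grad \<phi> \<in> borel_measurable borel" by (rule test_grad_measurable[OF \<phi>])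
  define T where "T = max 1 (R / norm x)"
  have T: "1 \<le> T" "norm (T *\<^sub>R x) \<ge> R"
  proof -
    show "1 \<le> T" by (simp add: T_def)
    have "R / norm x \<le> T" by (simp add: T_def)
    then have "R \<le> T * norm x" using x by (simp add: pos_divide_le_eq)
    then show "norm (T *\<^sub>R x) \<ge> R" using \<open>1 \<le> T\<close> by simp
  qed
  have "ennreal ((\<phi> (0 + T *\<^sub>R x) - \<phi> (0 + 1 *\<^sub>R x))\<^sup>2)
    \<le> (\<integral>\<^sup>+t. ennreal (1 / (t powr (1 + a))) * indicator {1..T} t \<partial>lborel) *
      (\<integral>\<^sup>+t. ennreal (t powr (1 + a) * (grad \<phi> (0 + t *\<^sub>R x) \<bullet> x)\<^sup>2) * indicator {1..T} t \<partial>lborel)"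
  proof (rule ftc_Cauchy_Schwarz[OF T(1)])
    show "((\<lambda>t. \<phi> (0 + t *\<^sub>R x)) has_real_derivative grad \<phi> (0 + t *\<^sub>R x) \<bullet> x) (at t)" for t
      by (rule test_line_deriv[OF \<phi>])
    show "isCont (\<lambda>t. grad \<phi> (0 + t *\<^sub>R x) \<bullet> x) t" for t
      by (intro continuous_intros continuous_on_interior[OF test_grad_continuous[OF \<phi>]]
          isCont_o2[of _ _ "grad \<phi>"]) auto
  qed auto
  also have "\<dots> \<le> (\<integral>\<^sup>+t. ennreal (t powr (- 1 - a)) * indicator {1..} t \<partial>lborel) *
    (\<integral>\<^sup>+t. ennreal (t powr (1 + a) * ((norm (grad \<phi> (t *\<^sub>R x)))\<^sup>2 * (norm x)\<^sup>2)) * indicator {1..} t \<partial>lborel)"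
  proof (rule mult_mono[OF nn_integral_mono nn_integral_mono])
    fix t :: real
    have "1 / (t powr (1 + a)) = t powr (- 1 - a)" using powr_minus_divide[of t "1 + a"] by simp
    then show "ennreal (1 / (t powr (1 + a))) * indicator {1..T} t \<le> ennreal (t powr (- 1 - a)) * indicator {1..} t"
      by (auto simp: indicator_def)
    have "\<bar>grad \<phi> (t *\<^sub>R x) \<bullet> x\<bar>\<^sup>2 \<le> (norm (grad \<phi> (t *\<^sub>R x)) * norm x)\<^sup>2"
      by (intro power_mono Cauchy_Schwarz_ineq2) auto
    then have "t powr (1 + a) * (grad \<phi> (t *\<^sub>R x) \<bullet> x)\<^sup>2 \<le> t powr (1 + a) * ((norm (grad \<phi> (t *\<^sub>R x)))\<^sup>2 * (norm x)\<^sup>2)"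
      by (intro mult_left_mono) (auto simp: power_mult_distrib)
    then show "ennreal (t powr (1 + a) * (grad \<phi> (0 + t *\<^sub>R x) \<bullet> x)\<^sup>2) * indicator {1..T} t
      \<le> ennreal (t powr (1 + a) * ((norm (grad \<phi> (t *\<^sub>R x)))\<^sup>2 * (norm x)\<^sup>2)) * indicator {1..} t"
      by (auto simp: indicator_def intro: ennreal_leI)
  qed auto
  finally show ?thesis using R(2)[OF T(2)] nn_integral_powr_tail[OF a] by simp
qed

text \<open>The ray inequality is multiplied by \<open>norm x powr (- m)\<close> and integrated;
  after Tonelli, scaling by \<open>t\<close> turns the inner integral into
  \<open>t powr (- N)\<close> times one fixed integral, and a convergent power of \<open>t\<close>
  remains.\<close>

lemma hardy_origin:
  fixes \<phi> :: "'a::euclidean_space \<Rightarrow> real"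
  assumes \<phi>: "test_function \<phi>" and m: "m < real DIM('a)"
  shows "(\<integral>\<^sup>+x. ennreal ((\<phi> x)\<^sup>2 * norm x powr (- m)) \<partial>lborel) \<le>
    ennreal (4 / (real DIM('a) - m)\<^sup>2) * (\<integral>\<^sup>+x. ennreal ((norm (grad \<phi> x))\<^sup>2 * norm x powr (2 - m)) \<partial>lborel)"
proof -
  have [measurable]: "\<phi> \<in> borel_measurable borel" "grad \<phi> \<in> borel_measurable borel"
    using \<phi> test_measurable test_grad_measurable by auto
  define N where "N = real DIM('a)"
  \<comment> \<open>For general \<open>a\<close> the constant would be
    \<open>1 / (a * (N - m - a))\<close>; the midpoint minimises it and gives
    \<open>4 / (N - m)\<^sup>2\<close>.\<close>
  define a where "a = (N - m) / 2"
  have a: "a > 0" using m by (simp add: a_def N_def)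
  define h where "h x = (norm (grad \<phi> x))\<^sup>2 * norm x powr (2 - m)" for x
  have [measurable]: "h \<in> borel_measurable borel" unfolding h_def by measurable
  define J where "J = (\<integral>\<^sup>+x. ennreal (h x) \<partial>lborel)"
  have pw: "ennreal ((\<phi> x)\<^sup>2 * norm x powr (- m)) \<le>
      ennreal (1 / a) * (\<integral>\<^sup>+t. ennreal (t powr (- 1 + a + m)) * ennreal (h (t *\<^sub>R x)) * indicator {1..} t \<partial>lborel)" for x
  proof (cases "x = 0")
    case False
    have "ennreal ((\<phi> x)\<^sup>2 * norm x powr (- m)) = ennreal ((\<phi> x)\<^sup>2) * ennreal (norm x powr (- m))"
      by (simp add: ennreal_mult)
    also have "\<dots> \<le> (ennreal (1 / a) * (\<integral>\<^sup>+t. ennreal (t powr (1 + a) * ((norm (grad \<phi> (t *\<^sub>R x)))\<^sup>2 * (norm x)\<^sup>2)) * indicator {1..} t \<partial>lborel))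
        * ennreal (norm x powr (- m))"
      by (intro mult_right_mono hardy_ray[OF \<phi> False a]) simp
    also have "\<dots> = ennreal (1 / a) * (\<integral>\<^sup>+t. ennreal (t powr (1 + a) * ((norm (grad \<phi> (t *\<^sub>R x)))\<^sup>2 * (norm x)\<^sup>2)) * indicator {1..} t * ennreal (norm x powr (- m)) \<partial>lborel)"
      by (subst nn_integral_multc) (auto simp: mult.assoc)
    also have "(\<integral>\<^sup>+t. ennreal (t powr (1 + a) * ((norm (grad \<phi> (t *\<^sub>R x)))\<^sup>2 * (norm x)\<^sup>2)) * indicator {1..} t * ennreal (norm x powr (- m)) \<partial>lborel)
      = (\<integral>\<^sup>+t. ennreal (t powr (- 1 + a + m)) * ennreal (h (t *\<^sub>R x)) * indicator {1..} t \<partial>lborel)"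
    proof (rule nn_integral_cong)
      fix t :: real
      show "ennreal (t powr (1 + a) * ((norm (grad \<phi> (t *\<^sub>R x)))\<^sup>2 * (norm x)\<^sup>2)) * indicator {1..} t * ennreal (norm x powr (- m))
        = ennreal (t powr (- 1 + a + m)) * ennreal (h (t *\<^sub>R x)) * indicator {1..} t"
      proof (cases "t \<ge> 1")
        case True
        have e1: "norm (t *\<^sub>R x) powr (2 - m) = t powr (2 - m) * norm x powr (2 - m)"
          using True by (simp add: powr_mult)
        have e2: "t powr (- 1 + a + m) * t powr (2 - m) = t powr (1 + a)"
          by (simp flip: powr_add)
        have "(norm x)\<^sup>2 = norm x powr 2" using False by (simp add: powr_numeral)
        then have e3: "(norm x)\<^sup>2 * norm x powr (- m) = norm x powr (2 - m)"
          by (simp add: powr_add[symmetric] del: powr_numeral)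
        have "t powr (- 1 + a + m) * h (t *\<^sub>R x) = (t powr (- 1 + a + m) * t powr (2 - m)) * (norm (grad \<phi> (t *\<^sub>R x)))\<^sup>2 * norm x powr (2 - m)"
          unfolding h_def e1 by (simp only: mult_ac)
        also have "\<dots> = t powr (1 + a) * ((norm (grad \<phi> (t *\<^sub>R x)))\<^sup>2 * (norm x)\<^sup>2) * norm x powr (- m)"
          unfolding e2 e3[symmetric] by (simp only: mult_ac)
        finally have E: "t powr (- 1 + a + m) * h (t *\<^sub>R x) = t powr (1 + a) * ((norm (grad \<phi> (t *\<^sub>R x)))\<^sup>2 * (norm x)\<^sup>2) * norm x powr (- m)" .
        show ?thesis using True E[symmetric] by (simp add: h_def flip: ennreal_mult)
      qed simp
    qed
    finally show ?thesis .
  qed simp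
  have sc: "(\<integral>\<^sup>+x. ennreal (h (t *\<^sub>R x)) \<partial>lborel) = ennreal (t powr (- N)) * J" if t: "t \<ge> 1" for t
  proof -
    have "J = ennreal (t ^ DIM('a)) * (\<integral>\<^sup>+x. ennreal (h (t *\<^sub>R x)) \<partial>lborel)"
      unfolding J_def using t nn_integral_affine[of "\<lambda>x. ennreal (h x)" t 0] by simp
    also have "t ^ DIM('a) = t powr N" using t by (simp add: N_def powr_realpow)
    finally have "ennreal (t powr (- N)) * J = (ennreal (t powr (- N)) * ennreal (t powr N)) * (\<integral>\<^sup>+x. ennreal (h (t *\<^sub>R x)) \<partial>lborel)"
      by (simp add: mult.assoc)
    also have "ennreal (t powr (- N)) * ennreal (t powr N) = 1"
      using t by (simp flip: ennreal_mult powr_add)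
    finally show ?thesis by simp
  qed
  have "(\<integral>\<^sup>+x. ennreal ((\<phi> x)\<^sup>2 * norm x powr (- m)) \<partial>lborel) \<le>
    (\<integral>\<^sup>+x. ennreal (1 / a) * (\<integral>\<^sup>+t. ennreal (t powr (- 1 + a + m)) * ennreal (h (t *\<^sub>R x)) * indicator {1..} t \<partial>lborel) \<partial>lborel)"
    by (rule nn_integral_mono) (rule pw)
  also have "\<dots> = ennreal (1 / a) * (\<integral>\<^sup>+x. (\<integral>\<^sup>+t. ennreal (t powr (- 1 + a + m)) * ennreal (h (t *\<^sub>R x)) * indicator {1..} t \<partial>lborel) \<partial>lborel)"
    by (rule nn_integral_cmult) measurable
  also have "(\<integral>\<^sup>+x. (\<integral>\<^sup>+t. ennreal (t powr (- 1 + a + m)) * ennreal (h (t *\<^sub>R x)) * indicator {1..} t \<partial>lborel) \<partial>lborel)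
    = (\<integral>\<^sup>+t. (\<integral>\<^sup>+x. ennreal (t powr (- 1 + a + m)) * ennreal (h (t *\<^sub>R x)) * indicator {1..} t \<partial>lborel) \<partial>(lborel::real measure))"
    by (rule lborel_pair.Fubini') measurable
  also have "\<dots> = (\<integral>\<^sup>+t. ennreal (t powr (- 1 - a)) * indicator {1..} t * J \<partial>(lborel::real measure))"
  proof (rule nn_integral_cong)
    fix t :: real
    have "(\<integral>\<^sup>+x. ennreal (t powr (- 1 + a + m)) * ennreal (h (t *\<^sub>R x)) * indicator {1..} t \<partial>lborel)
      = (\<integral>\<^sup>+x. (ennreal (t powr (- 1 + a + m)) * indicator {1..} t) * ennreal (h (t *\<^sub>R x)) \<partial>lborel)"
      by (simp only: mult_ac)
    also have "\<dots> = (ennreal (t powr (- 1 + a + m)) * indicator {1..} t) * (\<integral>\<^sup>+x. ennreal (h (t *\<^sub>R x)) \<partial>lborel)"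
      by (rule nn_integral_cmult) measurable
    also have "\<dots> = ennreal (t powr (- 1 - a)) * indicator {1..} t * J"
    proof (cases "t \<ge> 1")
      case True
      have "- 1 + a + m + - N = - 1 - a" by (simp add: a_def field_simps)
      then have "t powr (- 1 + a + m) * t powr (- N) = t powr (- 1 - a)" by (simp only: powr_add[symmetric])
      then have "ennreal (t powr (- 1 + a + m)) * ennreal (t powr (- N)) = ennreal (t powr (- 1 - a))"
        by (simp flip: ennreal_mult)
      then show ?thesis using True sc[OF True] by (simp flip: mult.assoc)
    qed simp
    finally show "(\<integral>\<^sup>+x. ennreal (t powr (- 1 + a + m)) * ennreal (h (t *\<^sub>R x)) * indicator {1..} t \<partial>lborel)
      = ennreal (t powr (- 1 - a)) * indicator {1..} t * J" .
  qed
  also have "\<dots> = ennreal (1 / a) * J"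
    by (subst nn_integral_multc) (auto simp: nn_integral_powr_tail[OF a])
  also have "ennreal (1 / a) * (ennreal (1 / a) * J) = ennreal (4 / (N - m)\<^sup>2) * J"
  proof -
    have "1 / a * (1 / a) = 4 / (N - m)\<^sup>2" by (simp add: a_def power2_eq_square)
    then have "ennreal (1 / a) * ennreal (1 / a) = ennreal (4 / (N - m)\<^sup>2)" using a by (simp flip: ennreal_mult)
    then show ?thesis by (simp flip: mult.assoc)
  qed
  finally show ?thesis by (simp add: J_def h_def N_def)
qed

lemma grad_translate:
  assumes "test_function \<phi>"
  shows "grad (\<lambda>x. \<phi> (x + y)) x = grad \<phi> (x + y)"
proof -
  have "((\<lambda>x. x + y) has_derivative (\<lambda>v. v)) (at x)" by (auto intro!: derivative_eq_intros)
  from has_derivative_compose[OF this test_derivative[OF assms]]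
  have "frechet_derivative (\<lambda>x. \<phi> (x + y)) (at x) = frechet_derivative \<phi> (at (x + y))"
    by (rule frechet_derivative_eq)
  then show ?thesis by (simp add: grad_def)
qed

lemma test_translate:
  assumes "test_function \<phi>"
  shows "test_function (\<lambda>x. \<phi> (x + y))"
  using test_affine[OF assms, of 1 y] by (simp add: add.commute)

lemma hardy:
  fixes \<phi> :: "'a::euclidean_space \<Rightarrow> real"
  assumes \<phi>: "test_function \<phi>" and m: "m < real DIM('a)"
  shows "(\<integral>\<^sup>+x. ennreal ((\<phi> x)\<^sup>2 * norm (x - y) powr (- m)) \<partial>lborel) \<le>
    ennreal (4 / (real DIM('a) - m)\<^sup>2) * (\<integral>\<^sup>+x. ennreal ((norm (grad \<phi> x))\<^sup>2 * norm (x - y) powr (2 - m)) \<partial>lborel)"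
proof -
  have [measurable]: "\<phi> \<in> borel_measurable borel" "grad \<phi> \<in> borel_measurable borel"
    using \<phi> test_measurable test_grad_measurable by auto
  show ?thesis
    using hardy_origin[OF test_translate[OF \<phi>, of y] m]
      nn_integral_translate[of "\<lambda>x. ennreal ((\<phi> x)\<^sup>2 * norm (x - y) powr (- m))" y]
      nn_integral_translate[of "\<lambda>x. ennreal ((norm (grad \<phi> x))\<^sup>2 * norm (x - y) powr (2 - m))" y]
    by (simp add: grad_translate[OF \<phi>])
qed

definition h1sq :: "('a::euclidean_space \<Rightarrow> real) \<Rightarrow> real" where
  "h1sq \<phi> = (L2n \<phi>)\<^sup>2 + (L2n (grad \<phi>))\<^sup>2"

lemma h1sq_nonneg: "h1sq \<phi> \<ge> 0"
  by (simp add: h1sq_def)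

text \<open>For exponents at most 2 the weight on the right of Hardy's inequality does not decay, so the
  inequality is applied to the product with a cutoff around \<open>y\<close>.\<close>

lemma hardy_local:
  fixes m :: real
  assumes m: "0 < m" "m \<le> 2" "m < real DIM('a::euclidean_space)"
  obtains C where "C > 0" "\<And>\<phi> (y::'a). test_function \<phi> \<Longrightarrow>
    (\<integral>\<^sup>+x. ennreal ((\<phi> x)\<^sup>2 * norm (x - y) powr (- m)) \<partial>lborel) \<le> ennreal (C * h1sq \<phi>)"
proof -
  obtain B where B: "B > 0" "\<And>x. norm (grad bump (x::'a)) \<le> B" using test_grad_bounded[OF bump_test] by metis
  define H where "H = 4 / (real DIM('a) - m)\<^sup>2"
  have H: "H > 0" using m(3) by (simp add: H_def)
  \<comment> \<open>On the ball of radius 1/2 the cutoff is at least \<open>exp (1 - 4/3)\<close>,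
    so \<open>c * (k x)\<^sup>2 \<ge> 1\<close> there; outside it the weight is at most
    \<open>2 powr 2\<close>, the source of the summand 4 in \<open>C\<close>.\<close>
  define c where "c = (exp (1/3::real))\<^sup>2"
  have c: "c > 0" by (simp add: c_def)
  define C where "C = c * H * (2 + 2 * B\<^sup>2) + 4"
  have C: "C > 0" "c * (H * 2) \<le> C" "c * (H * (2 * B\<^sup>2)) + 4 \<le> C"
  proof -
    have "0 \<le> c * H * (2 + 2 * B\<^sup>2)" "0 \<le> c * (H * (2 * B\<^sup>2))" "0 \<le> c * (H * 2)" using c H by simp_all
    then show "C > 0" "c * (H * 2) \<le> C" "c * (H * (2 * B\<^sup>2)) + 4 \<le> C"
      by (simp_all add: C_def algebra_simps)
  qed
  have "(\<integral>\<^sup>+x. ennreal ((\<phi> x)\<^sup>2 * norm (x - y) powr (- m)) \<partial>lborel) \<le> ennreal (C * h1sq \<phi>)"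
    if \<phi>: "test_function \<phi>" for \<phi> and y :: 'a
  proof -
    define k where "k x = bump (x + (- y))" for x
    have k: "test_function k" unfolding k_def by (rule test_translate[OF bump_test])
    have k1: "\<bar>k x\<bar> \<le> 1" for x using bump_nonneg[of "x + - y"] bump_le_1[of "x + - y"] by (simp add: k_def)
    have gk: "norm (grad k x) \<le> B" for x
      unfolding k_def grad_translate[OF bump_test] by (rule B(2))
    have t: "test_function (\<lambda>x. k x * \<phi> x)" by (rule test_mult[OF k \<phi>])
    have [measurable]: "\<phi> \<in> borel_measurable borel" "grad \<phi> \<in> borel_measurable borel"
      "k \<in> borel_measurable borel" "grad (\<lambda>x. k x * \<phi> x) \<in> borel_measurable borel"
      using \<phi> k t test_measurable test_grad_measurable by auto
    note si = sqi_integrable[OF test_sqi[OF \<phi>]] sqi_integrable[OF test_grad_sqi[OF \<phi>]]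
    \<comment> \<open>On the unit ball the exponent \<open>2 - m \<ge> 0\<close> makes the weight at
      most 1; beyond it the cutoff and its gradient vanish. The factors 2 come from squaring a
      sum.\<close>
    have g1: "(norm (grad (\<lambda>x. k x * \<phi> x) x))\<^sup>2 * norm (x - y) powr (2 - m) \<le> 2 * (norm (grad \<phi> x))\<^sup>2 + 2 * B\<^sup>2 * (\<phi> x)\<^sup>2" for x
    proof (cases "norm (x - y) \<le> 1")
      case True
      have "norm (grad (\<lambda>x. k x * \<phi> x) x) \<le> norm (k x *\<^sub>R grad \<phi> x) + norm (\<phi> x *\<^sub>R grad k x)"
        unfolding grad_mult[OF k \<phi>] by (rule norm_triangle_ineq)
      also have "\<dots> \<le> norm (grad \<phi> x) + B * \<bar>\<phi> x\<bar>"
        using k1[of x] gk[of x] by (intro add_mono) (auto simp: mult_left_le_one_le mult.commute[of B] intro: mult_left_mono)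
      finally have "(norm (grad (\<lambda>x. k x * \<phi> x) x))\<^sup>2 \<le> (norm (grad \<phi> x) + B * \<bar>\<phi> x\<bar>)\<^sup>2"
        by (rule power_mono) simp
      also have "\<dots> \<le> 2 * (norm (grad \<phi> x))\<^sup>2 + 2 * B\<^sup>2 * (\<phi> x)\<^sup>2"
        using sum_squares_bound[of "norm (grad \<phi> x)" "B * \<bar>\<phi> x\<bar>"] by (simp add: power2_sum power_mult_distrib)
      finally have *: "(norm (grad (\<lambda>x. k x * \<phi> x) x))\<^sup>2 \<le> 2 * (norm (grad \<phi> x))\<^sup>2 + 2 * B\<^sup>2 * (\<phi> x)\<^sup>2" .
      have "norm (x - y) powr (2 - m) \<le> 1 powr (2 - m)" using True m by (intro powr_mono2) auto
      then have "(norm (grad (\<lambda>x. k x * \<phi> x) x))\<^sup>2 * norm (x - y) powr (2 - m) \<le> (norm (grad (\<lambda>x. k x * \<phi> x) x))\<^sup>2 * 1"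
        by (intro mult_left_mono) auto
      then show ?thesis using * by linarith
    next
      case False
      have o: "open {x::'a. 1 < norm (x - y)}" by (intro open_Collect_less continuous_intros)
      have "grad (\<lambda>x. k x * \<phi> x) x = 0"
        unfolding grad_def by (subst frechet_derivative_locally_0[OF o]) (use False in \<open>auto simp: k_def bump_outside\<close>)
      then show ?thesis by simp
    qed
    have pw: "(\<phi> x)\<^sup>2 * norm (x - y) powr (- m) \<le> c * ((k x * \<phi> x)\<^sup>2 * norm (x - y) powr (- m)) + 4 * (\<phi> x)\<^sup>2" for x
    proof (cases "norm (x - y) \<le> 1 / 2")
      case True
      then have "(norm (x - y))\<^sup>2 \<le> (1/2)\<^sup>2" by (intro power_mono) auto
      then have "1 / (1 - (norm (x - y))\<^sup>2) \<le> 4 / 3" by (simp add: power2_eq_square field_simps)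
      then have "exp (1 - 4/3) \<le> k x" using True by (simp add: k_def bump_eq)
      then have "1 \<le> exp (1/3) * k x"
        by (simp add: exp_minus field_simps)
      then have "1\<^sup>2 \<le> (exp (1/3) * k x)\<^sup>2" by (intro power_mono) auto
      then have "1 \<le> c * (k x)\<^sup>2" by (simp add: c_def power_mult_distrib)
      then have "1 * ((\<phi> x)\<^sup>2 * norm (x - y) powr (- m)) \<le> (c * (k x)\<^sup>2) * ((\<phi> x)\<^sup>2 * norm (x - y) powr (- m))"
        by (intro mult_right_mono) auto
      also have "\<dots> = c * ((k x * \<phi> x)\<^sup>2 * norm (x - y) powr (- m))" by (simp add: power_mult_distrib mult_ac)
      finally show ?thesis by (simp add: add_increasing2)
    next
      case False
      have "norm (x - y) powr (- m) \<le> (1/2) powr (- m)" using False m by (intro powr_mono2') auto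
      also have "\<dots> = 2 powr m" by (simp add: powr_minus powr_divide)
      also have "\<dots> \<le> 2 powr 2" using m by (intro powr_mono) auto
      finally have "(\<phi> x)\<^sup>2 * norm (x - y) powr (- m) \<le> (\<phi> x)\<^sup>2 * 4" by (intro mult_left_mono) auto
      moreover have "0 \<le> c * ((k x * \<phi> x)\<^sup>2 * norm (x - y) powr (- m))" using c by simp
      ultimately show ?thesis by linarith
    qed
    have I1: "(\<integral>\<^sup>+x. ennreal (2 * (norm (grad \<phi> x))\<^sup>2 + 2 * B\<^sup>2 * (\<phi> x)\<^sup>2) \<partial>lborel)
      = ennreal (2 * (L2n (grad \<phi>))\<^sup>2 + 2 * B\<^sup>2 * (L2n \<phi>)\<^sup>2)"
      using si by (subst nn_integral_eq_integral) (auto simp: L2n_sq)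
    have "(\<integral>\<^sup>+x. ennreal ((\<phi> x)\<^sup>2 * norm (x - y) powr (- m)) \<partial>lborel)
      \<le> (\<integral>\<^sup>+x. ennreal c * ennreal ((k x * \<phi> x)\<^sup>2 * norm (x - y) powr (- m)) + ennreal (4 * (\<phi> x)\<^sup>2) \<partial>lborel)"
      using c by (intro nn_integral_mono) (simp add: pw flip: ennreal_mult ennreal_plus)
    also have "\<dots> = ennreal c * (\<integral>\<^sup>+x. ennreal ((k x * \<phi> x)\<^sup>2 * norm (x - y) powr (- m)) \<partial>lborel) + (\<integral>\<^sup>+x. ennreal (4 * (\<phi> x)\<^sup>2) \<partial>lborel)"
      by (simp add: nn_integral_add nn_integral_cmult)
    also have "\<dots> \<le> ennreal c * (ennreal H * ennreal (2 * (L2n (grad \<phi>))\<^sup>2 + 2 * B\<^sup>2 * (L2n \<phi>)\<^sup>2)) + ennreal (4 * (L2n \<phi>)\<^sup>2)"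
    proof (intro add_mono mult_left_mono)
      have "(\<integral>\<^sup>+x. ennreal ((k x * \<phi> x)\<^sup>2 * norm (x - y) powr (- m)) \<partial>lborel)
        \<le> ennreal H * (\<integral>\<^sup>+x. ennreal ((norm (grad (\<lambda>x. k x * \<phi> x) x))\<^sup>2 * norm (x - y) powr (2 - m)) \<partial>lborel)"
        unfolding H_def by (rule hardy[OF t m(3)])
      also have "\<dots> \<le> ennreal H * (\<integral>\<^sup>+x. ennreal (2 * (norm (grad \<phi> x))\<^sup>2 + 2 * B\<^sup>2 * (\<phi> x)\<^sup>2) \<partial>lborel)"
        by (intro mult_left_mono nn_integral_mono ennreal_leI g1) simp
      finally show "(\<integral>\<^sup>+x. ennreal ((k x * \<phi> x)\<^sup>2 * norm (x - y) powr (- m)) \<partial>lborel)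
        \<le> ennreal H * ennreal (2 * (L2n (grad \<phi>))\<^sup>2 + 2 * B\<^sup>2 * (L2n \<phi>)\<^sup>2)" unfolding I1 .
      show "(\<integral>\<^sup>+x. ennreal (4 * (\<phi> x)\<^sup>2) \<partial>lborel) \<le> ennreal (4 * (L2n \<phi>)\<^sup>2)"
        using si by (subst nn_integral_eq_integral) (auto simp: L2n_real_sq)
    qed simp
    also have "\<dots> = ennreal (c * (H * (2 * (L2n (grad \<phi>))\<^sup>2 + 2 * B\<^sup>2 * (L2n \<phi>)\<^sup>2)) + 4 * (L2n \<phi>)\<^sup>2)"
      using c H by (simp flip: ennreal_mult ennreal_plus)
    also have "\<dots> \<le> ennreal (C * h1sq \<phi>)"
    proof (rule ennreal_leI)
      have "c * (H * (2 * (L2n (grad \<phi>))\<^sup>2 + 2 * B\<^sup>2 * (L2n \<phi>)\<^sup>2)) + 4 * (L2n \<phi>)\<^sup>2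
        = (c * (H * 2)) * (L2n (grad \<phi>))\<^sup>2 + (c * (H * (2 * B\<^sup>2)) + 4) * (L2n \<phi>)\<^sup>2"
        by (simp add: algebra_simps)
      also have "\<dots> \<le> C * (L2n (grad \<phi>))\<^sup>2 + C * (L2n \<phi>)\<^sup>2"
        by (intro add_mono mult_right_mono C) auto
      finally show "c * (H * (2 * (L2n (grad \<phi>))\<^sup>2 + 2 * B\<^sup>2 * (L2n \<phi>)\<^sup>2)) + 4 * (L2n \<phi>)\<^sup>2 \<le> C * h1sq \<phi>"
        by (simp add: h1sq_def algebra_simps)
    qed
    finally show ?thesis .
  qed
  with C(1) show ?thesis using that by blast
qed

text \<open>Extended nonnegative values let Tonelli, Hardy and Fatou apply before finiteness is
  known; finiteness is the content of \<open>energy2_W\<close>.\<close>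

definition energy2 :: "real \<Rightarrow> ('a::euclidean_space \<Rightarrow> real) \<Rightarrow> ('a \<Rightarrow> real) \<Rightarrow> ennreal" where
  "energy2 m u v = (\<integral>\<^sup>+x. (\<integral>\<^sup>+y. ennreal ((u x)\<^sup>2 * ((v y)\<^sup>2 * norm (x - y) powr (- m))) \<partial>lborel) \<partial>lborel)"

lemma energy2_fst:
  assumes [measurable]: "u \<in> borel_measurable borel" "v \<in> borel_measurable borel"
  shows "energy2 m u v = (\<integral>\<^sup>+x. ennreal ((u x)\<^sup>2) * (\<integral>\<^sup>+y. ennreal ((v y)\<^sup>2 * norm (x - y) powr (- m)) \<partial>lborel) \<partial>lborel)"
  unfolding energy2_def
  by (intro nn_integral_cong, subst nn_integral_cmult[symmetric]) (auto simp: ennreal_mult)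

lemma energy2_commute:
  assumes [measurable]: "u \<in> borel_measurable borel" "v \<in> borel_measurable borel"
  shows "energy2 m u v = energy2 m v u"
proof -
  have "energy2 m u v = (\<integral>\<^sup>+y. (\<integral>\<^sup>+x. ennreal ((u x)\<^sup>2 * ((v y)\<^sup>2 * norm (x - y) powr (- m))) \<partial>lborel) \<partial>lborel)"
    unfolding energy2_def by (rule lborel_pair.Fubini') measurable
  then show ?thesis unfolding energy2_def by (simp add: norm_minus_commute mult_ac)
qed

text \<open>For \<open>m \<le> 2\<close> Hardy in \<open>y\<close> is uniform in \<open>x\<close>
  and the remaining factor is an L2 norm. For larger \<open>m\<close> Hardy in \<open>y\<close>
  lowers the exponent to \<open>m - 2\<close> at the price of the gradient of \<psi>; after swapping
  variables the local version applies to \<phi>, and \<open>m < 4\<close> brings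
  \<open>m - 2\<close> into its range.\<close>

lemma energy2_test:
  assumes m: "0 < m" "m < min (real DIM('a::euclidean_space)) 4"
  obtains C where "C > 0" "\<And>\<phi> \<psi> :: 'a \<Rightarrow> real. test_function \<phi> \<Longrightarrow> test_function \<psi> \<Longrightarrow>
    energy2 m \<phi> \<psi> \<le> ennreal (C * (h1sq \<phi> * h1sq \<psi>))"
proof (cases "m \<le> 2")
  case True
  have "m < real DIM('a)" using m(2) by simp
  from hardy_local[OF m(1) True this] obtain C where C: "C > 0" "\<And>\<phi> (y::'a). test_function \<phi> \<Longrightarrow>
    (\<integral>\<^sup>+x. ennreal ((\<phi> x)\<^sup>2 * norm (x - y) powr (- m)) \<partial>lborel) \<le> ennreal (C * h1sq \<phi>)" by blast
  have "energy2 m \<phi> \<psi> \<le> ennreal (C * (h1sq \<phi> * h1sq \<psi>))" if \<phi>: "test_function \<phi>" and \<psi>: "test_function \<psi>" for \<phi> \<psi> :: "'a \<Rightarrow> real"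
  proof -
    have [measurable]: "\<phi> \<in> borel_measurable borel" "\<psi> \<in> borel_measurable borel" using \<phi> \<psi> test_measurable by auto
    have "energy2 m \<phi> \<psi> \<le> (\<integral>\<^sup>+x. ennreal ((\<phi> x)\<^sup>2) * ennreal (C * h1sq \<psi>) \<partial>lborel)"
      unfolding energy2_fst[OF \<open>\<phi> \<in> _\<close> \<open>\<psi> \<in> _\<close>]
    proof (intro nn_integral_mono mult_left_mono)
      show "(\<integral>\<^sup>+y. ennreal ((\<psi> y)\<^sup>2 * norm (x - y) powr (- m)) \<partial>lborel) \<le> ennreal (C * h1sq \<psi>)" for x
        using C(2)[OF \<psi>, of x] by (simp add: norm_minus_commute)
    qed simp
    also have "\<dots> = ennreal ((L2n \<phi>)\<^sup>2) * ennreal (C * h1sq \<psi>)"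
      using nn_L2n[OF test_sqi[OF \<phi>]] by (simp add: nn_integral_multc)
    also have "\<dots> = ennreal ((L2n \<phi>)\<^sup>2 * (C * h1sq \<psi>))"
      using C(1) h1sq_nonneg[of \<psi>] by (simp flip: ennreal_mult)
    also have "\<dots> \<le> ennreal (C * (h1sq \<phi> * h1sq \<psi>))"
    proof (rule ennreal_leI)
      have "(L2n \<phi>)\<^sup>2 * (C * h1sq \<psi>) \<le> h1sq \<phi> * (C * h1sq \<psi>)"
        using C(1) h1sq_nonneg[of \<psi>] by (intro mult_right_mono) (auto simp: h1sq_def)
      then show "(L2n \<phi>)\<^sup>2 * (C * h1sq \<psi>) \<le> C * (h1sq \<phi> * h1sq \<psi>)" by (simp add: mult_ac)
    qed
    finally show ?thesis .
  qed
  with C(1) show ?thesis using that by blast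
next
  case False
  have mm: "m < real DIM('a)" "0 < m - 2" "m - 2 \<le> 2" "m - 2 < real DIM('a)" using m(2) False by auto
  from hardy_local[OF mm(2-4)] obtain C where C: "C > 0" "\<And>\<phi> (y::'a). test_function \<phi> \<Longrightarrow>
    (\<integral>\<^sup>+x. ennreal ((\<phi> x)\<^sup>2 * norm (x - y) powr (- (m - 2))) \<partial>lborel) \<le> ennreal (C * h1sq \<phi>)" by blast
  define H where "H = 4 / (real DIM('a) - m)\<^sup>2"
  have H: "H > 0" using mm(1) by (simp add: H_def)
  have "energy2 m \<phi> \<psi> \<le> ennreal ((H * C) * (h1sq \<phi> * h1sq \<psi>))" if \<phi>: "test_function \<phi>" and \<psi>: "test_function \<psi>" for \<phi> \<psi> :: "'a \<Rightarrow> real"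
  proof -
    have [measurable]: "\<phi> \<in> borel_measurable borel" "\<psi> \<in> borel_measurable borel" "grad \<psi> \<in> borel_measurable borel"
      using \<phi> \<psi> test_measurable test_grad_measurable by auto
    define g where "g y = norm (grad \<psi> y)" for y
    have [measurable]: "g \<in> borel_measurable borel" unfolding g_def by measurable
    have "energy2 m \<phi> \<psi> \<le> (\<integral>\<^sup>+x. ennreal ((\<phi> x)\<^sup>2) * (ennreal H * (\<integral>\<^sup>+y. ennreal ((g y)\<^sup>2 * norm (x - y) powr (- (m - 2))) \<partial>lborel)) \<partial>lborel)"
      unfolding energy2_fst[OF \<open>\<phi> \<in> _\<close> \<open>\<psi> \<in> _\<close>]
    proof (intro nn_integral_mono mult_left_mono)
      show "(\<integral>\<^sup>+y. ennreal ((\<psi> y)\<^sup>2 * norm (x - y) powr (- m)) \<partial>lborel)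
        \<le> ennreal H * (\<integral>\<^sup>+y. ennreal ((g y)\<^sup>2 * norm (x - y) powr (- (m - 2))) \<partial>lborel)" for x
        using hardy[OF \<psi> mm(1), of x] by (simp add: norm_minus_commute H_def g_def)
    qed simp
    also have "\<dots> = ennreal H * energy2 (m - 2) \<phi> g"
      unfolding energy2_fst[OF \<open>\<phi> \<in> _\<close> \<open>g \<in> _\<close>]
      by (subst nn_integral_cmult[symmetric]) (auto simp: mult_ac)
    also have "\<dots> = ennreal H * energy2 (m - 2) g \<phi>" by (subst energy2_commute) auto
    also have "\<dots> \<le> ennreal H * (\<integral>\<^sup>+x. ennreal ((g x)\<^sup>2) * ennreal (C * h1sq \<phi>) \<partial>lborel)"
      unfolding energy2_fst[OF \<open>g \<in> _\<close> \<open>\<phi> \<in> _\<close>]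
    proof (intro nn_integral_mono mult_left_mono)
      show "(\<integral>\<^sup>+y. ennreal ((\<phi> y)\<^sup>2 * norm (x - y) powr (- (m - 2))) \<partial>lborel) \<le> ennreal (C * h1sq \<phi>)" for x
        using C(2)[OF \<phi>, of x] by (simp add: norm_minus_commute)
    qed simp_all
    also have "\<dots> = ennreal H * (ennreal ((L2n (grad \<psi>))\<^sup>2) * ennreal (C * h1sq \<phi>))"
      using nn_L2n[OF test_grad_sqi[OF \<psi>]] by (simp add: nn_integral_multc g_def)
    also have "\<dots> = ennreal (H * ((L2n (grad \<psi>))\<^sup>2 * (C * h1sq \<phi>)))"
      using C(1) H h1sq_nonneg[of \<phi>] by (simp flip: ennreal_mult)
    also have "\<dots> \<le> ennreal ((H * C) * (h1sq \<phi> * h1sq \<psi>))"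
    proof (rule ennreal_leI)
      have "H * ((L2n (grad \<psi>))\<^sup>2 * (C * h1sq \<phi>)) \<le> H * (h1sq \<psi> * (C * h1sq \<phi>))"
        using C(1) H h1sq_nonneg[of \<phi>] by (intro mult_left_mono mult_right_mono) (auto simp: h1sq_def)
      then show "H * ((L2n (grad \<psi>))\<^sup>2 * (C * h1sq \<phi>)) \<le> (H * C) * (h1sq \<phi> * h1sq \<psi>)" by (simp add: mult_ac)
    qed
    finally show ?thesis .
  qed
  moreover have "H * C > 0" using H C(1) by simp
  ultimately show ?thesis using that by blast
qed

lemma nn_weight_fatou:
  fixes f :: "'a::euclidean_space \<Rightarrow> ennreal"
  assumes [measurable]: "\<And>n. U n \<in> borel_measurable borel" "f \<in> borel_measurable borel"
    and lim: "AE x in lborel. (\<lambda>n. U n x) \<longlonglongrightarrow> (u x :: real)"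
    and le: "\<And>n. (\<integral>\<^sup>+x. ennreal ((U n x)\<^sup>2) * f x \<partial>lborel) \<le> ennreal (c n)" and c: "c \<longlonglongrightarrow> d"
  shows "(\<integral>\<^sup>+x. ennreal ((u x)\<^sup>2) * f x \<partial>lborel) \<le> ennreal d"
proof -
  have "(\<integral>\<^sup>+x. ennreal ((u x)\<^sup>2) * f x \<partial>lborel) \<le> (\<integral>\<^sup>+x. liminf (\<lambda>n. ennreal ((U n x)\<^sup>2) * f x) \<partial>lborel)"
  proof (rule nn_integral_mono_AE, use lim in eventually_elim)
    case (elim x)
    have e: "(\<lambda>n. ennreal ((U n x)\<^sup>2)) \<longlonglongrightarrow> ennreal ((u x)\<^sup>2)" by (intro tendsto_ennrealI tendsto_intros elim)
    \<comment> \<open>\<open>f x\<close> may be infinite, and the product limit rule in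
      \<open>ennreal\<close> excludes \<open>0 * \<infinity>\<close>; where \<open>u x = 0\<close>
      the left-hand side vanishes anyway.\<close>
    show ?case
    proof (cases "u x = 0")
      case False
      then have "(\<lambda>n. ennreal ((U n x)\<^sup>2) * f x) \<longlonglongrightarrow> ennreal ((u x)\<^sup>2) * f x"
        by (intro tendsto_mult_ennreal e tendsto_const) auto
      then have "liminf (\<lambda>n. ennreal ((U n x)\<^sup>2) * f x) = ennreal ((u x)\<^sup>2) * f x"
        by (intro lim_imp_Liminf) auto
      then show ?thesis by simp
    qed simp
  qed
  also have "\<dots> \<le> liminf (\<lambda>n. \<integral>\<^sup>+x. ennreal ((U n x)\<^sup>2) * f x \<partial>lborel)"
    by (rule nn_integral_liminf) measurable
  also have "\<dots> \<le> liminf (\<lambda>n. ennreal (c n))" by (rule Liminf_mono) (use le in auto)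
  also have "\<dots> = ennreal d" by (intro lim_imp_Liminf tendsto_ennrealI c) auto
  finally show ?thesis .
qed

section \<open>Kernel bounds on W by approximation with test functions\<close>

context potential
begin

lemma h1sq_le_W:
  assumes \<phi>: "test_function \<phi>"
  shows "h1sq \<phi> \<le> (1 / aV + 1) * (W_norm V \<phi>)\<^sup>2"
proof -
  note tw = test_W[OF \<phi>]
  have "(L2n (grad \<phi>))\<^sup>2 \<le> (W_norm V \<phi>)\<^sup>2" using test_grad_le_W[OF \<phi>] by (intro power_mono) auto
  moreover have "(L2n \<phi>)\<^sup>2 \<le> (W_norm V \<phi> / sqrt aV)\<^sup>2" by (intro power_mono L2_le_W tw) auto
  ultimately show ?thesis using aV_pos by (simp add: h1sq_def power_divide algebra_simps)
qed

lemma W_approx: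
  assumes u: "u \<in> W_space V"
  obtains \<phi> where "\<And>n::nat. test_function (\<phi> n)" "(\<lambda>n. W_norm V (\<lambda>x. \<phi> n x - u x)) \<longlonglongrightarrow> 0"
proof -
  have "\<exists>\<phi>. test_function \<phi> \<and> W_norm V (\<lambda>x. u x - \<phi> x) < inverse (real (Suc n))" for n
    by (rule W_density[OF u, of "inverse (real (Suc n))"]) auto
  then obtain \<phi> where \<phi>: "\<And>n. test_function (\<phi> n)" "\<And>n. W_norm V (\<lambda>x. u x - \<phi> n x) < inverse (real (Suc n))"
    by metis
  have "W_norm V (\<lambda>x. \<phi> n x - u x) = W_norm V (\<lambda>x. u x - \<phi> n x)" for n
    unfolding W_diff(3)[OF u test_W(1)[OF \<phi>(1)]] W_diff(3)[OF test_W(1)[OF \<phi>(1)] u] by (rule L2n_minus_commute)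
  then have le: "norm (W_norm V (\<lambda>x. \<phi> n x - u x)) \<le> inverse (real (Suc n))" for n
    using \<phi>(2)[of n] W_norm_nonneg[of "\<lambda>x. \<phi> n x - u x"] by simp
  have "(\<lambda>n. W_norm V (\<lambda>x. \<phi> n x - u x)) \<longlonglongrightarrow> 0"
    by (rule Lim_null_comparison[OF always_eventually LIMSEQ_inverse_real_of_nat]) (use le in blast)
  with \<phi>(1) show ?thesis using that by blast
qed

lemma W_conv:
  assumes u: "\<And>n. U n \<in> W_space V" "u \<in> W_space V" and c: "(\<lambda>n. W_norm V (\<lambda>x. U n x - u x)) \<longlonglongrightarrow> 0"
  shows "(\<lambda>n. L2n (\<lambda>x. F (U n) x - F u x)) \<longlonglongrightarrow> 0" "(\<lambda>n. L2n (\<lambda>x. U n x - u x)) \<longlonglongrightarrow> 0"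
    "(\<lambda>n. W_norm V (U n)) \<longlonglongrightarrow> W_norm V u"
proof -
  show f: "(\<lambda>n. L2n (\<lambda>x. F (U n) x - F u x)) \<longlonglongrightarrow> 0" using c unfolding W_diff(3)[OF u] .
  show "(\<lambda>n. L2n (\<lambda>x. U n x - u x)) \<longlonglongrightarrow> 0"
  proof (rule Lim_null_comparison[OF always_eventually])
    show "(\<lambda>n. W_norm V (\<lambda>x. U n x - u x) / sqrt aV) \<longlonglongrightarrow> 0" using tendsto_divide_zero[OF c] .
    show "\<forall>n. norm (L2n (\<lambda>x. U n x - u x)) \<le> W_norm V (\<lambda>x. U n x - u x) / sqrt aV"
      using L2_le_W[OF W_diff(1)[OF u]] by simp
  qed
  show "(\<lambda>n. W_norm V (U n)) \<longlonglongrightarrow> W_norm V u"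
    unfolding W_norm_eq by (rule L2n_tendsto[OF W_D(5)[OF u(1)] W_D(5)[OF u(2)] f])
qed

lemma W_test_seq:
  assumes u: "u \<in> W_space V"
  obtains \<phi> where "\<And>n::nat. test_function (\<phi> n)" "(\<lambda>n. W_norm V (\<phi> n)) \<longlonglongrightarrow> W_norm V u"
    "AE x in lborel. (\<lambda>n. \<phi> n x) \<longlonglongrightarrow> u x"
proof -
  obtain \<phi> where \<phi>: "\<And>n::nat. test_function (\<phi> n)" "(\<lambda>n. W_norm V (\<lambda>x. \<phi> n x - u x)) \<longlonglongrightarrow> 0"
    by (rule W_approx[OF u]) blast
  note c = W_conv[OF test_W(1)[OF \<phi>(1)] u \<phi>(2)]
  from L2_AE_subseq[OF test_sqi[OF \<phi>(1)] W_D(2)[OF u] c(2)]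
  obtain r :: "nat \<Rightarrow> nat" where r: "strict_mono r" "AE x in lborel. (\<lambda>n. \<phi> (r n) x) \<longlonglongrightarrow> u x" by blast
  have "(\<lambda>n. W_norm V (\<phi> (r n))) \<longlonglongrightarrow> W_norm V u"
    using LIMSEQ_subseq_LIMSEQ[OF c(3) r(1)] by (simp add: o_def)
  then show ?thesis using that[of "\<lambda>n. \<phi> (r n)"] \<phi>(1) r(2) by blast
qed

text \<open>Test functions are replaced one variable at a time: an approximating sequence with
  convergent norms and convergent values almost everywhere, then Fatou. The symmetry of
  \<open>energy2\<close> reduces the second variable to the first.\<close>

theorem energy2_W:
  assumes m: "0 < m" "m < min (real DIM('a)) 4"
  obtains C where "C > 0" "\<And>u v. u \<in> W_space V \<Longrightarrow> v \<in> W_space V \<Longrightarrow>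
    energy2 m u v \<le> ennreal (C * ((W_norm V u)\<^sup>2 * (W_norm V v)\<^sup>2))"
proof -
  from energy2_test[OF m] obtain C0 where C0: "C0 > 0" "\<And>\<phi> \<psi> :: 'a \<Rightarrow> real. test_function \<phi> \<Longrightarrow> test_function \<psi> \<Longrightarrow>
    energy2 m \<phi> \<psi> \<le> ennreal (C0 * (h1sq \<phi> * h1sq \<psi>))" by blast
  define A where "A = 1 / aV + 1"
  have A: "A > 0" using aV_pos by (simp add: A_def add_pos_pos)
  define C where "C = C0 * A\<^sup>2"
  have C: "C > 0" using C0(1) A by (simp add: C_def)
  have tt: "energy2 m \<phi> \<psi> \<le> ennreal (C * ((W_norm V \<phi>)\<^sup>2 * (W_norm V \<psi>)\<^sup>2))"
    if "test_function \<phi>" "test_function \<psi>" for \<phi> \<psi> :: "'a \<Rightarrow> real"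
  proof -
    have "h1sq \<phi> * h1sq \<psi> \<le> (A * (W_norm V \<phi>)\<^sup>2) * (A * (W_norm V \<psi>)\<^sup>2)"
      unfolding A_def using aV_pos by (intro mult_mono h1sq_le_W that h1sq_nonneg mult_nonneg_nonneg) auto
    then have "C0 * (h1sq \<phi> * h1sq \<psi>) \<le> C0 * ((A * (W_norm V \<phi>)\<^sup>2) * (A * (W_norm V \<psi>)\<^sup>2))"
      using C0(1) by (intro mult_left_mono) auto
    also have "\<dots> = C * ((W_norm V \<phi>)\<^sup>2 * (W_norm V \<psi>)\<^sup>2)" by (simp add: C_def power2_eq_square mult_ac)
    finally show ?thesis using C0(2)[OF that] by (meson ennreal_leI order_trans)
  qed
  have tw: "energy2 m v \<phi> \<le> ennreal (C * ((W_norm V v)\<^sup>2 * (W_norm V \<phi>)\<^sup>2))"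
    if \<phi>: "test_function \<phi>" and v: "v \<in> W_space V" for \<phi> v
  proof -
    obtain p where p: "\<And>n::nat. test_function (p n)" "(\<lambda>n. W_norm V (p n)) \<longlonglongrightarrow> W_norm V v"
      "AE x in lborel. (\<lambda>n. p n x) \<longlonglongrightarrow> v x" by (rule W_test_seq[OF v]) blast
    have [measurable]: "\<phi> \<in> borel_measurable borel" "v \<in> borel_measurable borel" "\<And>n. p n \<in> borel_measurable borel"
      using \<phi> p(1) test_measurable W_D(6)[OF v] by auto
    show ?thesis unfolding energy2_fst[OF W_D(6)[OF v] test_measurable[OF \<phi>]]
    proof (rule nn_weight_fatou[where U = p and c = "\<lambda>n. C * ((W_norm V (p n))\<^sup>2 * (W_norm V \<phi>)\<^sup>2)"])
      show "(\<lambda>n. C * ((W_norm V (p n))\<^sup>2 * (W_norm V \<phi>)\<^sup>2)) \<longlonglongrightarrow> C * ((W_norm V v)\<^sup>2 * (W_norm V \<phi>)\<^sup>2)"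
        by (intro tendsto_intros p(2))
      show "(\<integral>\<^sup>+x. ennreal ((p n x)\<^sup>2) * (\<integral>\<^sup>+y. ennreal ((\<phi> y)\<^sup>2 * norm (x - y) powr (- m)) \<partial>lborel) \<partial>lborel)
        \<le> ennreal (C * ((W_norm V (p n))\<^sup>2 * (W_norm V \<phi>)\<^sup>2))" for n
        using tt[OF p(1)[of n] \<phi>] unfolding energy2_fst[OF test_measurable[OF p(1)] test_measurable[OF \<phi>]] .
    qed (use p(3) in measurable)
  qed
  have "energy2 m u v \<le> ennreal (C * ((W_norm V u)\<^sup>2 * (W_norm V v)\<^sup>2))"
    if u: "u \<in> W_space V" and v: "v \<in> W_space V" for u v
  proof -
    obtain p where p: "\<And>n::nat. test_function (p n)" "(\<lambda>n. W_norm V (p n)) \<longlonglongrightarrow> W_norm V u"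
      "AE x in lborel. (\<lambda>n. p n x) \<longlonglongrightarrow> u x" by (rule W_test_seq[OF u]) blast
    have [measurable]: "u \<in> borel_measurable borel" "v \<in> borel_measurable borel" "\<And>n. p n \<in> borel_measurable borel"
      using p(1) test_measurable W_D(6)[OF v] W_D(6)[OF u] by auto
    show ?thesis unfolding energy2_fst[OF W_D(6)[OF u] W_D(6)[OF v]]
    proof (rule nn_weight_fatou[where U = p and c = "\<lambda>n. C * ((W_norm V (p n))\<^sup>2 * (W_norm V v)\<^sup>2)"])
      show "(\<lambda>n. C * ((W_norm V (p n))\<^sup>2 * (W_norm V v)\<^sup>2)) \<longlonglongrightarrow> C * ((W_norm V u)\<^sup>2 * (W_norm V v)\<^sup>2)"
        by (intro tendsto_intros p(2))
      show "(\<integral>\<^sup>+x. ennreal ((p n x)\<^sup>2) * (\<integral>\<^sup>+y. ennreal ((v y)\<^sup>2 * norm (x - y) powr (- m)) \<partial>lborel) \<partial>lborel)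
        \<le> ennreal (C * ((W_norm V (p n))\<^sup>2 * (W_norm V v)\<^sup>2))" for n
        using tw[OF p(1)[of n] v]
        unfolding energy2_commute[OF W_D(6)[OF v] test_measurable[OF p(1)]] energy2_fst[OF test_measurable[OF p(1)] W_D(6)[OF v]]
        by (simp only: mult.commute[of "(W_norm V v)\<^sup>2"])
    qed (use p(3) in measurable)
  qed
  with C show ?thesis using that by blast
qed

end

text \<open>The factor \<open>\<bar>x - y\<bar> powr (- m / 2)\<close> turns the norm of \<open>L2_mu m\<close> into the plain \<open>L\<^sup>2\<close> norm.\<close>

definition tens :: "real \<Rightarrow> ('a::euclidean_space \<Rightarrow> real) \<Rightarrow> ('a \<Rightarrow> real) \<Rightarrow> 'a \<times> 'a \<Rightarrow> real" where
  "tens m u v p = u (fst p) * v (snd p) / norm (fst p - snd p) powr (m / 2)"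

lemma fst_snd_measurable [measurable]:
  "fst \<in> borel_measurable (borel :: ('a::euclidean_space \<times> 'b::euclidean_space) measure)"
  "snd \<in> borel_measurable (borel :: ('a::euclidean_space \<times> 'b::euclidean_space) measure)"
  by (intro borel_measurable_continuous_onI continuous_intros)+

lemma tens_measurable:
  assumes [measurable]: "u \<in> borel_measurable borel" "v \<in> borel_measurable borel"
  shows "tens m u v \<in> borel_measurable borel"
  unfolding tens_def[abs_def] by measurable

lemma powr_half_sq: "(x powr (m / 2))\<^sup>2 = x powr m" for x :: real
  by (simp add: power2_eq_square flip: powr_add)

lemma nn_integral_tens:
  assumes [measurable]: "u \<in> borel_measurable borel" "v \<in> borel_measurable borel"
  shows "(\<integral>\<^sup>+p. ennreal ((norm (tens m u v p))\<^sup>2) \<partial>lborel) = energy2 m u v"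
proof -
  have [measurable]: "tens m u v \<in> borel_measurable borel" by (rule tens_measurable) fact+
  have "(\<integral>\<^sup>+p. ennreal ((norm (tens m u v p))\<^sup>2) \<partial>lborel)
    = (\<integral>\<^sup>+p. ennreal ((norm (tens m u v p))\<^sup>2) \<partial>(lborel \<Otimes>\<^sub>M lborel))" by (simp add: lborel_prod)
  also have "\<dots> = (\<integral>\<^sup>+x. (\<integral>\<^sup>+y. ennreal ((norm (tens m u v (x, y)))\<^sup>2) \<partial>lborel) \<partial>lborel)"
    by (rule lborel.nn_integral_fst[symmetric]) (simp add: lborel_prod)
  also have "\<dots> = energy2 m u v"
    unfolding energy2_def
    by (intro nn_integral_cong) (simp add: tens_def power_mult_distrib power_divide powr_half_sq powr_minus field_simps)
  finally show ?thesis .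
qed

locale exchange_setting = potential V aV for V :: "'a::euclidean_space \<Rightarrow> real" and aV +
  fixes \<mu> :: real
  assumes mu: "0 < \<mu>" "\<mu> < min (real DIM('a)) 4"
begin

lemma tens_bound:
  obtains C where "C > 0" "\<And>u v. u \<in> W_space V \<Longrightarrow> v \<in> W_space V \<Longrightarrow> square_integrable (tens \<mu> u v)"
    "\<And>u v. u \<in> W_space V \<Longrightarrow> v \<in> W_space V \<Longrightarrow> L2n (tens \<mu> u v) \<le> C * (W_norm V u * W_norm V v)"
proof -
  from energy2_W[OF mu] obtain C where C: "C > 0" "\<And>u v. u \<in> W_space V \<Longrightarrow> v \<in> W_space V \<Longrightarrow>
    energy2 \<mu> u v \<le> ennreal (C * ((W_norm V u)\<^sup>2 * (W_norm V v)\<^sup>2))" by blast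
  have *: "square_integrable (tens \<mu> u v) \<and> L2n (tens \<mu> u v) \<le> sqrt C * (W_norm V u * W_norm V v)"
    if "u \<in> W_space V" "v \<in> W_space V" for u v
  proof -
    note m = W_D(6)[OF that(1)] W_D(6)[OF that(2)]
    have le: "(\<integral>\<^sup>+p. ennreal ((norm (tens \<mu> u v p))\<^sup>2) \<partial>lborel) \<le> ennreal ((sqrt C * (W_norm V u * W_norm V v))\<^sup>2)"
      using C(2)[OF that] C(1) unfolding nn_integral_tens[OF m] by (simp add: power_mult_distrib)
    have "(L2n (tens \<mu> u v))\<^sup>2 \<le> (sqrt C * (W_norm V u * W_norm V v))\<^sup>2"
      by (rule sqi_nn(2)[OF tens_measurable[OF m] le]) simp
    moreover have "0 \<le> sqrt C * (W_norm V u * W_norm V v)" using C(1) W_norm_nonneg by simp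
    ultimately show ?thesis using sqi_nn(1)[OF tens_measurable[OF m] le] power2_le_imp_le by auto
  qed
  show ?thesis by (rule that[of "sqrt C"]) (use C(1) * in auto)
qed

lemma tens_sqi: "u \<in> W_space V \<Longrightarrow> v \<in> W_space V \<Longrightarrow> square_integrable (tens \<mu> u v)"
  by (rule tens_bound) blast

text \<open>Splitting \<open>\<bar>x - y\<bar> powr - \<mu>\<close> at distance \<open>r\<close> and using a slightly larger exponent near the diagonal.\<close>

lemma tens_interpolation:
  assumes d: "d > 0"
  obtains K where "K > 0" "\<And>u v. u \<in> W_space V \<Longrightarrow> v \<in> W_space V \<Longrightarrow>
    (L2n (tens \<mu> u v))\<^sup>2 \<le> d * ((W_norm V u)\<^sup>2 * (W_norm V v)\<^sup>2) + K * ((L2n u)\<^sup>2 * (L2n v)\<^sup>2)"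
proof -
  \<comment> \<open>The midpoint between \<mu> and the threshold: the kernel bound still holds for
    it, and the strict gain \<open>m - \<mu>\<close> is what makes the coefficient near the diagonal
    small.\<close>
  define m where "m = (\<mu> + min (real DIM('a)) 4) / 2"
  have m: "0 < m" "m < min (real DIM('a)) 4" "\<mu> < m" using mu by (auto simp: m_def)
  from energy2_W[OF m(1,2)] obtain C where C: "C > 0" "\<And>u v. u \<in> W_space V \<Longrightarrow> v \<in> W_space V \<Longrightarrow>
    energy2 m u v \<le> ennreal (C * ((W_norm V u)\<^sup>2 * (W_norm V v)\<^sup>2))" by blast
  \<comment> \<open>Chosen so that \<open>r powr (m - \<mu>)\<close> equals \<open>d / C\<close>,
    whose denominator cancels the constant of the bound for exponent \<open>m\<close>.\<close>
  define r where "r = (d / C) powr (1 / (m - \<mu>))"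
  have r: "r > 0" using d C(1) by (simp add: r_def)
  have rd: "r powr (m - \<mu>) = d / C" using d C(1) m(3) by (simp add: r_def powr_powr)
  define K where "K = r powr (- \<mu>)"
  have K: "K > 0" using r by (simp add: K_def)
  have ker: "t powr (- \<mu>) \<le> (d / C) * t powr (- m) + K" if "t \<ge> 0" for t
  proof (cases "t \<le> r")
    case True
    show ?thesis
    proof (cases "t = 0")
      case False
      have "t powr (- \<mu>) = t powr (m - \<mu>) * t powr (- m)" by (simp flip: powr_add)
      also have "\<dots> \<le> r powr (m - \<mu>) * t powr (- m)"
        using True that m(3) by (intro mult_right_mono powr_mono2) auto
      finally show ?thesis using K rd by simp
    qed (use K in simp)
  next
    case False
    then have "t powr (- \<mu>) \<le> K" unfolding K_def using r mu(1) by (intro powr_mono2') auto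
    moreover have "0 \<le> (d / C) * t powr (- m)" using d C(1) by simp
    ultimately show ?thesis by linarith
  qed
  have "(L2n (tens \<mu> u v))\<^sup>2 \<le> d * ((W_norm V u)\<^sup>2 * (W_norm V v)\<^sup>2) + K * ((L2n u)\<^sup>2 * (L2n v)\<^sup>2)"
    if u: "u \<in> W_space V" and v: "v \<in> W_space V" for u v
  proof -
    note meas[measurable] = W_D(6)[OF u] W_D(6)[OF v]
    have "energy2 \<mu> u v \<le> (\<integral>\<^sup>+x. (\<integral>\<^sup>+y. ennreal (d / C) * ennreal ((u x)\<^sup>2 * ((v y)\<^sup>2 * norm (x - y) powr (- m)))
        + ennreal K * (ennreal ((u x)\<^sup>2) * ennreal ((v y)\<^sup>2)) \<partial>lborel) \<partial>lborel)"
      unfolding energy2_def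
    proof (intro nn_integral_mono)
      fix x y
      have "(u x)\<^sup>2 * ((v y)\<^sup>2 * norm (x - y) powr (- \<mu>)) \<le> (u x)\<^sup>2 * ((v y)\<^sup>2 * ((d / C) * norm (x - y) powr (- m) + K))"
        by (intro mult_left_mono ker) auto
      also have "\<dots> = (d / C) * ((u x)\<^sup>2 * ((v y)\<^sup>2 * norm (x - y) powr (- m))) + K * ((u x)\<^sup>2 * (v y)\<^sup>2)"
        by (simp add: algebra_simps)
      finally show "ennreal ((u x)\<^sup>2 * ((v y)\<^sup>2 * norm (x - y) powr (- \<mu>))) \<le> ennreal (d / C) * ennreal ((u x)\<^sup>2 * ((v y)\<^sup>2 * norm (x - y) powr (- m)))
        + ennreal K * (ennreal ((u x)\<^sup>2) * ennreal ((v y)\<^sup>2))"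
        using d C(1) K by (simp add: ennreal_leI flip: ennreal_mult ennreal_plus)
    qed
    also have "\<dots> = ennreal (d / C) * energy2 m u v + ennreal K * ((\<integral>\<^sup>+x. ennreal ((u x)\<^sup>2) \<partial>lborel) * (\<integral>\<^sup>+y. ennreal ((v y)\<^sup>2) \<partial>lborel))"
      unfolding energy2_def by (simp add: nn_integral_add nn_integral_cmult nn_integral_multc)
    also have "\<dots> \<le> ennreal (d / C) * ennreal (C * ((W_norm V u)\<^sup>2 * (W_norm V v)\<^sup>2)) + ennreal K * (ennreal ((L2n u)\<^sup>2) * ennreal ((L2n v)\<^sup>2))"
      using nn_L2n[OF W_D(2)[OF u]] nn_L2n[OF W_D(2)[OF v]] C(2)[OF u v]
      by (simp add: mult_left_mono add_mono)
    also have "\<dots> = ennreal (d / C * (C * ((W_norm V u)\<^sup>2 * (W_norm V v)\<^sup>2)) + K * ((L2n u)\<^sup>2 * (L2n v)\<^sup>2))"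
      using d C(1) K by (simp flip: ennreal_mult ennreal_plus)
    also have "d / C * (C * ((W_norm V u)\<^sup>2 * (W_norm V v)\<^sup>2)) = d * ((W_norm V u)\<^sup>2 * (W_norm V v)\<^sup>2)"
      using C(1) by simp
    finally show ?thesis unfolding nn_integral_tens[OF meas, symmetric]
      by (rule sqi_nn(2)[OF tens_measurable[OF meas]]) (use d K in simp)
  qed
  with K show ?thesis using that by blast
qed

end

section \<open>Principal solutions\<close>

text \<open>The zero set of a continuous function is closed, and a closed set of full measure is
  everything.\<close>

lemma test_L2n_pos:
  assumes \<psi>: "test_function (\<psi> :: 'a::euclidean_space \<Rightarrow> real)" and "\<psi> \<noteq> (\<lambda>_. 0)"
  shows "L2n \<psi> > 0"
proof (rule ccontr)
  assume "\<not> L2n \<psi> > 0"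
  then have "L2n \<psi> = 0" using L2n_nonneg[of \<psi>] by linarith
  then have "AE x in lborel. \<psi> x = 0" using L2n_eq_0_iff[OF test_sqi[OF \<psi>]] by simp
  then have "AE x in lebesgue. x \<in> {x. \<psi> x = 0}" by (simp add: AE_completion)
  moreover have "closed {x. \<psi> x = 0}"
    by (intro closed_Collect_eq test_continuous \<psi> continuous_intros)
  ultimately have "x \<in> {x. \<psi> x = 0}" for x by (intro mem_closed_if_AE_lebesgue)
  then show False using assms(2) by auto
qed

text \<open>A point where \<open>u\<close> is nonzero shows that \<open>u\<close> is almost
  everywhere a constant multiple of \<open>v\<close>; comparing the products once more forces the
  square of the constant to be 1.\<close>

lemma tensor_square_eq_AE:
  fixes u v :: "'a::euclidean_space \<Rightarrow> real"
  assumes [measurable]: "u \<in> borel_measurable borel" "v \<in> borel_measurable borel"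
    and eq: "AE p in lborel. tens m u u p = tens m v v p"
  shows "(AE x in lborel. u x = v x) \<or> (AE x in lborel. u x = - v x)"
proof -
  have "AE p in lborel \<Otimes>\<^sub>M lborel. tens m u u p = tens m v v p" unfolding lborel_prod by (rule eq)
  then have "AE x in lborel. AE y in lborel. tens m u u (x, y) = tens m v v (x, y)"
    by (rule lborel_pair.AE_pair)
  then have uv: "AE x in lborel. AE y in lborel. u x * u y = v x * v y"
  proof eventually_elim
    case (elim x)
    \<comment> \<open>Off the diagonal the weight is nonzero and cancels; on it \<open>tens\<close>
      is 0 by convention.\<close>
    have "AE y in lborel. y \<noteq> x" by (rule AE_lborel_singleton)
    with elim show ?case
    proof eventually_elim
      case (elim y)
      then show ?case by (simp add: tens_def)
    qed
  qed
  \<comment> \<open>Replaces measure theory by a choice of points: a property holding almost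
    everywhere meets any function that is not almost everywhere zero at a point where the latter is
    nonzero.\<close>
  have pick: "\<exists>x. P x \<and> f x \<noteq> 0" if "AE x in lborel. P x" "\<not> (AE x in lborel. f x = 0)" for P and f :: "'a \<Rightarrow> real"
  proof (rule ccontr)
    assume "\<nexists>x. P x \<and> f x \<noteq> 0"
    then have "AE x in lborel. f x = 0" using that(1) by (auto elim: eventually_mono)
    then show False using that(2) by simp
  qed
  show ?thesis
  proof (cases "AE x in lborel. u x = 0")
    case True
    have "AE x in lborel. v x = 0"
    proof (rule ccontr)
      assume nv: "\<not> (AE x in lborel. v x = 0)"
      have "AE x in lborel. (AE y in lborel. u x * u y = v x * v y) \<and> u x = 0" using uv True by eventually_elim simp
      from pick[OF this nv] obtain x where x: "AE y in lborel. u x * u y = v x * v y" "u x = 0" "v x \<noteq> 0" by blast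
      from x(1) have "AE y in lborel. v y = 0" by eventually_elim (use x in simp)
      then show False using nv by simp
    qed
    with True have "AE x in lborel. u x = v x" by eventually_elim simp
    then show ?thesis by simp
  next
    case False
    from pick[OF uv False] obtain x where x: "AE y in lborel. u x * u y = v x * v y" "u x \<noteq> 0" by blast
    define c where "c = v x / u x"
    have uc: "AE y in lborel. u y = c * v y" using x(1)
    proof eventually_elim
      case (elim y)
      then show ?case using x(2) by (simp add: c_def field_simps)
    qed
    have nv: "\<not> (AE x in lborel. v x = 0)"
    proof
      assume "AE x in lborel. v x = 0"
      with uc have "AE y in lborel. u y = 0" by eventually_elim simp
      then show False using False by simp
    qed
    have "AE x in lborel. (AE y in lborel. u x * u y = v x * v y) \<and> u x = c * v x" using uv uc by eventually_elim simp
    from pick[OF this nv] obtain z where z: "AE y in lborel. u z * u y = v z * v y" "u z = c * v z" "v z \<noteq> 0" by blast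
    have "AE y in lborel. u z * u y = v z * v y \<and> u y = c * v y" using z(1) uc by eventually_elim simp
    from pick[OF this nv] obtain y where y: "u z * u y = v z * v y" "u y = c * v y" "v y \<noteq> 0" by blast
    have "c * c * (v z * v y) = 1 * (v z * v y)" using y(1) unfolding z(2) y(2) by (simp add: mult_ac)
    then have "c * c = 1" using mult_right_cancel[of "v z * v y" "c * c" 1] z(3) y(3) by (metis mult_eq_0_iff)
    then have "c = 1 \<or> c = - 1" by (simp add: square_eq_1_iff)
    then show ?thesis
    proof
      assume "c = 1"
      then show ?thesis using uc by simp
    next
      assume "c = - 1"
      then have "AE x in lborel. u x = - v x" using uc by simp
      then show ?thesis ..
    qed
  qed
qed

lemma tens_diff_left: "tens m (\<lambda>x. u x - v x) w p = tens m u w p - tens m v w p"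
  by (simp add: tens_def left_diff_distrib diff_divide_distrib)

lemma tens_diff_right: "tens m w (\<lambda>x. u x - v x) p = tens m w u p - tens m w v p"
  by (simp add: tens_def right_diff_distrib diff_divide_distrib)

lemma tens_scale_right: "tens m w (\<lambda>x. c * u x) p = c * tens m w u p"
  by (simp add: tens_def)

definition kern :: "real \<Rightarrow> ('a::euclidean_space \<Rightarrow> 'a \<Rightarrow> real) \<Rightarrow> 'a \<times> 'a \<Rightarrow> real" where
  "kern m \<rho> p = \<rho> (fst p) (snd p) / norm (fst p - snd p) powr (m / 2)"

lemma kern_tensor: "kern m (\<lambda>x y. u x * v y) = tens m u v"
  by (simp add: kern_def tens_def fun_eq_iff)

lemma kern_diff: "kern m (\<lambda>x y. \<rho> x y - \<sigma> x y) p = kern m \<rho> p - kern m \<sigma> p"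
  by (simp add: kern_def diff_divide_distrib)

lemma kern_sq: "(kern m \<rho> (x, y))\<^sup>2 = (\<rho> x y)\<^sup>2 / norm (x - y) powr m"
  by (simp add: kern_def power_divide powr_half_sq)

lemma kern_mult_tens: "kern m \<rho> (x, y) * tens m u v (x, y) = \<rho> x y * u x * v y / norm (x - y) powr m"
proof -
  have "norm (x - y) powr (m / 2) * norm (x - y) powr (m / 2) = norm (x - y) powr m"
    by (simp flip: powr_add)
  then show ?thesis by (simp add: kern_def tens_def mult.assoc)
qed

lemma L2_mu_kern:
  assumes "\<rho> \<in> L2_mu m"
  shows "square_integrable (kern m \<rho>)"
proof -
  have [measurable]: "(\<lambda>(x, y). \<rho> x y) \<in> borel_measurable borel" using assms by (simp add: L2_mu_def)
  have [measurable]: "(\<lambda>p. \<rho> (fst p) (snd p)) \<in> borel_measurable borel"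
    using \<open>(\<lambda>(x, y). \<rho> x y) \<in> _\<close> by (simp add: case_prod_beta')
  have "kern m \<rho> \<in> borel_measurable borel" unfolding kern_def[abs_def] by measurable
  moreover have "(\<lambda>p. (kern m \<rho> p)\<^sup>2) = (\<lambda>(x, y). (\<rho> x y)\<^sup>2 / norm (x - y) powr m)"
    by (auto simp: kern_sq)
  then have "integrable lborel (\<lambda>p. (kern m \<rho> p)\<^sup>2)"
    using assms by (simp add: L2_mu_def)
  ultimately show ?thesis by (simp add: sqi_real_iff)
qed

lemma L2_mu_norm_diff: "L2_mu_norm m (\<lambda>x y. \<rho> x y - \<sigma> x y) = L2n (\<lambda>p. kern m \<rho> p - kern m \<sigma> p)"
proof -
  have "(case p of (x, y) \<Rightarrow> (\<rho> x y - \<sigma> x y)\<^sup>2 / norm (x - y) powr m) = (norm (kern m \<rho> p - kern m \<sigma> p))\<^sup>2" for p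
    unfolding kern_diff[symmetric] by (cases p) (simp add: kern_sq)
  then show ?thesis by (simp add: L2_mu_norm_def L2n_def)
qed

section \<open>Weak formulations as L2 pairings, and their extension from test functions to
  W\<close>

context exchange_setting
begin

text \<open>The weak form of the operator whose kernel, divided by the square root of
  \<open>norm (x - y) powr \<mu>\<close>, is \<open>g\<close>. Written with L2 pairings it is
  visibly continuous in \<open>g\<close>, \<open>u\<close> and \<phi>.\<close>

definition bil :: "('a \<times> 'a \<Rightarrow> real) \<Rightarrow> ('a \<Rightarrow> real) \<Rightarrow> ('a \<Rightarrow> real) \<Rightarrow> real" where
  "bil g u \<phi> = L2ip (F u) (F \<phi>) - L2ip g (tens \<mu> \<phi> u)"

definition qf :: "('a \<times> 'a \<Rightarrow> real) \<Rightarrow> ('a \<Rightarrow> real) \<Rightarrow> real" where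
  "qf g \<psi> = (W_norm V \<psi>)\<^sup>2 - L2ip g (tens \<mu> \<psi> \<psi>)"

lemma qf_eq_bil: "qf g \<psi> = bil g \<psi> \<psi>"
  by (simp add: qf_def bil_def L2ip_self W_norm_eq)

lemma F_inner: "F u x \<bullet> F v x = weak_grad u x \<bullet> weak_grad v x + V x * u x * v x"
proof -
  have "sqrt (V x) * sqrt (V x) = V x" using V_pos[of x] by simp
  then show ?thesis by (simp add: wpair_def algebra_simps)
qed

lemma quad_form_eq:
  shows "quad_form V \<mu> \<rho> \<psi> = qf (kern \<mu> \<rho>) \<psi>"
proof -
  have "(LINT x|lborel. (norm (weak_grad \<psi> x))\<^sup>2 + V x * (\<psi> x)\<^sup>2) = (W_norm V \<psi>)\<^sup>2"
    unfolding W_norm_eq L2n_sq norm_wpair ..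
  moreover have "(case p of (x, y) \<Rightarrow> \<rho> x y * \<psi> x * \<psi> y / norm (x - y) powr \<mu>) = kern \<mu> \<rho> p * tens \<mu> \<psi> \<psi> p" for p
    by (cases p) (simp add: kern_mult_tens)
  ultimately show ?thesis by (simp add: quad_form_def qf_def L2ip_def)
qed

text \<open>Fubini, with integrability from the product of two square integrable functions: the
  singular weight is shared equally between the kernel and the tensor product.\<close>

lemma exchange_integral:
  assumes k: "square_integrable (kern \<mu> \<rho>)" and u: "u \<in> W_space V" and \<phi>: "\<phi> \<in> W_space V"
  shows "integrable lborel (\<lambda>x. exchange \<mu> \<rho> u x * \<phi> x)"
    "(LINT x|lborel. exchange \<mu> \<rho> u x * \<phi> x) = L2ip (kern \<mu> \<rho>) (tens \<mu> \<phi> u)"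
proof -
  let ?f = "\<lambda>p. kern \<mu> \<rho> p * tens \<mu> \<phi> u p"
  have i: "integrable (lborel \<Otimes>\<^sub>M lborel) ?f"
    unfolding lborel_prod by (rule sqi_mult_integrable[OF k tens_sqi[OF \<phi> u]])
  have e: "(LINT y|lborel. ?f (x, y)) = exchange \<mu> \<rho> u x * \<phi> x" for x
  proof -
    have "(LINT y|lborel. ?f (x, y)) = (LINT y|lborel. (\<rho> x y * u y / norm (x - y) powr \<mu>) * \<phi> x)"
      by (rule Bochner_Integration.integral_cong) (simp_all add: kern_mult_tens)
    also have "\<dots> = exchange \<mu> \<rho> u x * \<phi> x" unfolding exchange_def by (rule integral_mult_left_zero)
    finally show ?thesis .
  qed
  show "integrable lborel (\<lambda>x. exchange \<mu> \<rho> u x * \<phi> x)"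
    using lborel_pair.integrable_fst'[OF i] unfolding e .
  have "L2ip (kern \<mu> \<rho>) (tens \<mu> \<phi> u) = integral\<^sup>L (lborel \<Otimes>\<^sub>M lborel) ?f"
    by (simp add: L2ip_def lborel_prod)
  also have "\<dots> = (LINT x|lborel. exchange \<mu> \<rho> u x * \<phi> x)"
    using lborel_pair.integral_fst'[OF i] unfolding e by simp
  finally show "(LINT x|lborel. exchange \<mu> \<rho> u x * \<phi> x) = L2ip (kern \<mu> \<rho>) (tens \<mu> \<phi> u)" by simp
qed

lemma eigen_integral:
  assumes k: "square_integrable (kern \<mu> \<rho>)" and u: "u \<in> W_space V" and \<phi>: "\<phi> \<in> W_space V"
  shows "(LINT x|lborel. weak_grad u x \<bullet> weak_grad \<phi> x + V x * u x * \<phi> x - exchange \<mu> \<rho> u x * \<phi> x)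
    = bil (kern \<mu> \<rho>) u \<phi>"
proof -
  have "(LINT x|lborel. F u x \<bullet> F \<phi> x - exchange \<mu> \<rho> u x * \<phi> x)
    = (LINT x|lborel. F u x \<bullet> F \<phi> x) - (LINT x|lborel. exchange \<mu> \<rho> u x * \<phi> x)"
    by (intro Bochner_Integration.integral_diff sqi_inner_integrable W_D(5) u \<phi> exchange_integral(1) k)
  then show ?thesis
    unfolding F_inner[symmetric] exchange_integral(2)[OF assms] by (simp add: bil_def L2ip_def[of "F u"])
qed

text \<open>This is why a solution of the nonlinear equation solves the linear eigenvalue equation
  for the kernel with u(x) u(y) subtracted.\<close>

lemma hartree_exchange: "hartree \<mu> u x * u x = exchange \<mu> (\<lambda>x y. u x * u y) u x"
proof -
  have "exchange \<mu> (\<lambda>x y. u x * u y) u x = (LINT y|lborel. ((u y)\<^sup>2 / norm (x - y) powr \<mu>) * u x)"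
    unfolding exchange_def by (rule Bochner_Integration.integral_cong) (simp_all add: power2_eq_square mult_ac)
  also have "\<dots> = hartree \<mu> u x * u x" unfolding hartree_def by (rule integral_mult_left_zero)
  finally show ?thesis by simp
qed

lemma solution_integral:
  assumes k: "square_integrable (kern \<mu> \<rho>)" and u: "u \<in> W_space V" and \<phi>: "\<phi> \<in> W_space V"
  shows "(LINT x|lborel. weak_grad u x \<bullet> weak_grad \<phi> x + V x * u x * \<phi> x
      - exchange \<mu> \<rho> u x * \<phi> x + hartree \<mu> u x * u x * \<phi> x)
    = bil (\<lambda>p. kern \<mu> \<rho> p - tens \<mu> u u p) u \<phi>"
proof -
  have ku: "square_integrable (kern \<mu> (\<lambda>x y. u x * u y))" unfolding kern_tensor by (rule tens_sqi[OF u u])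
  note e1 = exchange_integral[OF k u \<phi>] and e2 = exchange_integral[OF ku u \<phi>]
  have f: "integrable lborel (\<lambda>x. F u x \<bullet> F \<phi> x)" by (intro sqi_inner_integrable W_D(5) u \<phi>)
  have "(LINT x|lborel. F u x \<bullet> F \<phi> x - exchange \<mu> \<rho> u x * \<phi> x + exchange \<mu> (\<lambda>x y. u x * u y) u x * \<phi> x)
    = L2ip (F u) (F \<phi>) - L2ip (kern \<mu> \<rho>) (tens \<mu> \<phi> u) + L2ip (tens \<mu> u u) (tens \<mu> \<phi> u)"
    using f e1 e2 by (simp add: L2ip_def kern_tensor)
  then show ?thesis
    unfolding F_inner[symmetric] hartree_exchange bil_def
    using L2ip_diff_left[OF k tens_sqi[OF u u] tens_sqi[OF \<phi> u]] by simp
qed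

lemma weak_solution_iff:
  assumes "square_integrable (kern \<mu> \<rho>)"
  shows "weak_solution V \<mu> lam \<rho> u \<longleftrightarrow> u \<in> W_space V \<and>
    (\<forall>\<phi>. test_function \<phi> \<longrightarrow> bil (\<lambda>p. kern \<mu> \<rho> p - tens \<mu> u u p) u \<phi> = lam * L2ip u \<phi>)"
  unfolding weak_solution_def using solution_integral[OF assms] test_W(1) by (auto simp: L2ip_def)

lemma weak_eigenfunction_iff:
  assumes "square_integrable (kern \<mu> \<rho>)"
  shows "weak_eigenfunction V \<mu> \<rho> lam u \<longleftrightarrow> u \<in> W_space V \<and> \<not> ae_zero u \<and>
    (\<forall>\<phi>. test_function \<phi> \<longrightarrow> bil (kern \<mu> \<rho>) u \<phi> = lam * L2ip u \<phi>)"
  unfolding weak_eigenfunction_def using eigen_integral[OF assms] test_W(1) by (auto simp: L2ip_def)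

lemma tens_conv:
  assumes u: "\<And>n. U n \<in> W_space V" "u \<in> W_space V" "(\<lambda>n. W_norm V (\<lambda>x. U n x - u x)) \<longlonglongrightarrow> 0"
    and v: "\<And>n. Y n \<in> W_space V" "v \<in> W_space V" "(\<lambda>n. W_norm V (\<lambda>x. Y n x - v x)) \<longlonglongrightarrow> 0"
  shows "(\<lambda>n. L2n (\<lambda>p. tens \<mu> (U n) (Y n) p - tens \<mu> u v p)) \<longlonglongrightarrow> 0"
proof -
  obtain C where C: "C > 0" "\<And>u v. u \<in> W_space V \<Longrightarrow> v \<in> W_space V \<Longrightarrow> L2n (tens \<mu> u v) \<le> C * (W_norm V u * W_norm V v)"
    by (rule tens_bound) blast
  show ?thesis
  proof (rule Lim_null_comparison[OF always_eventually], rule allI)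
    fix n
    note d = W_diff(1)[OF u(1)[of n] u(2)] W_diff(1)[OF v(1)[of n] v(2)]
    have "L2n (\<lambda>p. tens \<mu> (U n) (Y n) p - tens \<mu> u v p)
      \<le> L2n (\<lambda>p. tens \<mu> (U n) (Y n) p - tens \<mu> u (Y n) p) + L2n (\<lambda>p. tens \<mu> u (Y n) p - tens \<mu> u v p)"
      by (intro L2n_triangle_diff tens_sqi u v)
    also have "\<dots> = L2n (tens \<mu> (\<lambda>x. U n x - u x) (Y n)) + L2n (tens \<mu> u (\<lambda>x. Y n x - v x))"
      by (simp add: tens_diff_left[abs_def] tens_diff_right[abs_def])
    also have "\<dots> \<le> C * (W_norm V (\<lambda>x. U n x - u x) * W_norm V (Y n)) + C * (W_norm V u * W_norm V (\<lambda>x. Y n x - v x))"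
      by (intro add_mono C d u v)
    finally show "norm (L2n (\<lambda>p. tens \<mu> (U n) (Y n) p - tens \<mu> u v p))
      \<le> C * (W_norm V (\<lambda>x. U n x - u x) * W_norm V (Y n)) + C * (W_norm V u * W_norm V (\<lambda>x. Y n x - v x))" by simp
  next
    have "(\<lambda>n. C * (W_norm V (\<lambda>x. U n x - u x) * W_norm V (Y n)) + C * (W_norm V u * W_norm V (\<lambda>x. Y n x - v x)))
      \<longlonglongrightarrow> C * (0 * W_norm V v) + C * (W_norm V u * 0)"
      by (intro tendsto_intros u v W_conv)
    then show "(\<lambda>n. C * (W_norm V (\<lambda>x. U n x - u x) * W_norm V (Y n)) + C * (W_norm V u * W_norm V (\<lambda>x. Y n x - v x))) \<longlonglongrightarrow> 0"
      by simp
  qed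
qed

lemma W_conv_const: "(\<lambda>n. W_norm V (\<lambda>x. u x - u x)) \<longlonglongrightarrow> 0" if "u \<in> W_space V"
  using W_diff(3)[OF that that] by (simp add: L2n_def)

lemma bil_tendsto:
  assumes g: "\<And>n. square_integrable (g n)" "square_integrable g'" "(\<lambda>n. L2n (\<lambda>p. g n p - g' p)) \<longlonglongrightarrow> 0"
    and u: "\<And>n. U n \<in> W_space V" "u \<in> W_space V" "(\<lambda>n. W_norm V (\<lambda>x. U n x - u x)) \<longlonglongrightarrow> 0"
    and v: "\<And>n. Y n \<in> W_space V" "v \<in> W_space V" "(\<lambda>n. W_norm V (\<lambda>x. Y n x - v x)) \<longlonglongrightarrow> 0"
  shows "(\<lambda>n. bil (g n) (U n) (Y n)) \<longlonglongrightarrow> bil g' u v"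
  unfolding bil_def
  by (intro tendsto_diff L2ip_tendsto W_D(5) W_conv(1) tens_sqi tens_conv g u v)

lemma L2_conv_const: "(\<lambda>n. L2n (\<lambda>p. g p - g p)) \<longlonglongrightarrow> 0"
  by (simp add: L2n_def)

text \<open>Both sides are continuous in \<phi> for the norm of \<open>W\<close>, so density
  suffices. It permits testing with the solution itself.\<close>

lemma bil_extend:
  assumes g: "square_integrable g" and u: "u \<in> W_space V"
    and t: "\<And>\<phi>. test_function \<phi> \<Longrightarrow> bil g u \<phi> = lam * L2ip u \<phi>" and \<phi>: "\<phi> \<in> W_space V"
  shows "bil g u \<phi> = lam * L2ip u \<phi>"
proof -
  obtain p where p: "\<And>n::nat. test_function (p n)" "(\<lambda>n. W_norm V (\<lambda>x. p n x - \<phi> x)) \<longlonglongrightarrow> 0"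
    by (rule W_approx[OF \<phi>]) blast
  note pW = test_W(1)[OF p(1)]
  have "(\<lambda>n. bil g u (p n)) \<longlonglongrightarrow> bil g u \<phi>"
    by (intro bil_tendsto g L2_conv_const u W_conv_const pW \<phi> p(2))
  moreover have "(\<lambda>n. lam * L2ip u (p n)) \<longlonglongrightarrow> lam * L2ip u \<phi>"
    by (intro tendsto_intros L2ip_tendsto W_D(2) u pW \<phi> L2_conv_const W_conv(2) p(2))
  ultimately show ?thesis using LIMSEQ_unique unfolding t[OF p(1)] by blast
qed

lemma qf_extend:
  assumes g: "square_integrable g"
    and t: "\<And>\<phi>. test_function \<phi> \<Longrightarrow> lam * (L2n \<phi>)\<^sup>2 \<le> qf g \<phi>" and \<psi>: "\<psi> \<in> W_space V"
  shows "lam * (L2n \<psi>)\<^sup>2 \<le> qf g \<psi>"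
proof -
  obtain p where p: "\<And>n::nat. test_function (p n)" "(\<lambda>n. W_norm V (\<lambda>x. p n x - \<psi> x)) \<longlonglongrightarrow> 0"
    by (rule W_approx[OF \<psi>]) blast
  note pW = test_W(1)[OF p(1)]
  have l1: "(\<lambda>n. qf g (p n)) \<longlonglongrightarrow> qf g \<psi>"
    unfolding qf_eq_bil by (intro bil_tendsto g L2_conv_const pW \<psi> p(2))
  have l2: "(\<lambda>n. lam * (L2n (p n))\<^sup>2) \<longlonglongrightarrow> lam * (L2n \<psi>)\<^sup>2"
    by (intro tendsto_intros L2n_tendsto W_D(2) pW \<psi> W_conv(2) p(2))
  show ?thesis by (rule LIMSEQ_le[OF l2 l1]) (use t[OF p(1)] in blast)
qed

text \<open>A real infimum is meaningful only for a set bounded below, and this provides the bound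
  for \<open>lambda1\<close>. Interpolation lets the exchange term be absorbed by the norm of
  \<open>W\<close>, leaving a multiple of the squared L2 norm.\<close>

lemma qf_bounded_below:
  assumes g: "square_integrable g"
  obtains C where "\<And>\<psi>. \<psi> \<in> W_space V \<Longrightarrow> - C * (L2n \<psi>)\<^sup>2 \<le> qf g \<psi>"
proof -
  define G where "G = L2n g + 1"
  have G: "G > 0" unfolding G_def by (rule add_nonneg_pos) simp_all
  \<comment> \<open>After taking roots the \<open>W\<close> part of the bound has coefficient
    \<open>1 / G\<close>, which cancels against the kernel norm; the 1 in \<open>G\<close> avoids
    division by 0.\<close>
  define d where "d = (1 / G)\<^sup>2"
  have d: "d > 0" using G by (simp add: d_def)
  from tens_interpolation[OF d] obtain K where K: "K > 0" "\<And>u v. u \<in> W_space V \<Longrightarrow> v \<in> W_space V \<Longrightarrow>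
    (L2n (tens \<mu> u v))\<^sup>2 \<le> d * ((W_norm V u)\<^sup>2 * (W_norm V v)\<^sup>2) + K * ((L2n u)\<^sup>2 * (L2n v)\<^sup>2)" by blast
  have "- (G * sqrt K) * (L2n \<psi>)\<^sup>2 \<le> qf g \<psi>" if \<psi>: "\<psi> \<in> W_space V" for \<psi>
  proof -
    define w where "w = (W_norm V \<psi>)\<^sup>2"
    define l where "l = (L2n \<psi>)\<^sup>2"
    have wl: "w \<ge> 0" "l \<ge> 0" by (simp_all add: w_def l_def)
    have "L2n (tens \<mu> \<psi> \<psi>) \<le> (1 / G) * w + sqrt K * l"
    proof (rule power2_le_imp_le)
      have "(L2n (tens \<mu> \<psi> \<psi>))\<^sup>2 \<le> d * (w * w) + K * (l * l)"
        using K(2)[OF \<psi> \<psi>] by (simp add: w_def l_def)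
      also have "\<dots> = ((1 / G) * w)\<^sup>2 + (sqrt K * l)\<^sup>2"
        using K(1) by (simp add: d_def power_mult_distrib power2_eq_square)
      also have "\<dots> \<le> ((1 / G) * w + sqrt K * l)\<^sup>2"
      proof -
        have "0 \<le> 2 * ((1 / G) * w) * (sqrt K * l)" using wl G K(1) by (intro mult_nonneg_nonneg) auto
        then show ?thesis by (simp only: power2_sum)
      qed
      finally show "(L2n (tens \<mu> \<psi> \<psi>))\<^sup>2 \<le> ((1 / G) * w + sqrt K * l)\<^sup>2" .
      show "0 \<le> (1 / G) * w + sqrt K * l" using wl G K(1) by (intro add_nonneg_nonneg mult_nonneg_nonneg) auto
    qed
    then have "G * L2n (tens \<mu> \<psi> \<psi>) \<le> G * ((1 / G) * w + sqrt K * l)" using G by (intro mult_left_mono) auto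
    also have "\<dots> = w + G * sqrt K * l" using G by (simp add: distrib_left)
    finally have 1: "G * L2n (tens \<mu> \<psi> \<psi>) \<le> w + G * sqrt K * l" .
    have "L2ip g (tens \<mu> \<psi> \<psi>) \<le> L2n g * L2n (tens \<mu> \<psi> \<psi>)"
      using L2_Cauchy_Schwarz[OF g tens_sqi[OF \<psi> \<psi>]] by linarith
    also have "\<dots> \<le> G * L2n (tens \<mu> \<psi> \<psi>)" by (intro mult_right_mono) (simp_all add: G_def)
    finally show ?thesis using 1 by (simp add: qf_def w_def l_def)
  qed
  then show ?thesis using that by blast
qed

section \<open>The principal eigenvalue as the best lower bound of the form on W\<close>

lemma lambda1_alt:
  "lambda1 V \<mu> \<rho> = (INF \<psi>\<in>{\<psi>. test_function \<psi> \<and> \<psi> \<noteq> (\<lambda>_. 0)}. qf (kern \<mu> \<rho>) \<psi> / (L2n \<psi>)\<^sup>2)"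
  by (simp add: lambda1_def quad_form_eq L2n_real_sq)

lemma lambda1_ge:
  assumes "\<And>\<psi>. \<psi> \<in> W_space V \<Longrightarrow> lam * (L2n \<psi>)\<^sup>2 \<le> qf (kern \<mu> \<rho>) \<psi>"
  shows "lam \<le> lambda1 V \<mu> \<rho>"
  unfolding lambda1_alt
proof (rule cINF_greatest)
  have "bump \<noteq> (\<lambda>_::'a. 0)" using bump_0 by (metis zero_neq_one)
  then show "{\<psi> :: 'a \<Rightarrow> real. test_function \<psi> \<and> \<psi> \<noteq> (\<lambda>_. 0)} \<noteq> {}" using bump_test by blast
  fix \<psi> :: "'a \<Rightarrow> real" assume "\<psi> \<in> {\<psi>. test_function \<psi> \<and> \<psi> \<noteq> (\<lambda>_. 0)}"
  then have \<psi>: "test_function \<psi>" "L2n \<psi> > 0" using test_L2n_pos by auto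
  show "lam \<le> qf (kern \<mu> \<rho>) \<psi> / (L2n \<psi>)\<^sup>2"
    using assms[OF test_W(1)[OF \<psi>(1)]] \<psi>(2) by (simp add: pos_le_divide_eq)
qed

lemma W_norm_ae_zero:
  assumes "u \<in> W_space V" "ae_zero u"
  shows "W_norm V u = 0"
proof -
  have "W_norm V u = W_norm V (\<lambda>x. 0)"
    by (rule W_cong(3)[OF W_zero W_D(6)[OF assms(1)]]) (use assms(2) in \<open>simp add: ae_zero_def\<close>)
  moreover have "W_norm V (\<lambda>x. 0) = 0"
    using W_diff(3)[OF W_zero W_zero] by (simp add: L2n_def)
  ultimately show ?thesis by simp
qed

lemma tens_ae_zero:
  assumes "u \<in> W_space V" "v \<in> W_space V" "W_norm V u = 0 \<or> W_norm V v = 0" "square_integrable g"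
  shows "L2n (tens \<mu> u v) = 0" "L2ip g (tens \<mu> u v) = 0" "L2ip (tens \<mu> u v) g = 0"
proof -
  obtain C where C: "C > 0" "L2n (tens \<mu> u v) \<le> C * (W_norm V u * W_norm V v)"
    by (rule tens_bound) (use assms in blast)
  then have "L2n (tens \<mu> u v) \<le> 0" using assms(3) by auto
  then show z: "L2n (tens \<mu> u v) = 0" using L2n_nonneg[of "tens \<mu> u v"] by linarith
  show i: "L2ip g (tens \<mu> u v) = 0"
    using L2_Cauchy_Schwarz[OF assms(4) tens_sqi[OF assms(1,2)]] z by simp
  then show "L2ip (tens \<mu> u v) g = 0" by (simp add: L2ip_commute)
qed

lemma lambda1_le:
  assumes g: "square_integrable (kern \<mu> \<rho>)" and \<psi>: "\<psi> \<in> W_space V"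
  shows "lambda1 V \<mu> \<rho> * (L2n \<psi>)\<^sup>2 \<le> qf (kern \<mu> \<rho>) \<psi>"
proof (rule qf_extend[OF g _ \<psi>])
  fix \<phi> :: "'a \<Rightarrow> real" assume \<phi>: "test_function \<phi>"
  obtain C where C: "\<And>\<psi>. \<psi> \<in> W_space V \<Longrightarrow> - C * (L2n \<psi>)\<^sup>2 \<le> qf (kern \<mu> \<rho>) \<psi>"
    by (rule qf_bounded_below[OF g]) blast
  show "lambda1 V \<mu> \<rho> * (L2n \<phi>)\<^sup>2 \<le> qf (kern \<mu> \<rho>) \<phi>"
  proof (cases "\<phi> = (\<lambda>_. 0)")
    case True
    then have z: "W_norm V \<phi> = 0" using W_norm_ae_zero[OF test_W(1)[OF \<phi>]] by (simp add: ae_zero_def)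
    then have "qf (kern \<mu> \<rho>) \<phi> = 0"
      using tens_ae_zero(2)[OF test_W(1)[OF \<phi>] test_W(1)[OF \<phi>] _ g] by (simp add: qf_def)
    moreover have "L2n \<phi> = 0" using True by (simp add: L2n_def)
    ultimately show ?thesis by simp
  next
    case False
    have pos: "L2n \<phi> > 0" by (rule test_L2n_pos[OF \<phi> False])
    have "lambda1 V \<mu> \<rho> \<le> qf (kern \<mu> \<rho>) \<phi> / (L2n \<phi>)\<^sup>2"
      unfolding lambda1_alt
    proof (rule cINF_lower)
      show "bdd_below ((\<lambda>\<psi>. qf (kern \<mu> \<rho>) \<psi> / (L2n \<psi>)\<^sup>2) ` {\<psi>. test_function \<psi> \<and> \<psi> \<noteq> (\<lambda>_. 0)})"
      proof (rule bdd_belowI2)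
        fix \<psi> :: "'a \<Rightarrow> real" assume "\<psi> \<in> {\<psi>. test_function \<psi> \<and> \<psi> \<noteq> (\<lambda>_. 0)}"
        then have \<psi>: "test_function \<psi>" "L2n \<psi> > 0" using test_L2n_pos by auto
        show "- C \<le> qf (kern \<mu> \<rho>) \<psi> / (L2n \<psi>)\<^sup>2"
          using C[OF test_W(1)[OF \<psi>(1)]] \<psi>(2) by (simp add: pos_le_divide_eq)
      qed
    qed (use \<phi> False in simp)
    then show ?thesis using pos by (simp add: pos_le_divide_eq)
  qed
qed

text \<open>The kernel enters as a function \<open>g\<close>, standing for
  \<open>kern \<mu> \<rho>\<close>, so that convergence of kernels is L2 convergence. For nonzero
  \<open>u\<close> the two conditions say that \<open>lam\<close> is the lowest eigenvalue of the
  operator with u(x) u(y) subtracted and that \<open>u\<close> belongs to it.\<close>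

definition extremal :: "real \<Rightarrow> ('a \<times> 'a \<Rightarrow> real) \<Rightarrow> ('a \<Rightarrow> real) \<Rightarrow> bool" where
  "extremal lam g u \<longleftrightarrow> u \<in> W_space V
    \<and> (\<forall>\<phi>\<in>W_space V. bil (\<lambda>p. g p - tens \<mu> u u p) u \<phi> = lam * L2ip u \<phi>)
    \<and> (\<forall>\<psi>\<in>W_space V. lam * (L2n \<psi>)\<^sup>2 \<le> qf (\<lambda>p. g p - tens \<mu> u u p) \<psi>)"

lemma qf_diff:
  assumes "square_integrable g" "square_integrable h" "\<psi> \<in> W_space V"
  shows "qf (\<lambda>p. g p - h p) \<psi> = qf g \<psi> + L2ip h (tens \<mu> \<psi> \<psi>)"
  using L2ip_diff_left[OF assms(1,2) tens_sqi[OF assms(3,3)]] by (simp add: qf_def)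

lemma extremal_weak_solution:
  assumes "square_integrable (kern \<mu> \<rho>)" "extremal lam (kern \<mu> \<rho>) u"
  shows "weak_solution V \<mu> lam \<rho> u"
  unfolding weak_solution_iff[OF assms(1)] using assms(2) test_W(1) by (auto simp: extremal_def)

text \<open>The equation tested with its own solution. The quartic term appears with a positive
  sign, the source of both the a priori bound and uniqueness.\<close>

lemma extremal_energy:
  assumes g: "square_integrable g" and u: "extremal lam g u"
  shows "qf g u + (L2n (tens \<mu> u u))\<^sup>2 = lam * (L2n u)\<^sup>2"
proof -
  have W: "u \<in> W_space V" and e: "bil (\<lambda>p. g p - tens \<mu> u u p) u u = lam * L2ip u u"
    using u by (auto simp: extremal_def)
  then show ?thesis
    using qf_diff[OF g tens_sqi[OF W W] W] by (simp add: qf_eq_bil[symmetric] L2ip_self)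
qed

lemma tens_zero_imp:
  assumes u: "u \<in> W_space V" and z: "L2n (tens \<mu> u u) = 0"
  shows "ae_zero u"
proof -
  have "AE p in lborel. tens \<mu> u u p = 0" using z L2n_eq_0_iff[OF tens_sqi[OF u u]] by simp
  then have "AE p in lborel. tens \<mu> u u p = tens \<mu> (\<lambda>x. 0) (\<lambda>x. 0) p" by (simp add: tens_def[of \<mu> "\<lambda>x. 0"])
  from tensor_square_eq_AE[OF W_D(6)[OF u] _ this] show ?thesis by (simp add: ae_zero_def)
qed

lemma kern_minus_tensor: "kern \<mu> (\<lambda>x y. \<rho> x y - u x * u y) = (\<lambda>p. kern \<mu> \<rho> p - tens \<mu> u u p)"
  by (simp add: kern_diff[abs_def] fun_eq_iff kern_tensor[symmetric] kern_diff)

lemma is_uhat_imp_extremal: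
  assumes k: "square_integrable (kern \<mu> \<rho>)" and u: "is_uhat V \<mu> lam \<rho> u"
  shows "extremal lam (kern \<mu> \<rho>) u"
proof (cases "lam > lambda1 V \<mu> \<rho>")
  case True
  then have p: "principal_solution V \<mu> lam \<rho> u" using u by (simp add: is_uhat_def)
  then have ws: "weak_solution V \<mu> lam \<rho> u" and l: "lambda1 V \<mu> (\<lambda>x y. \<rho> x y - u x * u y) = lam"
    by (auto simp: principal_solution_def Let_def)
  have W: "u \<in> W_space V" using ws by (simp add: weak_solution_def)
  have g: "square_integrable (\<lambda>p. kern \<mu> \<rho> p - tens \<mu> u u p)" by (rule sqi_diff[OF k tens_sqi[OF W W]])
  have "bil (\<lambda>p. kern \<mu> \<rho> p - tens \<mu> u u p) u \<phi> = lam * L2ip u \<phi>" if "\<phi> \<in> W_space V" for \<phi>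
    using ws unfolding weak_solution_iff[OF k] by (intro bil_extend[OF g W _ that]) blast
  moreover have "lam * (L2n \<psi>)\<^sup>2 \<le> qf (\<lambda>p. kern \<mu> \<rho> p - tens \<mu> u u p) \<psi>" if "\<psi> \<in> W_space V" for \<psi>
    using lambda1_le[of "\<lambda>x y. \<rho> x y - u x * u y", unfolded kern_minus_tensor l, OF g that] .
  ultimately show ?thesis using W by (simp add: extremal_def)
next
  case False
  then have W: "u \<in> W_space V" and z: "ae_zero u" using u by (auto simp: is_uhat_def)
  have z': "W_norm V u = 0" by (rule W_norm_ae_zero[OF W z])
  then have Fz: "L2n (F u) = 0" by (simp add: W_norm_eq)
  have uz: "L2n u = 0" using L2_le_W[OF W] z' L2n_nonneg[of u] by simp
  have g: "square_integrable (\<lambda>p. kern \<mu> \<rho> p - tens \<mu> u u p)" by (rule sqi_diff[OF k tens_sqi[OF W W]])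
  have "bil (\<lambda>p. kern \<mu> \<rho> p - tens \<mu> u u p) u \<phi> = lam * L2ip u \<phi>" if \<phi>: "\<phi> \<in> W_space V" for \<phi>
    using L2_Cauchy_Schwarz[OF W_D(5)[OF W] W_D(5)[OF \<phi>]] L2_Cauchy_Schwarz[OF W_D(2)[OF W] W_D(2)[OF \<phi>]]
      tens_ae_zero(2)[OF \<phi> W _ g] z' by (simp add: bil_def Fz uz)
  moreover have "lam * (L2n \<psi>)\<^sup>2 \<le> qf (\<lambda>p. kern \<mu> \<rho> p - tens \<mu> u u p) \<psi>" if \<psi>: "\<psi> \<in> W_space V" for \<psi>
  proof -
    \<comment> \<open>Here \<open>u\<close> is null, so subtracting its tensor square changes
      nothing, and the inequality is just \<open>lam \<le> lambda1 V \<mu> \<rho>\<close>.\<close>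
    have "lam * (L2n \<psi>)\<^sup>2 \<le> lambda1 V \<mu> \<rho> * (L2n \<psi>)\<^sup>2" using False by (intro mult_right_mono) auto
    also have "\<dots> \<le> qf (kern \<mu> \<rho>) \<psi>" by (rule lambda1_le[OF k \<psi>])
    also have "\<dots> = qf (\<lambda>p. kern \<mu> \<rho> p - tens \<mu> u u p) \<psi>"
      using qf_diff[OF k tens_sqi[OF W W] \<psi>] tens_ae_zero(3)[OF W W _ tens_sqi[OF \<psi> \<psi>]] z' by simp
    finally show ?thesis .
  qed
  ultimately show ?thesis using W by (simp add: extremal_def)
qed

text \<open>The position of \<open>lam\<close> decides whether \<open>u\<close> is null. Up to the
  principal eigenvalue the energy identity leaves no room for the quartic term; above it a null
  \<open>u\<close> would turn the form inequality into
  \<open>lam \<le> lambda1 V \<mu> \<rho>\<close>.\<close>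

lemma extremal_imp_is_uhat:
  assumes k: "square_integrable (kern \<mu> \<rho>)" and u: "extremal lam (kern \<mu> \<rho>) u"
  shows "is_uhat V \<mu> lam \<rho> u"
proof -
  let ?g = "\<lambda>p. kern \<mu> \<rho> p - tens \<mu> u u p"
  have W: "u \<in> W_space V" and el: "\<And>\<phi>. \<phi> \<in> W_space V \<Longrightarrow> bil ?g u \<phi> = lam * L2ip u \<phi>"
    and q: "\<And>\<psi>. \<psi> \<in> W_space V \<Longrightarrow> lam * (L2n \<psi>)\<^sup>2 \<le> qf ?g \<psi>"
    using u by (auto simp: extremal_def)
  have g: "square_integrable ?g" by (rule sqi_diff[OF k tens_sqi[OF W W]])
  have en: "qf (kern \<mu> \<rho>) u + (L2n (tens \<mu> u u))\<^sup>2 = lam * (L2n u)\<^sup>2" by (rule extremal_energy[OF k u])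
  show ?thesis
  proof (cases "lam > lambda1 V \<mu> \<rho>")
    case False
    have "lam * (L2n u)\<^sup>2 \<le> lambda1 V \<mu> \<rho> * (L2n u)\<^sup>2" using False by (intro mult_right_mono) auto
    also have "\<dots> \<le> qf (kern \<mu> \<rho>) u" by (rule lambda1_le[OF k W])
    finally have "(L2n (tens \<mu> u u))\<^sup>2 \<le> 0" using en by linarith
    then have "L2n (tens \<mu> u u) = 0" by simp
    then show ?thesis using tens_zero_imp[OF W] W False by (simp add: is_uhat_def)
  next
    case True
    have nz: "\<not> ae_zero u"
    proof
      assume "ae_zero u"
      then have z: "W_norm V u = 0" by (rule W_norm_ae_zero[OF W])
      have "lam \<le> lambda1 V \<mu> \<rho>"
      proof (rule lambda1_ge)
        fix \<psi> assume \<psi>: "\<psi> \<in> W_space V"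
        show "lam * (L2n \<psi>)\<^sup>2 \<le> qf (kern \<mu> \<rho>) \<psi>"
          using q[OF \<psi>] qf_diff[OF k tens_sqi[OF W W] \<psi>] tens_ae_zero(3)[OF W W _ tens_sqi[OF \<psi> \<psi>]] z by simp
      qed
      then show False using True by simp
    qed
    then have pos: "L2n u > 0"
      using L2n_eq_0_iff[OF W_D(2)[OF W]] L2n_nonneg[of u] unfolding ae_zero_def by linarith
    let ?\<rho> = "\<lambda>x y. \<rho> x y - u x * u y"
    \<comment> \<open>The form inequality bounds the infimum from below, and \<open>u\<close>,
      tested with itself, attains it.\<close>
    have l: "lambda1 V \<mu> ?\<rho> = lam"
    proof (rule antisym)
      show "lam \<le> lambda1 V \<mu> ?\<rho>" by (rule lambda1_ge) (simp add: kern_minus_tensor q)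
      have "lambda1 V \<mu> ?\<rho> * (L2n u)\<^sup>2 \<le> qf ?g u"
        using lambda1_le[of ?\<rho>, unfolded kern_minus_tensor, OF g W] .
      also have "\<dots> = lam * (L2n u)\<^sup>2" using el[OF W] by (simp add: qf_eq_bil L2ip_self)
      finally show "lambda1 V \<mu> ?\<rho> \<le> lam" using pos by simp
    qed
    define c where "c = 1 / L2n u"
    have c: "c > 0" using pos by (simp add: c_def)
    have nc: "(\<lambda>x. u x / L2_norm u) = (\<lambda>x. c * u x)" by (simp add: L2_norm_eq c_def)
    note sc = W_scale[OF W, of c]
    have "principal_eigenfunction V \<mu> ?\<rho> (\<lambda>x. u x / L2_norm u)"
      unfolding principal_eigenfunction_def l nc
    proof (subst weak_eigenfunction_iff, unfold kern_minus_tensor, safe)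
      show "square_integrable ?g" by (rule g)
      show "(\<lambda>x. c * u x) \<in> W_space V" by (rule sc)
      show False if "ae_zero (\<lambda>x. c * u x)" using that nz c by (simp add: ae_zero_def)
      fix \<phi> :: "'a \<Rightarrow> real" assume \<phi>: "test_function \<phi>"
      note \<phi>W = test_W(1)[OF \<phi>]
      have "L2ip (F (\<lambda>x. c * u x)) (F \<phi>) = L2ip (\<lambda>x. c *\<^sub>R F u x) (F \<phi>)"
        by (intro L2ip_cong_AE sqi_scaleR W_D(5) W \<phi>W sqi_meas sc) simp
      then have "bil ?g (\<lambda>x. c * u x) \<phi> = c * bil ?g u \<phi>"
        using L2ip_scale_left[of c "tens \<mu> \<phi> u" ?g]
        by (simp add: bil_def L2ip_scale_left tens_scale_right[abs_def] L2ip_commute[of ?g] right_diff_distrib)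
      then show "bil ?g (\<lambda>x. c * u x) \<phi> = lam * L2ip (\<lambda>x. c * u x) \<phi>"
        using el[OF \<phi>W] L2ip_scale_left[of c u \<phi>] by simp
    qed
    then have "principal_solution V \<mu> lam \<rho> u"
      unfolding principal_solution_def Let_def using extremal_weak_solution[OF k u] nz l by simp
    then show ?thesis using True by (simp add: is_uhat_def)
  qed
qed

lemma extremal_unique:
  assumes g: "square_integrable g" and u: "extremal lam g u" and v: "extremal lam g v"
  shows "(AE x in lborel. u x = v x) \<or> (AE x in lborel. u x = - v x)"
proof -
  have uW: "u \<in> W_space V" and vW: "v \<in> W_space V" using u v by (auto simp: extremal_def)
  let ?u = "tens \<mu> u u" and ?v = "tens \<mu> v v"
  note su = tens_sqi[OF uW uW] and sv = tens_sqi[OF vW vW]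
  have "lam * (L2n v)\<^sup>2 \<le> qf g v + L2ip ?u ?v"
    using u vW qf_diff[OF g su vW] by (auto simp: extremal_def)
  moreover have "lam * (L2n u)\<^sup>2 \<le> qf g u + L2ip ?u ?v"
    using v uW qf_diff[OF g sv uW] by (auto simp: extremal_def L2ip_commute[of ?v])
  \<comment> \<open>By \<open>extremal_energy\<close> the two inequalities read
    \<open>(L2n ?v)\<^sup>2 \<le> L2ip ?u ?v\<close> and
    \<open>(L2n ?u)\<^sup>2 \<le> L2ip ?u ?v\<close>; all terms with \<open>lam\<close> and
    \<open>g\<close> have cancelled.\<close>
  ultimately have "(L2n (\<lambda>p. ?u p - ?v p))\<^sup>2 \<le> 0"
    using extremal_energy[OF g u] extremal_energy[OF g v] L2n_diff_sq[OF su sv] by linarith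
  then have "L2n (\<lambda>p. ?u p - ?v p) = 0" by simp
  then have "AE p in lborel. ?u p - ?v p = 0" using L2n_eq_0_iff[OF sqi_diff[OF su sv]] by simp
  then have "AE p in lborel. ?u p = ?v p" by eventually_elim simp
  then show ?thesis by (rule tensor_square_eq_AE[OF W_D(6)[OF uW] W_D(6)[OF vW]])
qed

end

text \<open>Two points of the ball are at distance at most \<open>2 * R\<close>, so the singular
  weight is bounded below there and the double integral dominates the square of the local mass. In
  this way a quartic term controls a quadratic one.\<close>

lemma local_mass_bound:
  fixes u :: "'a::euclidean_space \<Rightarrow> real"
  assumes u: "square_integrable u" and t: "square_integrable (tens m u u)" and m: "m > 0" and R: "R > 0"
  shows "(L2n (\<lambda>x. indicator (cball 0 R) x * u x))\<^sup>2 \<le> (2 * R) powr (m / 2) * L2n (tens m u u)"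
proof (rule power2_le_imp_le)
  let ?w = "\<lambda>x. indicator (cball 0 R) x * u x"
  have [measurable]: "u \<in> borel_measurable borel" using u by (rule sqi_meas)
  have sw: "square_integrable ?w" by (rule sqi_indicator(1)[OF u]) simp
  then have [measurable]: "?w \<in> borel_measurable borel" by (rule sqi_meas)
  define M where "M = (2 * R) powr m"
  have "ennreal (((L2n ?w)\<^sup>2)\<^sup>2) = ennreal ((L2n ?w)\<^sup>2) * ennreal ((L2n ?w)\<^sup>2)"
    by (simp add: power2_eq_square ennreal_mult)
  also have "\<dots> = (\<integral>\<^sup>+x. ennreal ((?w x)\<^sup>2) \<partial>lborel) * (\<integral>\<^sup>+y. ennreal ((?w y)\<^sup>2) \<partial>lborel)"
    using nn_L2n[OF sw] by (simp only: real_norm_def power2_abs)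
  also have "\<dots> = (\<integral>\<^sup>+x. ennreal ((?w x)\<^sup>2) * (\<integral>\<^sup>+y. ennreal ((?w y)\<^sup>2) \<partial>lborel) \<partial>lborel)"
    by (rule nn_integral_multc[symmetric]) measurable
  also have "\<dots> = (\<integral>\<^sup>+x. (\<integral>\<^sup>+y. ennreal ((?w x)\<^sup>2) * ennreal ((?w y)\<^sup>2) \<partial>lborel) \<partial>lborel)"
    by (intro nn_integral_cong nn_integral_cmult[symmetric]) measurable
  also have "\<dots> \<le> (\<integral>\<^sup>+x. (\<integral>\<^sup>+y. ennreal M * ennreal ((u x)\<^sup>2 * ((u y)\<^sup>2 * norm (x - y) powr (- m))) \<partial>lborel) \<partial>lborel)"
  proof (rule nn_integral_mono, rule nn_integral_mono_AE)
    fix x :: 'a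
    \<comment> \<open>On the diagonal \<open>0 powr (- m)\<close> is 0 instead of infinite, so the
      pointwise bound may fail there.\<close>
    have "AE y in lborel. y \<noteq> x" by (rule AE_lborel_singleton)
    then show "AE y in lborel. ennreal ((?w x)\<^sup>2) * ennreal ((?w y)\<^sup>2)
        \<le> ennreal M * ennreal ((u x)\<^sup>2 * ((u y)\<^sup>2 * norm (x - y) powr (- m)))"
    proof eventually_elim
      case (elim y)
      have "(?w x)\<^sup>2 * (?w y)\<^sup>2 \<le> M * ((u x)\<^sup>2 * ((u y)\<^sup>2 * norm (x - y) powr (- m)))"
      proof (cases "x \<in> cball 0 R \<and> y \<in> cball 0 R")
        case True
        then have "norm (x - y) \<le> 2 * R" using norm_triangle_ineq4[of x y] by simp
        then have "norm (x - y) powr m \<le> M" unfolding M_def using m by (intro powr_mono2) auto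
        moreover have "norm (x - y) powr m > 0" using elim by simp
        ultimately have "1 \<le> M * norm (x - y) powr (- m)" by (simp add: powr_minus field_simps)
        then have "(u x)\<^sup>2 * (u y)\<^sup>2 * 1 \<le> (u x)\<^sup>2 * (u y)\<^sup>2 * (M * norm (x - y) powr (- m))"
          by (intro mult_left_mono) auto
        then show ?thesis using True by (simp add: mult_ac)
      next
        case False
        have "0 \<le> M * ((u x)\<^sup>2 * ((u y)\<^sup>2 * norm (x - y) powr (- m)))" by (simp add: M_def)
        then show ?thesis using False by (auto simp: indicator_def)
      qed
      then show ?case by (simp add: M_def ennreal_leI flip: ennreal_mult)
    qed
  qed
  also have "\<dots> = ennreal M * energy2 m u u"
    unfolding energy2_def by (simp add: nn_integral_cmult)
  also have "\<dots> = ennreal M * ennreal ((L2n (tens m u u))\<^sup>2)"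
    using nn_L2n[OF t] nn_integral_tens[of u u m] by simp
  also have "\<dots> = ennreal (((2 * R) powr (m / 2) * L2n (tens m u u))\<^sup>2)"
    by (simp add: M_def power_mult_distrib powr_half_sq ennreal_mult)
  finally show "((L2n ?w)\<^sup>2)\<^sup>2 \<le> ((2 * R) powr (m / 2) * L2n (tens m u u))\<^sup>2"
    by (simp add: ennreal_le_iff)
qed simp

lemma L2n_indicator_split:
  fixes u :: "'a::euclidean_space \<Rightarrow> real"
  assumes u: "square_integrable u" and B[measurable]: "B \<in> sets borel"
  shows "(L2n u)\<^sup>2 = (L2n (\<lambda>x. indicator B x * u x))\<^sup>2 + (L2n (\<lambda>x. indicator (- B) x * u x))\<^sup>2"
proof -
  have [measurable]: "u \<in> borel_measurable borel" using u by (rule sqi_meas)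
  have i: "integrable lborel (\<lambda>x. (u x)\<^sup>2)" using u by (simp add: sqi_real_iff)
  have "integrable lborel (\<lambda>x. (indicator A x * u x)\<^sup>2)" if [measurable]: "A \<in> sets borel" for A
    by (rule Bochner_Integration.integrable_bound[OF i]) (auto simp: indicator_def)
  then have "(LINT x|lborel. (indicator B x * u x)\<^sup>2 + (indicator (- B) x * u x)\<^sup>2)
    = (L2n (\<lambda>x. indicator B x * u x))\<^sup>2 + (L2n (\<lambda>x. indicator (- B) x * u x))\<^sup>2"
    unfolding L2n_real_sq by (intro Bochner_Integration.integral_add) auto
  moreover have "(indicator B x * u x)\<^sup>2 + (indicator (- B) x * u x)\<^sup>2 = (u x)\<^sup>2" for x
    by (simp add: indicator_def)
  ultimately show ?thesis by (simp add: L2n_real_sq)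
qed

section \<open>A priori bound, compactness and continuity of extremal functions\<close>

context exchange_setting
begin

text \<open>On a ball the \<open>L\<^sup>2\<close> norm is controlled by the quartic Hartree energy, outside by the growth of
  the potential.\<close>

lemma extremal_bounded:
  obtains A where "\<And>lam g u. \<bar>lam\<bar> \<le> L \<Longrightarrow> square_integrable g \<Longrightarrow> L2n g \<le> G \<Longrightarrow> extremal lam g u \<Longrightarrow> W_norm V u \<le> A"
proof -
  define L' where "L' = max L 0"
  \<comment> \<open>Makes \<open>L' / T \<le> 1 / 2\<close>: the mass outside the ball then costs at
    most half of \<open>w\<close>, which the left-hand side of the energy identity can
    absorb.\<close>
  define T where "T = 2 * L' + 1"
  have T: "T > 0" "L' \<ge> 0" by (simp_all add: T_def L'_def)
  obtain R where R: "R > 0" "\<And>x. norm x \<ge> R \<Longrightarrow> V x \<ge> T" by (rule filterlim_at_infinity_ge[OF V_lim]) blast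
  define D where "D = (2 * R) powr (\<mu> / 2)"
  have "W_norm V u \<le> sqrt ((L' * D)\<^sup>2 + G\<^sup>2)"
    if lam: "\<bar>lam\<bar> \<le> L" and g: "square_integrable g" "L2n g \<le> G" and u: "extremal lam g u" for lam g u
  proof -
    have W: "u \<in> W_space V" using u by (simp add: extremal_def)
    note su = W_D(2)[OF W]
    define t where "t = L2n (tens \<mu> u u)"
    define w where "w = (W_norm V u)\<^sup>2"
    have t0: "t \<ge> 0" by (simp add: t_def)
    have w0: "w \<ge> 0" by (simp add: w_def)
    have l: "(L2n u)\<^sup>2 \<le> D * t + w / T"
    proof -
      have "(L2n (\<lambda>x. indicator (cball 0 R) x * u x))\<^sup>2 \<le> D * t"
        unfolding D_def t_def by (rule local_mass_bound[OF su tens_sqi[OF W W] mu(1) R(1)])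
      moreover have "L2n (\<lambda>x. indicator (- cball 0 R) x * u x) \<le> W_norm V u / sqrt T"
        by (rule W_tail(2)[OF W T(1)]) (use R(2) in auto)
      then have "(L2n (\<lambda>x. indicator (- cball 0 R) x * u x))\<^sup>2 \<le> (W_norm V u / sqrt T)\<^sup>2"
        by (intro power_mono) auto
      moreover have "(W_norm V u / sqrt T)\<^sup>2 = w / T" using T(1) by (simp add: w_def power_divide)
      moreover have "(L2n u)\<^sup>2 = (L2n (\<lambda>x. indicator (cball 0 R) x * u x))\<^sup>2 + (L2n (\<lambda>x. indicator (- cball 0 R) x * u x))\<^sup>2"
        by (rule L2n_indicator_split[OF su]) simp
      ultimately show ?thesis by linarith
    qed
    have e: "w - L2ip g (tens \<mu> u u) + t\<^sup>2 = lam * (L2n u)\<^sup>2"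
      using extremal_energy[OF g(1) u] by (simp add: qf_def w_def t_def)
    have "lam * (L2n u)\<^sup>2 \<le> L' * (L2n u)\<^sup>2" using lam by (intro mult_right_mono) (auto simp: L'_def)
    also have "\<dots> \<le> L' * (D * t + w / T)" by (intro mult_left_mono l T)
    also have "\<dots> = (L' * D) * t + w * (L' / T)" by (simp add: algebra_simps)
    also have "w * (L' / T) \<le> w * (1 / 2)" using T w0 by (intro mult_left_mono) (auto simp: T_def field_simps)
    finally have 1: "lam * (L2n u)\<^sup>2 \<le> (L' * D) * t + w / 2" by simp
    have "L2ip g (tens \<mu> u u) \<le> L2n g * t"
      using L2_Cauchy_Schwarz[OF g(1) tens_sqi[OF W W]] unfolding t_def by linarith
    also have "\<dots> \<le> G * t" by (intro mult_right_mono g t0)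
    finally have 2: "L2ip g (tens \<mu> u u) \<le> G * t" .
    \<comment> \<open>Young's inequality: the two terms linear in \<open>t\<close> together consume
      exactly the quartic term \<open>t\<^sup>2\<close>.\<close>
    have 3: "2 * ((L' * D) * t) \<le> (L' * D)\<^sup>2 + t\<^sup>2" "2 * (G * t) \<le> G\<^sup>2 + t\<^sup>2"
      using sum_squares_bound[of "L' * D" t] sum_squares_bound[of G t] by (simp_all add: mult.assoc)
    have "w \<le> (L' * D)\<^sup>2 + G\<^sup>2" using e 1 2 3 by linarith
    then have "sqrt w \<le> sqrt ((L' * D)\<^sup>2 + G\<^sup>2)" by (rule real_sqrt_le_mono)
    then show ?thesis using W_norm_nonneg[of u] by (simp add: w_def)
  qed
  then show ?thesis using that by blast
qed

lemma tendsto_abs_bounded: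
  fixes l :: "nat \<Rightarrow> real"
  assumes "l \<longlonglongrightarrow> x"
  obtains B where "B > 0" "\<And>n. \<bar>l n\<bar> \<le> B"
  using convergent_imp_Bseq[OF convergentI[OF assms]] by (auto elim!: BseqE)

text \<open>Each of the two equations is tested with \<open>w\<close> on its own, so the Cauchy
  estimate rests on boundedness of \<open>h\<close> and smallness of \<open>w\<close> in L2.
  Convergence of \<open>h\<close> enters afterwards, when the limit is shown to be extremal.\<close>

theorem extremal_compact:
  assumes l: "l \<longlonglongrightarrow> lam"
    and g: "\<And>n. square_integrable (g n)" "square_integrable g'" "(\<lambda>n. L2n (\<lambda>p. g n p - g' p)) \<longlonglongrightarrow> 0"
    and u: "\<And>n. extremal (l n) (g n) (u n)"
  obtains r :: "nat \<Rightarrow> nat" and v where "strict_mono r" "extremal lam g' v"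
    "(\<lambda>n. W_norm V (\<lambda>x. u (r n) x - v x)) \<longlonglongrightarrow> 0"
proof -
  obtain L where L: "L > 0" "\<And>n. \<bar>l n\<bar> \<le> L" by (rule tendsto_abs_bounded[OF l]) blast
  obtain G where G: "G > 0" "\<And>n. \<bar>L2n (g n)\<bar> \<le> G" by (rule tendsto_abs_bounded[OF L2n_tendsto[OF g]]) blast
  obtain A0 where A0: "\<And>lam g u. \<bar>lam\<bar> \<le> L \<Longrightarrow> square_integrable g \<Longrightarrow> L2n g \<le> G \<Longrightarrow> extremal lam g u \<Longrightarrow> W_norm V u \<le> A0"
    by (rule extremal_bounded) blast
  define A where "A = A0 + 1"
  have uW: "u n \<in> W_space V" for n using u by (auto simp: extremal_def)
  have uA0: "W_norm V (u n) \<le> A0" for n by (rule A0[OF L(2) g(1) _ u]) (use G(2)[of n] in simp)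
  have uA: "W_norm V (u n) \<le> A" for n using uA0[of n] by (simp add: A_def)
  have A: "A > 0" using uA0[of 0] W_norm_nonneg[of "u 0"] by (simp add: A_def)
  obtain C where C: "C > 0" "\<And>u v. u \<in> W_space V \<Longrightarrow> v \<in> W_space V \<Longrightarrow> L2n (tens \<mu> u v) \<le> C * (W_norm V u * W_norm V v)"
    by (rule tens_bound) blast
  obtain r :: "nat \<Rightarrow> nat" where r: "strict_mono r"
    "\<And>e. e > 0 \<Longrightarrow> \<exists>M. \<forall>m\<ge>M. \<forall>n\<ge>M. L2n (\<lambda>x. u (r m) x - u (r n) x) < e"
    by (rule W_compact[where u = u and K = A, OF uW uA]) blast
  define h where "h n p = g (r n) p - tens \<mu> (u (r n)) (u (r n)) p" for n p
  have sh: "square_integrable (h n)" for n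
    unfolding h_def by (rule sqi_diff[OF g(1) tens_sqi[OF uW uW]])
  define H where "H = G + C * (A * A)"
  have H: "H > 0" using G(1) C(1) A by (auto simp: H_def intro!: add_pos_pos)
  have hH: "L2n (h n) \<le> H" for n
  proof -
    have "L2n (h n) \<le> L2n (g (r n)) + L2n (tens \<mu> (u (r n)) (u (r n)))"
      unfolding h_def
      using L2n_triangle[OF g(1) sqi_minus(1)[OF tens_sqi[OF uW uW]]] sqi_minus(2)[OF tens_sqi[OF uW uW]] by simp
    also have "\<dots> \<le> G + C * (W_norm V (u (r n)) * W_norm V (u (r n)))"
      using G(2)[of "r n"] C(2)[OF uW uW, of "r n" "r n"] by simp
    also have "\<dots> \<le> H" unfolding H_def
      using C(1) A by (intro add_left_mono mult_left_mono mult_mono uA W_norm_nonneg) auto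
    finally show ?thesis .
  qed
  have el: "L2ip (F (u (r n))) (F \<phi>) = l (r n) * L2ip (u (r n)) \<phi> + L2ip (h n) (tens \<mu> \<phi> (u (r n)))"
    if "\<phi> \<in> W_space V" for n \<phi>
    using u[of "r n"] that unfolding extremal_def bil_def h_def by (auto simp: algebra_simps)
  have "\<exists>M. \<forall>m\<ge>M. \<forall>n\<ge>M. W_norm V (\<lambda>x. u (r m) x - u (r n) x) < e" if e: "e > 0" for e
  proof -
    \<comment> \<open>Each equation contributes an eigenvalue term and a kernel term of size at most
      \<open>s\<close>, which makes \<open>4 * s = e\<^sup>2 / 2\<close> for both.\<close>
    define s where "s = e\<^sup>2 / 8"
    have s: "s > 0" using e by (simp add: s_def)
    define q where "q = s / H"
    have q: "q > 0" using s H by (simp add: q_def)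
    \<comment> \<open>The budget for the squared norm of \<open>tens \<mu> w (u (r k))\<close> is
      \<open>q\<^sup>2\<close>, with \<open>H * q = s\<close>. One half goes to the \<open>W\<close>
      norms, bounded by \<open>2 * A\<close> and \<open>A\<close>, through \<open>d\<close>; the
      other half goes to the L2 norms through \<open>f\<close>.\<close>
    define d where "d = q\<^sup>2 / 2 / ((2 * A)\<^sup>2 * A\<^sup>2)"
    have AA: "(2 * A)\<^sup>2 * A\<^sup>2 > 0" using A by simp
    have d: "d > 0" "d * ((2 * A)\<^sup>2 * A\<^sup>2) = q\<^sup>2 / 2" using q AA by (simp_all add: d_def)
    from tens_interpolation[OF d(1)] obtain K where K: "K > 0" "\<And>u v. u \<in> W_space V \<Longrightarrow> v \<in> W_space V \<Longrightarrow>
      (L2n (tens \<mu> u v))\<^sup>2 \<le> d * ((W_norm V u)\<^sup>2 * (W_norm V v)\<^sup>2) + K * ((L2n u)\<^sup>2 * (L2n v)\<^sup>2)" by blast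
    define B where "B = A / sqrt aV"
    have B: "B > 0" using A aV_pos by (simp add: B_def)
    have uB: "L2n (u n) \<le> B" for n
      using L2_le_W[OF uW, of n] divide_right_mono[OF uA[of n], of "sqrt aV"] aV_pos by (simp add: B_def)
    \<comment> \<open>The first entry gives \<open>K * (f * B)\<^sup>2 \<le> q\<^sup>2 / 2\<close>,
      the second \<open>L * (B * f) \<le> s\<close>.\<close>
    define f where "f = min (q / sqrt (2 * K) / B) (s / (L * B))"
    have f: "f > 0" using q K(1) B s L(1) by (simp add: f_def)
    obtain M where M: "\<And>m n. m \<ge> M \<Longrightarrow> n \<ge> M \<Longrightarrow> L2n (\<lambda>x. u (r m) x - u (r n) x) < f"
      using r(2)[OF f] by blast
    show ?thesis
    proof (intro exI[of _ M] allI impI)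
      fix m n assume mn: "M \<le> m" "M \<le> n"
      define w where "w x = u (r m) x - u (r n) x" for x
      have w: "w \<in> W_space V" unfolding w_def by (rule W_diff(1)[OF uW uW])
      have wA: "W_norm V w \<le> 2 * A"
        unfolding w_def using W_norm_diff_le[OF uW uW, of "r m" "r n"] uA[of "r m"] uA[of "r n"] by linarith
      have wf: "L2n w < f" unfolding w_def by (rule M[OF mn])
      have small: "\<bar>l (r k) * L2ip (u (r k)) w + L2ip (h k) (tens \<mu> w (u (r k)))\<bar> \<le> 2 * s" for k
      proof -
        have "\<bar>L2ip (u (r k)) w\<bar> \<le> L2n (u (r k)) * L2n w" by (rule L2_Cauchy_Schwarz[OF W_D(2)[OF uW] W_D(2)[OF w]])
        also have "\<dots> \<le> B * f" using wf B by (intro mult_mono uB) auto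
        finally have "\<bar>l (r k) * L2ip (u (r k)) w\<bar> \<le> L * (B * f)"
          unfolding abs_mult using L(1) by (intro mult_mono L) auto
        also have "\<dots> \<le> s"
        proof -
          have "f \<le> s / (L * B)" by (simp add: f_def)
          then have "f * (L * B) \<le> s" using L(1) B by (simp add: pos_le_divide_eq)
          then show ?thesis by (simp add: mult_ac)
        qed
        finally have 1: "\<bar>l (r k) * L2ip (u (r k)) w\<bar> \<le> s" .
        have "(L2n (tens \<mu> w (u (r k))))\<^sup>2 \<le> d * ((W_norm V w)\<^sup>2 * (W_norm V (u (r k)))\<^sup>2) + K * ((L2n w)\<^sup>2 * (L2n (u (r k)))\<^sup>2)"
          by (rule K(2)[OF w uW])
        also have "\<dots> \<le> d * ((2 * A)\<^sup>2 * A\<^sup>2) + K * (f\<^sup>2 * B\<^sup>2)"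
        proof -
          have "(W_norm V w)\<^sup>2 * (W_norm V (u (r k)))\<^sup>2 \<le> (2 * A)\<^sup>2 * A\<^sup>2"
            by (intro mult_mono power_mono wA uA W_norm_nonneg zero_le_power2)
          moreover have "(L2n w)\<^sup>2 * (L2n (u (r k)))\<^sup>2 \<le> f\<^sup>2 * B\<^sup>2"
            by (intro mult_mono power_mono less_imp_le[OF wf] uB L2n_nonneg zero_le_power2)
          ultimately show ?thesis
            by (rule add_mono[OF mult_left_mono[OF _ less_imp_le[OF d(1)]] mult_left_mono[OF _ less_imp_le[OF K(1)]]])
        qed
        also have "K * (f\<^sup>2 * B\<^sup>2) \<le> q\<^sup>2 / 2"
        proof -
          have "f \<le> q / sqrt (2 * K) / B" by (simp add: f_def)
          then have "f * B \<le> q / sqrt (2 * K)" using B by (simp only: pos_le_divide_eq)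
          then have "(f * B)\<^sup>2 \<le> (q / sqrt (2 * K))\<^sup>2" using f B by (intro power_mono) auto
          also have "\<dots> = q\<^sup>2 / (2 * K)" using K(1) by (simp add: power_divide)
          finally have "K * (f * B)\<^sup>2 \<le> K * (q\<^sup>2 / (2 * K))" using K(1) by (intro mult_left_mono) auto
          then show ?thesis using K(1) by (simp add: power_mult_distrib)
        qed
        finally have "(L2n (tens \<mu> w (u (r k))))\<^sup>2 \<le> q\<^sup>2" using d(2) by linarith
        then have tq: "L2n (tens \<mu> w (u (r k))) \<le> q" by (rule power2_le_imp_le[OF _ less_imp_le[OF q]])
        have "\<bar>L2ip (h k) (tens \<mu> w (u (r k)))\<bar> \<le> L2n (h k) * L2n (tens \<mu> w (u (r k)))"
          by (rule L2_Cauchy_Schwarz[OF sh tens_sqi[OF w uW]])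
        also have "\<dots> \<le> H * q" by (intro mult_mono hH tq less_imp_le[OF H] L2n_nonneg)
        also have "\<dots> = s" using H by (simp add: q_def)
        finally show ?thesis using 1 by linarith
      qed
      have "(W_norm V w)\<^sup>2 = L2ip (F w) (F w)" by (simp add: L2ip_self W_norm_eq)
      also have "\<dots> = L2ip (\<lambda>x. F (u (r m)) x - F (u (r n)) x) (F w)"
        by (rule L2ip_cong_AE[OF sqi_diff[OF W_D(5)[OF uW] W_D(5)[OF uW]] W_D(5)[OF w] sqi_meas[OF W_D(5)[OF w]] sqi_meas[OF W_D(5)[OF w]]])
           (use W_diff(2)[OF uW uW, of "r m" "r n"] in \<open>simp_all add: w_def[abs_def]\<close>)
      also have "\<dots> = L2ip (F (u (r m))) (F w) - L2ip (F (u (r n))) (F w)"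
        by (rule L2ip_diff_left[OF W_D(5)[OF uW] W_D(5)[OF uW] W_D(5)[OF w]])
      also have "\<dots> \<le> 4 * s" unfolding el[OF w] using small[of m] small[of n] by linarith
      also have "\<dots> < e\<^sup>2" using e by (simp add: s_def)
      finally have "W_norm V w < e" using e by (intro power_less_imp_less_base[of _ 2 e]) auto
      then show "W_norm V (\<lambda>x. u (r m) x - u (r n) x) < e" by (simp add: w_def[abs_def])
    qed
  qed
  from W_complete[OF uW this] obtain v where v: "v \<in> W_space V" "(\<lambda>n. W_norm V (\<lambda>x. u (r n) x - v x)) \<longlonglongrightarrow> 0" by blast
  have gr: "(\<lambda>n. L2n (\<lambda>p. g (r n) p - g' p)) \<longlonglongrightarrow> 0"
    using LIMSEQ_subseq_LIMSEQ[OF g(3) r(1)] by (simp add: o_def)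
  have lr: "(\<lambda>n. l (r n)) \<longlonglongrightarrow> lam" using LIMSEQ_subseq_LIMSEQ[OF l r(1)] by (simp add: o_def)
  note tc = tens_conv[OF uW v uW v]
  define h' where "h' p = g' p - tens \<mu> v v p" for p
  have sh': "square_integrable h'" unfolding h'_def by (rule sqi_diff[OF g(2) tens_sqi[OF v(1) v(1)]])
  have hc: "(\<lambda>n. L2n (\<lambda>p. h n p - h' p)) \<longlonglongrightarrow> 0"
  proof (rule Lim_null_comparison[OF always_eventually], rule allI)
    fix n
    note s1 = sqi_diff[OF g(1)[of "r n"] g(2)] and s2 = sqi_diff[OF tens_sqi[OF uW[of "r n"] uW[of "r n"]] tens_sqi[OF v(1) v(1)]]
    have "(\<lambda>p. h n p - h' p) = (\<lambda>p. (g (r n) p - g' p) + - (tens \<mu> (u (r n)) (u (r n)) p - tens \<mu> v v p))"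
      by (auto simp: h_def h'_def fun_eq_iff)
    then show "norm (L2n (\<lambda>p. h n p - h' p)) \<le> L2n (\<lambda>p. g (r n) p - g' p) + L2n (\<lambda>p. tens \<mu> (u (r n)) (u (r n)) p - tens \<mu> v v p)"
      using L2n_triangle[OF s1 sqi_minus(1)[OF s2]] sqi_minus(2)[OF s2] by simp
  next
    show "(\<lambda>n. L2n (\<lambda>p. g (r n) p - g' p) + L2n (\<lambda>p. tens \<mu> (u (r n)) (u (r n)) p - tens \<mu> v v p)) \<longlonglongrightarrow> 0"
      using tendsto_add[OF gr tc] by simp
  qed
  have "extremal lam g' v"
    unfolding extremal_def h'_def[symmetric]
  proof (intro conjI ballI v(1))
    fix \<phi> assume \<phi>: "\<phi> \<in> W_space V"
    have "(\<lambda>n. bil (h n) (u (r n)) \<phi>) \<longlonglongrightarrow> bil h' v \<phi>"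
      by (rule bil_tendsto[OF sh sh' hc uW v \<phi> \<phi> W_conv_const[OF \<phi>]])
    moreover have "bil (h n) (u (r n)) \<phi> = l (r n) * L2ip (u (r n)) \<phi>" for n
      using el[OF \<phi>] by (simp add: bil_def)
    moreover have "(\<lambda>n. l (r n) * L2ip (u (r n)) \<phi>) \<longlonglongrightarrow> lam * L2ip v \<phi>"
      by (intro tendsto_mult lr L2ip_tendsto W_D(2) uW v \<phi> L2_conv_const W_conv(2))
    ultimately show "bil h' v \<phi> = lam * L2ip v \<phi>" using LIMSEQ_unique by fastforce
  next
    fix \<psi> assume \<psi>: "\<psi> \<in> W_space V"
    have l1: "(\<lambda>n. qf (h n) \<psi>) \<longlonglongrightarrow> qf h' \<psi>"
      unfolding qf_eq_bil by (rule bil_tendsto[OF sh sh' hc \<psi> \<psi> W_conv_const[OF \<psi>] \<psi> \<psi> W_conv_const[OF \<psi>]])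
    have l2: "(\<lambda>n. l (r n) * (L2n \<psi>)\<^sup>2) \<longlonglongrightarrow> lam * (L2n \<psi>)\<^sup>2" by (intro tendsto_intros lr)
    have "l (r n) * (L2n \<psi>)\<^sup>2 \<le> qf (h n) \<psi>" for n
      using u[of "r n"] \<psi> unfolding extremal_def h_def by blast
    then show "lam * (L2n \<psi>)\<^sup>2 \<le> qf h' \<psi>" by (intro LIMSEQ_le[OF l2 l1]) blast
  qed
  then show ?thesis using that r(1) v(2) by blast
qed

text \<open>Parameter and kernel vary together, so that the two sequential statements are the cases
  of a constant parameter and of a constant kernel.\<close>

lemma uhat_subsequence:
  assumes l: "l \<longlonglongrightarrow> lam" and lam: "lam \<ge> lambda1 V \<mu> \<rho>'"
    and \<rho>: "\<And>n. \<rho> n \<in> L2_mu \<mu>" "\<rho>' \<in> L2_mu \<mu>" "(\<lambda>n. L2_mu_norm \<mu> (\<lambda>x y. \<rho> n x y - \<rho>' x y)) \<longlonglongrightarrow> 0"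
    and u: "\<And>n. is_uhat V \<mu> (l n) (\<rho> n) (u n)"
  shows "\<exists>(r :: nat \<Rightarrow> nat) v. strict_mono r \<and> weak_solution V \<mu> lam \<rho>' v
    \<and> (\<lambda>n. W_norm V (\<lambda>x. u (r n) x - v x)) \<longlonglongrightarrow> 0
    \<and> (lam > lambda1 V \<mu> \<rho>' \<longrightarrow> principal_solution V \<mu> lam \<rho>' v)
    \<and> (lam = lambda1 V \<mu> \<rho>' \<longrightarrow> ae_zero v)"
proof -
  note k = L2_mu_kern[OF \<rho>(1)] and k' = L2_mu_kern[OF \<rho>(2)]
  obtain r :: "nat \<Rightarrow> nat" and v where rv: "strict_mono r" "extremal lam (kern \<mu> \<rho>') v"
    "(\<lambda>n. W_norm V (\<lambda>x. u (r n) x - v x)) \<longlonglongrightarrow> 0"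
    by (rule extremal_compact[OF l k k' \<rho>(3)[unfolded L2_mu_norm_diff] is_uhat_imp_extremal[OF k u]]) blast
  have "is_uhat V \<mu> lam \<rho>' v" by (rule extremal_imp_is_uhat[OF k' rv(2)])
  then have "(lam > lambda1 V \<mu> \<rho>' \<longrightarrow> principal_solution V \<mu> lam \<rho>' v) \<and> (lam = lambda1 V \<mu> \<rho>' \<longrightarrow> ae_zero v)"
    by (auto simp: is_uhat_def)
  with rv extremal_weak_solution[OF k' rv(2)] show ?thesis by blast
qed

text \<open>A subsequence converges to some extremal function, and uniqueness identifies it with
  \<open>v\<close> or \<open>- v\<close>. A single index suffices, since continuity is proved by
  contradiction from sequences that stay at distance \<open>e\<close>.\<close>

lemma W_dist_mod_sign_tendsto:
  assumes l: "l \<longlonglongrightarrow> lam"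
    and \<rho>: "\<And>n. \<rho> n \<in> L2_mu \<mu>" "\<rho>' \<in> L2_mu \<mu>" "(\<lambda>n. L2_mu_norm \<mu> (\<lambda>x y. \<rho> n x y - \<rho>' x y)) \<longlonglongrightarrow> 0"
    and u: "\<And>n. is_uhat V \<mu> (l n) (\<rho> n) (u n)" and v: "is_uhat V \<mu> lam \<rho>' v" and e: "e > 0"
  shows "\<exists>n. W_dist_mod_sign V (u n) v < e"
proof -
  note k = L2_mu_kern[OF \<rho>(1)] and k' = L2_mu_kern[OF \<rho>(2)]
  obtain r :: "nat \<Rightarrow> nat" and w where rw: "strict_mono r" "extremal lam (kern \<mu> \<rho>') w"
    "(\<lambda>n. W_norm V (\<lambda>x. u (r n) x - w x)) \<longlonglongrightarrow> 0"
    by (rule extremal_compact[OF l k k' \<rho>(3)[unfolded L2_mu_norm_diff] is_uhat_imp_extremal[OF k u]]) blast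
  note ev = is_uhat_imp_extremal[OF k' v]
  have uW: "u n \<in> W_space V" for n using is_uhat_imp_extremal[OF k u] by (simp add: extremal_def)
  have wW: "w \<in> W_space V" and vW: "v \<in> W_space V" using rw(2) ev by (simp_all add: extremal_def)
  note [measurable] = W_D(6)[OF uW] W_D(6)[OF wW] W_D(6)[OF vW]
  obtain n where n: "W_norm V (\<lambda>x. u (r n) x - w x) < e"
    using LIMSEQ_D[OF rw(3) e] by (auto simp: abs_of_nonneg[OF W_norm_nonneg])
  note d = W_diff(1)[OF uW[of "r n"] wW]
  from extremal_unique[OF k' ev rw(2)]
  show ?thesis
  proof
    assume eq: "AE x in lborel. v x = w x"
    have "W_norm V (\<lambda>x. u (r n) x - v x) = W_norm V (\<lambda>x. u (r n) x - w x)"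
      by (rule W_cong(3)[OF d]) (use eq in \<open>auto elim: eventually_mono\<close>)
    then show ?thesis using n by (auto simp: W_dist_mod_sign_def intro!: exI[of _ "r n"])
  next
    assume eq: "AE x in lborel. v x = - w x"
    have "W_norm V (\<lambda>x. u (r n) x + v x) = W_norm V (\<lambda>x. u (r n) x - w x)"
      by (rule W_cong(3)[OF d]) (use eq in \<open>auto elim: eventually_mono\<close>)
    then show ?thesis using n by (auto simp: W_dist_mod_sign_def intro!: exI[of _ "r n"])
  qed
qed

lemma L2_mu_norm_self: "L2_mu_norm \<mu> (\<lambda>x y. \<rho> x y - \<rho> x y) = 0"
  unfolding L2_mu_norm_diff by (simp add: L2n_def)

lemma L2_mu_norm_nonneg: "0 \<le> L2_mu_norm \<mu> \<rho>"
  by (simp add: L2_mu_norm_def case_prod_beta')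

text \<open>A failure for every \<delta>, taken at the reciprocals of \<open>Suc n\<close>, would
  give kernels tending to \<open>\<rho>'\<close> whose solutions all keep distance at least
  \<open>e\<close> from \<open>v\<close>.\<close>

lemma uhat_continuous_kernel:
  assumes \<rho>': "\<rho>' \<in> L2_mu \<mu>" and v: "is_uhat V \<mu> lam \<rho>' v" and e: "e > 0"
  shows "\<exists>\<delta>>0. \<forall>\<rho> u. \<rho> \<in> L2_mu \<mu> \<and> L2_mu_norm \<mu> (\<lambda>x y. \<rho> x y - \<rho>' x y) < \<delta> \<and> is_uhat V \<mu> lam \<rho> u \<longrightarrow>
    W_dist_mod_sign V u v < e"
proof (rule ccontr)
  assume "\<not> ?thesis"
  then have n: "\<exists>\<rho> u. \<rho> \<in> L2_mu \<mu> \<and> L2_mu_norm \<mu> (\<lambda>x y. \<rho> x y - \<rho>' x y) < \<delta> \<and> is_uhat V \<mu> lam \<rho> u \<and>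
    \<not> W_dist_mod_sign V u v < e" if "\<delta> > 0" for \<delta>
    using that by blast
  have "\<forall>n. \<exists>\<rho> u. \<rho> \<in> L2_mu \<mu> \<and> L2_mu_norm \<mu> (\<lambda>x y. \<rho> x y - \<rho>' x y) < inverse (real (Suc n)) \<and> is_uhat V \<mu> lam \<rho> u \<and>
    \<not> W_dist_mod_sign V u v < e" by (intro allI n) simp
  then obtain \<rho> u where \<rho>: "\<And>n. \<rho> n \<in> L2_mu \<mu>"
    "\<And>n. L2_mu_norm \<mu> (\<lambda>x y. \<rho> n x y - \<rho>' x y) < inverse (real (Suc n))"
    "\<And>n. is_uhat V \<mu> lam (\<rho> n) (u n)" "\<And>n. \<not> W_dist_mod_sign V (u n) v < e" by metis
  have "(\<lambda>n. L2_mu_norm \<mu> (\<lambda>x y. \<rho> n x y - \<rho>' x y)) \<longlonglongrightarrow> 0"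
    by (rule Lim_null_comparison[OF always_eventually LIMSEQ_inverse_real_of_nat])
       (use \<rho>(2) in \<open>auto simp: abs_of_nonneg[OF L2_mu_norm_nonneg] intro: less_imp_le\<close>)
  from W_dist_mod_sign_tendsto[where l = "\<lambda>n. lam", OF tendsto_const \<rho>(1) \<rho>' this \<rho>(3) v e]
  show False using \<rho>(4) by blast
qed

lemma uhat_continuous_parameter:
  assumes \<rho>': "\<rho>' \<in> L2_mu \<mu>" and v: "is_uhat V \<mu> lam \<rho>' v" and e: "e > 0"
  shows "\<exists>\<delta>>0. \<forall>lam' u. \<bar>lam' - lam\<bar> < \<delta> \<and> is_uhat V \<mu> lam' \<rho>' u \<longrightarrow> W_dist_mod_sign V u v < e"
proof (rule ccontr)
  assume "\<not> ?thesis"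
  then have n: "\<exists>lam' u. \<bar>lam' - lam\<bar> < \<delta> \<and> is_uhat V \<mu> lam' \<rho>' u \<and> \<not> W_dist_mod_sign V u v < e" if "\<delta> > 0" for \<delta>
    using that by blast
  have "\<forall>n. \<exists>lam' u. \<bar>lam' - lam\<bar> < inverse (real (Suc n)) \<and> is_uhat V \<mu> lam' \<rho>' u \<and> \<not> W_dist_mod_sign V u v < e"
    by (intro allI n) simp
  then obtain l u where l: "\<And>n. \<bar>l n - lam\<bar> < inverse (real (Suc n))"
    "\<And>n. is_uhat V \<mu> (l n) \<rho>' (u n)" "\<And>n. \<not> W_dist_mod_sign V (u n) v < e" by metis
  have "(\<lambda>n. l n - lam) \<longlonglongrightarrow> 0"
    by (rule Lim_null_comparison[OF always_eventually LIMSEQ_inverse_real_of_nat])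
       (use l(1) in \<open>auto intro: less_imp_le\<close>)
  then have "l \<longlonglongrightarrow> lam" by (rule LIM_zero_cancel)
  moreover have "(\<lambda>n. L2_mu_norm \<mu> (\<lambda>x y. \<rho>' x y - \<rho>' x y)) \<longlonglongrightarrow> 0" unfolding L2_mu_norm_self by simp
  ultimately show False
    using W_dist_mod_sign_tendsto[where \<rho> = "\<lambda>n. \<rho>'" and l = l and u = u, OF _ \<rho>' \<rho>' _ l(2) v e] l(3) by blast
qed

end

theorem theorem1p3:
  fixes V :: "'a::euclidean_space \<Rightarrow> real" and a_V \<mu> :: real
  assumes "continuous_on UNIV V"
    and "filterlim V at_top at_infinity"
    and "a_V > 0" and "\<forall>x. V x \<ge> a_V"
    and "0 < \<mu>" and "\<mu> < min (real DIM('a)) 4"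
  shows
    "(\<forall>\<rho>bar lam \<rho> u.
        \<rho>bar \<in> L2_mu \<mu> \<and> lam \<ge> lambda1 V \<mu> \<rho>bar
        \<and> (\<forall>n. \<rho> n \<in> L2_mu \<mu>)
        \<and> (\<lambda>n. L2_mu_norm \<mu> (\<lambda>x y. \<rho> n x y - \<rho>bar x y)) \<longlonglongrightarrow> 0
        \<and> (\<forall>n. is_uhat V \<mu> lam (\<rho> n) (u n)) \<longrightarrow>
        (\<exists>(r :: nat \<Rightarrow> nat) ubar. strict_mono r
           \<and> weak_solution V \<mu> lam \<rho>bar ubar
           \<and> (\<lambda>n. W_norm V (\<lambda>x. u (r n) x - ubar x)) \<longlonglongrightarrow> 0
           \<and> (lam > lambda1 V \<mu> \<rho>bar \<longrightarrow> principal_solution V \<mu> lam \<rho>bar ubar)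
           \<and> (lam = lambda1 V \<mu> \<rho>bar \<longrightarrow> ae_zero ubar)))
   \<and> (\<forall>\<rho>bar lam l u.
        \<rho>bar \<in> L2_mu \<mu> \<and> lam \<ge> lambda1 V \<mu> \<rho>bar
        \<and> l \<longlonglongrightarrow> lam
        \<and> (\<forall>n. is_uhat V \<mu> (l n) \<rho>bar (u n)) \<longrightarrow>
        (\<exists>(r :: nat \<Rightarrow> nat) ubar. strict_mono r
           \<and> weak_solution V \<mu> lam \<rho>bar ubar
           \<and> (\<lambda>n. W_norm V (\<lambda>x. u (r n) x - ubar x)) \<longlonglongrightarrow> 0
           \<and> (lam > lambda1 V \<mu> \<rho>bar \<longrightarrow> principal_solution V \<mu> lam \<rho>bar ubar)
           \<and> (lam = lambda1 V \<mu> \<rho>bar \<longrightarrow> ae_zero ubar)))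
   \<and> (\<forall>\<rho>bar lam ubar.
        \<rho>bar \<in> L2_mu \<mu> \<and> lam \<ge> lambda1 V \<mu> \<rho>bar \<and> is_uhat V \<mu> lam \<rho>bar ubar \<longrightarrow>
        (\<forall>\<epsilon>>0. \<exists>\<delta>>0. \<forall>\<rho> u.
           \<rho> \<in> L2_mu \<mu> \<and> L2_mu_norm \<mu> (\<lambda>x y. \<rho> x y - \<rho>bar x y) < \<delta> \<and> is_uhat V \<mu> lam \<rho> u \<longrightarrow>
           W_dist_mod_sign V u ubar < \<epsilon>))
   \<and> (\<forall>\<rho>bar lam ubar.
        \<rho>bar \<in> L2_mu \<mu> \<and> lam \<ge> lambda1 V \<mu> \<rho>bar \<and> is_uhat V \<mu> lam \<rho>bar ubar \<longrightarrow>
        (\<forall>\<epsilon>>0. \<exists>\<delta>>0. \<forall>lam' u.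
           lam' \<ge> lambda1 V \<mu> \<rho>bar \<and> \<bar>lam' - lam\<bar> < \<delta> \<and> is_uhat V \<mu> lam' \<rho>bar u \<longrightarrow>
           W_dist_mod_sign V u ubar < \<epsilon>))"
proof -
  interpret exchange_setting V a_V \<mu>
    by unfold_locales (use assms in auto)
  show ?thesis
  proof (intro conjI allI impI; elim conjE)
    fix \<rho>bar lam and \<rho> :: "nat \<Rightarrow> 'a \<Rightarrow> 'a \<Rightarrow> real" and u
    assume "\<rho>bar \<in> L2_mu \<mu>" "lam \<ge> lambda1 V \<mu> \<rho>bar" "\<forall>n. \<rho> n \<in> L2_mu \<mu>"
      "(\<lambda>n. L2_mu_norm \<mu> (\<lambda>x y. \<rho> n x y - \<rho>bar x y)) \<longlonglongrightarrow> 0" "\<forall>n. is_uhat V \<mu> lam (\<rho> n) (u n)"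
    then show "\<exists>(r :: nat \<Rightarrow> nat) ubar. strict_mono r \<and> weak_solution V \<mu> lam \<rho>bar ubar
           \<and> (\<lambda>n. W_norm V (\<lambda>x. u (r n) x - ubar x)) \<longlonglongrightarrow> 0
           \<and> (lam > lambda1 V \<mu> \<rho>bar \<longrightarrow> principal_solution V \<mu> lam \<rho>bar ubar)
           \<and> (lam = lambda1 V \<mu> \<rho>bar \<longrightarrow> ae_zero ubar)"
      by (intro uhat_subsequence[where l = "\<lambda>_. lam" and \<rho> = \<rho>]) auto
  next
    fix \<rho>bar lam l u
    assume "\<rho>bar \<in> L2_mu \<mu>" "lam \<ge> lambda1 V \<mu> \<rho>bar" "l \<longlonglongrightarrow> lam" "\<forall>n. is_uhat V \<mu> (l n) \<rho>bar (u n)"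
    then show "\<exists>(r :: nat \<Rightarrow> nat) ubar. strict_mono r \<and> weak_solution V \<mu> lam \<rho>bar ubar
           \<and> (\<lambda>n. W_norm V (\<lambda>x. u (r n) x - ubar x)) \<longlonglongrightarrow> 0
           \<and> (lam > lambda1 V \<mu> \<rho>bar \<longrightarrow> principal_solution V \<mu> lam \<rho>bar ubar)
           \<and> (lam = lambda1 V \<mu> \<rho>bar \<longrightarrow> ae_zero ubar)"
      using L2_mu_norm_self[of \<rho>bar]
      by (intro uhat_subsequence[where l = l and \<rho> = "\<lambda>_. \<rho>bar"]) auto
  next
    fix \<rho>bar lam ubar and \<epsilon> :: real
    assume "\<rho>bar \<in> L2_mu \<mu>" "is_uhat V \<mu> lam \<rho>bar ubar" "\<epsilon> > 0"
    then show "\<exists>\<delta>>0. \<forall>\<rho> u. \<rho> \<in> L2_mu \<mu> \<and> L2_mu_norm \<mu> (\<lambda>x y. \<rho> x y - \<rho>bar x y) < \<delta> \<and> is_uhat V \<mu> lam \<rho> u \<longrightarrow>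
           W_dist_mod_sign V u ubar < \<epsilon>"
      by (rule uhat_continuous_kernel)
  next
    fix \<rho>bar lam ubar and \<epsilon> :: real
    assume "\<rho>bar \<in> L2_mu \<mu>" "is_uhat V \<mu> lam \<rho>bar ubar" "\<epsilon> > 0"
    then obtain \<delta> where "\<delta> > 0"
      "\<And>lam' u. \<bar>lam' - lam\<bar> < \<delta> \<and> is_uhat V \<mu> lam' \<rho>bar u \<Longrightarrow> W_dist_mod_sign V u ubar < \<epsilon>"
      using uhat_continuous_parameter by blast
    then show "\<exists>\<delta>>0. \<forall>lam' u. lam' \<ge> lambda1 V \<mu> \<rho>bar \<and> \<bar>lam' - lam\<bar> < \<delta> \<and> is_uhat V \<mu> lam' \<rho>bar u \<longrightarrow>
           W_dist_mod_sign V u ubar < \<epsilon>"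
      by blast
  qed
qed

end
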